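(* For every $n\ge1$, $[\mathrm{VAL}_n]=[\mathrm{SAT}_n]\cap[\overline{\mathrm{SAT}}_n]$.
   Context: $\Sigma=\{0,1\}$, $\Sigma^*$ the finite nonempty binary strings; for $x\in\Sigma^m$, $\pi_1(x)=x_1$. $\mathbb{P}_+\Sigma=\{\{0\},\{1\},\Sigma\}$. A promise problem is $\phi:\Sigma^*\to\mathbb{P}_+\Sigma$; a problem $\psi:\Sigma^*\to\Sigma$ is identified with $x\mapsto\{\psi(x)\}$. $\phi_1\propto\phi_2$ means there is a polynomial-time computable $\mu:\Sigma^*\to\Sigma^*$ with $\phi_1(x)\supseteq\phi_2(\mu(x))$ for all $x$; $[\phi]=\{\phi_1:\phi_1\propto\phi\}$. Level-$n$ problems: the input encodes (e.g. dimensions in binary plus a Boolean formula) $f:\Sigma^{m_1}\times\dots\times\Sigma^{m_n}\to\Sigma$, written $f(x,y^{(1)},\dots,y^{(n-1)})$ with $x\in\Sigma^{m_1}$; $f_x$ is $f$ with $x$ fixed. For a constant $c$, $\mathrm{SAT}_0(c)=\overline{\mathrm{SAT}}_0(c)=c$; for $n\ge1$, $\mathrm{SAT}_n(f)=1\iff\exists x:\overline{\mathrm{SAT}}_{n-1}(f_x)=1$, $\overline{\mathrm{SAT}}_n(f)=1\iff\forall x,\ \mathrm{SAT}_{n-1}(f_x)=1$, and $\mathrm{VAL}_n(f)=\{\pi_1x:\overline{\mathrm{SAT}}_{n-1}(f_x)=1\}$ if $\mathrm{SAT}_n(f)=1$, and $\Sigma$ otherwise. *)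

theory Defs
  imports Main
begin

text \<open>Binary strings are bool lists (False = 0, True = 1).  The paper's Sigma^* consists
of the nonempty strings; the empty list plays no role (reductions are only constrained
on nonempty inputs and must produce nonempty outputs).  A value of a promise problem is a
nonempty subset of bool: {False}, {True} or UNIV.\<close>

definition promise_problem :: "(bool list \<Rightarrow> bool set) \<Rightarrow> bool" where
  "promise_problem \<phi> \<longleftrightarrow> (\<forall>x. \<phi> x \<noteq> {})"

datatype sym = Bl | S0 | S1
datatype dir = MvL | MvN | MvR

text \<open>A machine is a transition function; state 0 is the start state, state 1 the halting
state; well-formed machines use only the finitely many states below Q.\<close>
type_synonym tm = "nat \<Rightarrow> sym \<Rightarrow> nat \<times> sym \<times> dir"
type_synonym config = "nat \<times> sym list \<times> sym list"

definition tm_wf :: "nat \<Rightarrow> tm \<Rightarrow> bool" where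
  "tm_wf Q \<delta> \<longleftrightarrow> 2 \<le> Q \<and> (\<forall>q<Q. \<forall>a. fst (\<delta> q a) < Q)"

text \<open>Configuration (q, ls, rs): ls is the tape left of the head (reversed), rs starts
at the head cell; missing cells are blank.\<close>
fun tm_step :: "tm \<Rightarrow> config \<Rightarrow> config" where
  "tm_step \<delta> (q, ls, rs) =
    (if q = 1 then (q, ls, rs) else
      (let a = (case rs of [] \<Rightarrow> Bl | c # _ \<Rightarrow> c);
           (q', b, d) = \<delta> q a;
           rs' = b # tl rs
       in case d of
            MvL \<Rightarrow> (case ls of [] \<Rightarrow> (q', [], Bl # rs') | l # ls' \<Rightarrow> (q', ls', l # rs'))
          | MvN \<Rightarrow> (q', ls, rs')
          | MvR \<Rightarrow> (q', b # ls, tl rs)))"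

definition sym_of :: "bool \<Rightarrow> sym" where
  "sym_of b = (if b then S1 else S0)"

definition tm_init :: "bool list \<Rightarrow> config" where
  "tm_init x = (0, [], map sym_of x)"

definition tm_output :: "config \<Rightarrow> bool list" where
  "tm_output c = map (\<lambda>s. s = S1) (takeWhile (\<lambda>s. s \<noteq> Bl) (snd (snd c)))"

definition poly_time_computable :: "(bool list \<Rightarrow> bool list) \<Rightarrow> bool" where
  "poly_time_computable \<mu> \<longleftrightarrow>
    (\<exists>Q \<delta> (c::nat) (k::nat). tm_wf Q \<delta> \<and>
      (\<forall>x. \<exists>t. t \<le> c * (length x + 1) ^ k \<and>
              fst ((tm_step \<delta> ^^ t) (tm_init x)) = 1 \<and>
              tm_output ((tm_step \<delta> ^^ t) (tm_init x)) = \<mu> x))"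

definition reduces :: "(bool list \<Rightarrow> bool set) \<Rightarrow> (bool list \<Rightarrow> bool set) \<Rightarrow> bool" where
  "reduces \<phi>1 \<phi>2 \<longleftrightarrow> (\<exists>\<mu>. poly_time_computable \<mu> \<and>
      (\<forall>x. x \<noteq> [] \<longrightarrow> \<mu> x \<noteq> [] \<and> \<phi>2 (\<mu> x) \<subseteq> \<phi>1 x))"

definition cls :: "(bool list \<Rightarrow> bool set) \<Rightarrow> (bool list \<Rightarrow> bool set) set" where
  "cls \<phi> = {\<phi>1. promise_problem \<phi>1 \<and> reduces \<phi>1 \<phi>}"

datatype form = FVar nat | FNeg form | FAnd form form | FOr form form

fun feval :: "form \<Rightarrow> bool list \<Rightarrow> bool" where
  "feval (FVar v) a = a ! v"
| "feval (FNeg f) a = (\<not> feval f a)"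
| "feval (FAnd f g) a = (feval f a \<and> feval g a)"
| "feval (FOr f g) a = (feval f a \<or> feval g a)"

fun fvars_below :: "nat \<Rightarrow> form \<Rightarrow> bool" where
  "fvars_below N (FVar v) = (v < N)"
| "fvars_below N (FNeg f) = fvars_below N f"
| "fvars_below N (FAnd f g) = (fvars_below N f \<and> fvars_below N g)"
| "fvars_below N (FOr f g) = (fvars_below N f \<and> fvars_below N g)"

fun bits :: "nat \<Rightarrow> bool list" where
  "bits n = (if n = 0 then [] else bits (n div 2) @ [odd n])"

text \<open>Intermediate alphabet {0,1,2,3}; each symbol is written with two bits.\<close>
definition numenc :: "nat \<Rightarrow> nat list" where
  "numenc n = map (\<lambda>b. if b then 1 else 0) (bits n) @ [2]"

fun fenc :: "form \<Rightarrow> nat list" where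
  "fenc (FVar v) = 0 # numenc v"
| "fenc (FNeg f) = 1 # fenc f"
| "fenc (FAnd f g) = 2 # fenc f @ fenc g"
| "fenc (FOr f g) = 3 # fenc f @ fenc g"

definition sym_bits :: "nat \<Rightarrow> bool list" where
  "sym_bits s = [s div 2 = 1, s mod 2 = 1]"

text \<open>An instance: the number of blocks n, the dimensions m_1..m_n (in binary), and a
formula whose variable v denotes position v of the concatenation x y1 ... y(n-1).\<close>
definition inst_enc :: "nat list \<times> form \<Rightarrow> bool list" where
  "inst_enc e = concat (map sym_bits
      (numenc (length (fst e)) @ concat (map numenc (fst e)) @ fenc (snd e)))"

definition decode :: "bool list \<Rightarrow> (nat list \<times> form) option" where
  "decode w = (if \<exists>e. inst_enc e = w then Some (THE e. inst_enc e = w) else None)"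

text \<open>Valid level-n instance: n dimensions, all at least 1, and all variables in range.
Strings that are not valid level-n instances are read as the constant-0 function.\<close>
definition level_inst :: "nat \<Rightarrow> bool list \<Rightarrow> (nat list \<times> form) option" where
  "level_inst n w = (case decode w of
      Some (ms, f) \<Rightarrow> (if length ms = n \<and> (\<forall>m\<in>set ms. 1 \<le> m) \<and> fvars_below (sum_list ms) f
                      then Some (ms, f) else None)
    | None \<Rightarrow> None)"

text \<open>sat ms g / cosat ms g: g is a Boolean function of the concatenation of blocks of
lengths ms; with no blocks left, g is the constant g [].\<close>
fun sat :: "nat list \<Rightarrow> (bool list \<Rightarrow> bool) \<Rightarrow> bool"
and cosat :: "nat list \<Rightarrow> (bool list \<Rightarrow> bool) \<Rightarrow> bool" where
  "sat [] g = g []"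
| "sat (m # ms) g = (\<exists>x. length x = m \<and> cosat ms (\<lambda>y. g (x @ y)))"
| "cosat [] g = g []"
| "cosat (m # ms) g = (\<forall>x. length x = m \<longrightarrow> sat ms (\<lambda>y. g (x @ y)))"

definition val :: "nat list \<Rightarrow> (bool list \<Rightarrow> bool) \<Rightarrow> bool set" where
  "val ms g = (if sat ms g
     then {hd x | x. length x = hd ms \<and> cosat (tl ms) (\<lambda>y. g (x @ y))}
     else UNIV)"

definition SAT :: "nat \<Rightarrow> bool list \<Rightarrow> bool set" where
  "SAT n w = (case level_inst n w of Some (ms, f) \<Rightarrow> {sat ms (feval f)} | None \<Rightarrow> {False})"

definition coSAT :: "nat \<Rightarrow> bool list \<Rightarrow> bool set" where
  "coSAT n w = (case level_inst n w of Some (ms, f) \<Rightarrow> {cosat ms (feval f)} | None \<Rightarrow> {False})"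

definition VAL :: "nat \<Rightarrow> bool list \<Rightarrow> bool set" where
  "VAL n w = (case level_inst n w of Some (ms, f) \<Rightarrow> val ms (feval f) | None \<Rightarrow> UNIV)"

end

theory Submission
  imports Defs
begin

text \<open>
  \<open>VAL n\<close> reduces to both decision problems: conjoin the first bit of \<open>x\<close> to \<open>f\<close> and ask \<open>SAT\<close>,
  or ask \<open>coSAT\<close> about \<open>x\<^sub>1 \<or> \<not> f\<close>.  Conversely, given reductions of a problem to \<open>SAT\<close> (with
  instance \<open>f\<close>) and to \<open>coSAT\<close> (with instance \<open>g\<close>), ask \<open>VAL\<close> about
  \<open>h = (c \<and> f) \<or> (\<not> c \<and> \<not> g)\<close>, where the selector \<open>c\<close> is a new first bit of the first block:
  a witness of \<open>h\<close> starting with 1 shows \<open>SAT f = 1\<close>, one starting with 0 shows \<open>coSAT g = 0\<close>,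
  and if there is none then \<open>SAT f = 0\<close> and \<open>coSAT g = 1\<close>, so that both values are allowed.
  To give \<open>f\<close> and \<open>g\<close> common dimensions without arithmetic on the variable numbers, all blocks
  are widened to the same power of two; the new number of a variable is then its block number followed by
  the padded old number.  Strings that do not encode an instance stand for the constant 0 and have to
  be recognised, because \<open>f\<close> and \<open>g\<close> can be invalid independently.

  Polynomial-time computability is transferred from Turing machines to programs on finitely many
  stacks and then to functions on encoded data types, which are closed under composition and
  iteration with polynomially bounded intermediate results.
\<close>

text \<open>The coSAT instance enters \<open>h\<close> negated because both branches must have the
  shape "some first block \<open>x\<close> makes \<open>cosat\<close> true of the rest":
  \<open>coSAT g = 0\<close> says exactly this about the negation of \<open>g\<close>. Since the
  selector lies in the first block, it is fixed before the remaining quantifiers are evaluated, and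
  \<open>VAL\<close> reads it off a witness. The exponent \<open>L\<close> of the common dimension
  is the number of two-bit symbols of both inputs together. The sum of the dimensions may be
  exponential in the input length, but it is at most \<open>2 ^ L\<close>, and in binary the widened
  dimension takes only \<open>L + 3\<close> symbols. Numbers of type \<open>nat\<close> are unary in
  the programs, so the numbers inside instances are never formed there; they are compared and
  subtracted as digit lists. Formulas are not parsed into trees either: in prefix notation a counter
  of missing subformulas decides well-formedness, so one fold over the symbols both checks and
  renames. Only the block prefixes \<open>2 * i + 1\<close> with \<open>i < n\<close> need
  arithmetic, and for fixed \<open>n\<close> they form a finite table.\<close>

section \<open>Stack programs with a continuation-based step semantics\<close>

type_synonym store = "nat \<Rightarrow> bool list"

datatype com = Skip | Push nat bool | Branch nat com com com | Loop nat com com | Seq com com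

fun target :: "com \<Rightarrow> nat option" where
  "target (Push r b) = Some r"
| "target (Branch r e f g) = Some r"
| "target (Loop r f g) = Some r"
| "target _ = None"

fun pushed :: "com \<Rightarrow> bool option" where
  "pushed (Push r b) = Some b"
| "pushed _ = None"

text \<open>The next continuation depends only on the current one and on the bit observed or pushed,
  not on the store. This lets the finite control of a Turing machine hold the continuation.\<close>

fun nxt :: "com list \<Rightarrow> bool option \<Rightarrow> com list" where
  "nxt [] v = []"
| "nxt (Skip # K) v = K"
| "nxt (Push r b # K) v = K"
| "nxt (Seq a b # K) v = a # b # K"
| "nxt (Branch r e f g # K) v = (case v of None \<Rightarrow> e | Some b \<Rightarrow> if b then g else f) # K"
| "nxt (Loop r f g # K) v =
    (case v of None \<Rightarrow> K | Some b \<Rightarrow> (if b then g else f) # Loop r f g # K)"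

fun cstep :: "com list \<times> store \<Rightarrow> com list \<times> store" where
  "cstep ([], \<sigma>) = ([], \<sigma>)"
| "cstep (c # K, \<sigma>) = (case target c of
      None \<Rightarrow> (nxt (c # K) None, \<sigma>)
    | Some r \<Rightarrow> (case pushed c of
        Some b \<Rightarrow> (nxt (c # K) (Some b), \<sigma>(r := b # \<sigma> r))
      | None \<Rightarrow> (case \<sigma> r of
          [] \<Rightarrow> (nxt (c # K) None, \<sigma>)
        | b # bs \<Rightarrow> (nxt (c # K) (Some b), \<sigma>(r := bs)))))"

text \<open>\<open>t\<close> is only an upper bound, so branches of different cost can share it. The
  step count \<open>t'\<close> is chosen before \<open>K\<close>, which makes runs composable under
  any continuation.\<close>

definition runs :: "com \<Rightarrow> store \<Rightarrow> nat \<Rightarrow> store \<Rightarrow> bool" where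
  "runs c \<sigma> t \<sigma>' \<longleftrightarrow> (\<exists>t'\<le>t. \<forall>K. (cstep ^^ t') (c # K, \<sigma>) = (K, \<sigma>'))"

lemma runs_mono: "runs c \<sigma> t \<sigma>' \<Longrightarrow> t \<le> u \<Longrightarrow> runs c \<sigma> u \<sigma>'"
  unfolding runs_def by (meson le_trans)

lemma funpow_Suc_app: "(f ^^ Suc t) x = (f ^^ t) (f x)"
  by (simp add: funpow_swap1)

lemma funpow_trans: "(f ^^ s) x = y \<Longrightarrow> (f ^^ t) y = z \<Longrightarrow> (f ^^ (s + t)) x = z"
  by (subst add.commute) (simp add: funpow_add)

lemma runs_Skip: "runs Skip \<sigma> 1 \<sigma>"
  unfolding runs_def by (rule exI[of _ 1]) simp

lemma runs_Push: "runs (Push r b) \<sigma> 1 (\<sigma>(r := b # \<sigma> r))"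
  unfolding runs_def by (rule exI[of _ 1]) simp

lemma runs_Seq:
  assumes "runs a \<sigma> s \<sigma>1" "runs b \<sigma>1 t \<sigma>2"
  shows "runs (Seq a b) \<sigma> (Suc (s + t)) \<sigma>2"
proof -
  obtain s' where s: "s' \<le> s" "\<And>K. (cstep ^^ s') (a # K, \<sigma>) = (K, \<sigma>1)"
    using assms(1) unfolding runs_def by blast
  obtain t' where t: "t' \<le> t" "\<And>K. (cstep ^^ t') (b # K, \<sigma>1) = (K, \<sigma>2)"
    using assms(2) unfolding runs_def by blast
  have "(cstep ^^ (s' + t')) (a # b # K, \<sigma>) = (K, \<sigma>2)" for K
    by (rule funpow_trans[OF s(2) t(2)])
  then have "(cstep ^^ Suc (s' + t')) (Seq a b # K, \<sigma>) = (K, \<sigma>2)" for K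
    by (subst funpow_Suc_app) simp
  then show ?thesis
    unfolding runs_def using s(1) t(1) by (intro exI[of _ "Suc (s' + t')"]) simp
qed

lemma runs_first:
  assumes "\<And>K. cstep (c # K, \<sigma>) = (c' # K, \<sigma>1)" "runs c' \<sigma>1 t \<sigma>2"
  shows "runs c \<sigma> (Suc t) \<sigma>2"
proof -
  obtain t' where t: "t' \<le> t" "\<And>K. (cstep ^^ t') (c' # K, \<sigma>1) = (K, \<sigma>2)"
    using assms(2) unfolding runs_def by blast
  have "(cstep ^^ Suc t') (c # K, \<sigma>) = (K, \<sigma>2)" for K
    by (simp only: funpow_Suc_app assms(1) t(2))
  then show ?thesis unfolding runs_def using t(1) by (intro exI[of _ "Suc t'"]) simp
qed

lemma runs_Branch:
  "\<sigma> r = [] \<Longrightarrow> runs e \<sigma> t \<sigma>' \<Longrightarrow> runs (Branch r e f g) \<sigma> (Suc t) \<sigma>'"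
  "\<sigma> r = False # xs \<Longrightarrow> runs f (\<sigma>(r := xs)) t \<sigma>' \<Longrightarrow> runs (Branch r e f g) \<sigma> (Suc t) \<sigma>'"
  "\<sigma> r = True # xs \<Longrightarrow> runs g (\<sigma>(r := xs)) t \<sigma>' \<Longrightarrow> runs (Branch r e f g) \<sigma> (Suc t) \<sigma>'"
  by (rule runs_first; simp)+

lemma runs_Loop_Nil: "\<sigma> r = [] \<Longrightarrow> runs (Loop r f g) \<sigma> 1 \<sigma>"
  unfolding runs_def by (rule exI[of _ 1]) simp

lemma runs_Loop_Cons:
  assumes "\<sigma> r = b # xs" "runs (if b then g else f) (\<sigma>(r := xs)) s \<sigma>1" "runs (Loop r f g) \<sigma>1 t \<sigma>2"
  shows "runs (Loop r f g) \<sigma> (Suc (s + t)) \<sigma>2"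
proof -
  obtain s' where s: "s' \<le> s" "\<And>K. (cstep ^^ s') ((if b then g else f) # K, \<sigma>(r := xs)) = (K, \<sigma>1)"
    using assms(2) unfolding runs_def by blast
  obtain t' where t: "t' \<le> t" "\<And>K. (cstep ^^ t') (Loop r f g # K, \<sigma>1) = (K, \<sigma>2)"
    using assms(3) unfolding runs_def by blast
  have "(cstep ^^ (s' + t')) ((if b then g else f) # Loop r f g # K, \<sigma>(r := xs)) = (K, \<sigma>2)" for K
    by (rule funpow_trans[OF s(2) t(2)])
  then have "(cstep ^^ Suc (s' + t')) (Loop r f g # K, \<sigma>) = (K, \<sigma>2)" for K
    by (subst funpow_Suc_app) (simp add: assms(1))
  then show ?thesis
    unfolding runs_def using s(1) t(1) by (intro exI[of _ "Suc (s' + t')"]) simp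
qed

lemma length_cstep: "length (snd (cstep (K, \<sigma>)) r) \<le> length (\<sigma> r) + 1"
  by (cases K) (auto split: option.split list.split)

lemma length_funpow_cstep: "length (snd ((cstep ^^ t) (K, \<sigma>)) r) \<le> length (\<sigma> r) + t"
proof (induction t)
  case (Suc t)
  obtain K' \<sigma>' where "(cstep ^^ t) (K, \<sigma>) = (K', \<sigma>')" by fastforce
  with Suc length_cstep[of K' \<sigma>' r] show ?case by simp
qed simp

text \<open>A step pushes at most one bit. This is the source of all size bounds on results of
  programs.\<close>

lemma runs_length: "runs c \<sigma> t \<sigma>' \<Longrightarrow> length (\<sigma>' r) \<le> length (\<sigma> r) + t"
  unfolding runs_def by (metis add_left_mono le_trans length_funpow_cstep snd_conv)

section \<open>Compilation to Turing machines\<close>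

text \<open>An intermediate machine model: states of any type and a tape indexed by all integers, so
  that head movements can be calculated as displacements.\<close>

type_synonym 's fconfig = "'s \<times> int \<times> (int \<Rightarrow> sym)"

fun shift :: "dir \<Rightarrow> int" where
  "shift MvL = -1" | "shift MvN = 0" | "shift MvR = 1"

fun fstep :: "('s \<Rightarrow> sym \<Rightarrow> 's \<times> sym \<times> dir) \<Rightarrow> 's fconfig \<Rightarrow> 's fconfig" where
  "fstep d (s, p, T) = (case d s (T p) of (s', b, v) \<Rightarrow> (s', p + shift v, T(p := b)))"

text \<open>\<open>Find\<close> walks from the bottom of the target stack to the first blank beyond
  its top, \<open>Take\<close> inspects the cell just before that blank, \<open>Back v\<close> walks
  to the origin, and \<open>Home v\<close> waits on cell \<open>-1\<close> with the observed bit
  \<open>v\<close>. The integer in \<open>St\<close> is the displacement still to be walked before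
  the phase acts.\<close>

datatype phase = At | Find | Take | Back "bool option" | Home "bool option"
datatype mst = St "com list" phase int | Fin

text \<open>Element \<open>i\<close> of stack \<open>r\<close>, counted from the bottom, is stored at cell \<open>pos m r i\<close>: stack 0
  occupies the cells \<open>0, 1, \<dots>\<close>, where input and output are expected, and the stacks \<open>1, \<dots>, m\<close>
  are interleaved to the left.  The cells \<open>org r\<close> just before the bottoms always stay blank, and
  the head rests on cell \<open>-1\<close> between the commands.\<close>
definition org :: "nat \<Rightarrow> int" where "org r = - 1 - int r"
definition dlt :: "nat \<Rightarrow> nat \<Rightarrow> int" where "dlt m r = (if r = 0 then 1 else - int m)"
definition pos :: "nat \<Rightarrow> nat \<Rightarrow> nat \<Rightarrow> int" where "pos m r i = org r + dlt m r * (int i + 1)"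

text \<open>From cell \<open>-1\<close> the displacement \<open>org r + dlt m r + 1\<close> leads to
  \<open>pos m r 0\<close>, and \<open>- 1 - org r\<close> leads from the origin back to
  \<open>-1\<close>. In \<open>Take\<close> a blank means that the cell is the origin, so the stack
  is empty. The last move to the right puts the head on cell 0, where the output begins.\<close>

fun act :: "nat \<Rightarrow> com list \<Rightarrow> phase \<Rightarrow> sym \<Rightarrow> mst \<times> sym \<times> dir" where
  "act m K At s = (case K of
      [] \<Rightarrow> (Fin, s, MvR)
    | c # _ \<Rightarrow> (case target c of
        None \<Rightarrow> (St (nxt K None) At 0, s, MvN)
      | Some r \<Rightarrow> (St K Find (org r + dlt m r + 1), s, MvN)))"
| "act m K Find s = (let r = the (target (hd K)) in
    if s \<noteq> Bl then (St K Find (dlt m r), s, MvN)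
    else (case pushed (hd K) of
        Some b \<Rightarrow> (St K (Back (Some b)) (- dlt m r), sym_of b, MvN)
      | None \<Rightarrow> (St K Take (- dlt m r), s, MvN)))"
| "act m K Take s = (let r = the (target (hd K)) in
    if s = Bl then (St K (Home None) (- 1 - org r), s, MvN)
    else (St K (Back (Some (s = S1))) (- dlt m r), Bl, MvN))"
| "act m K (Back v) s = (let r = the (target (hd K)) in
    if s \<noteq> Bl then (St K (Back v) (- dlt m r), s, MvN)
    else (St K (Home v) (- 1 - org r), s, MvN))"
| "act m K (Home v) s = (St (nxt K v) At 0, s, MvN)"

fun mdelta :: "nat \<Rightarrow> mst \<Rightarrow> sym \<Rightarrow> mst \<times> sym \<times> dir" where
  "mdelta m Fin s = (Fin, s, MvN)"
| "mdelta m (St K p z) s =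
    (if z > 0 then (St K p (z - 1), s, MvR)
     else if z < 0 then (St K p (z + 1), s, MvL)
     else act m K p s)"

text \<open>Stacks grow away from their origins, hence \<open>rev\<close>: push and pop change one
  cell and shift nothing.\<close>

definition rep :: "nat \<Rightarrow> store \<Rightarrow> (int \<Rightarrow> sym) \<Rightarrow> bool" where
  "rep m \<sigma> T \<longleftrightarrow> (\<forall>r\<le>m. T (org r) = Bl \<and>
     (\<forall>i. T (pos m r i) = (if i < length (\<sigma> r) then sym_of (rev (\<sigma> r) ! i) else Bl)))"

lemma pos_Suc: "pos m r (Suc i) = pos m r i + dlt m r"
  by (simp add: pos_def algebra_simps)

lemma pos_0: "pos m r 0 = org r + dlt m r"
  by (simp add: pos_def)

lemma pos_neg: "r \<noteq> 0 \<Longrightarrow> pos m r i < - 1 - int m"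
proof -
  assume "r \<noteq> 0"
  then have "pos m r i = - 1 - int r - int m * (int i + 1)" by (simp add: pos_def org_def dlt_def)
  moreover have "int m * (int i + 1) \<ge> int m" by (simp add: algebra_simps)
  ultimately show ?thesis using \<open>r \<noteq> 0\<close> by linarith
qed

lemma pos_nonneg: "pos m 0 i = int i"
  by (simp add: pos_def org_def dlt_def)

lemma pos_noteq_org: "r \<le> m \<Longrightarrow> s \<le> m \<Longrightarrow> pos m r i \<noteq> org s"
  using pos_neg[of r m i] pos_nonneg[of m i] by (cases "r = 0") (auto simp: org_def)

text \<open>Stack 0 lies on the nonnegative cells and the others on negative ones. Among the others
  the address determines \<open>r + m * i\<close> with \<open>1 \<le> r \<le> m\<close>, which is
  division with remainder by \<open>m\<close> once \<open>r\<close> is lowered by one.\<close>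

lemma pos_inj:
  assumes "r \<le> m" "s \<le> m" "pos m r i = pos m s j"
  shows "r = s \<and> i = j"
proof (cases "r = 0 \<or> s = 0")
  case True
  then show ?thesis
    using assms pos_neg[of r m i] pos_neg[of s m j] pos_nonneg[of m i] pos_nonneg[of m j]
    by (cases "r = 0"; cases "s = 0") auto
next
  case False
  have "int r + int m * (int i + 1) = int s + int m * (int j + 1)"
    using assms(3) False by (simp add: pos_def org_def dlt_def)
  then have "int (r + m * i) = int (s + m * j)"
    by (simp add: algebra_simps)
  then have e: "r + m * i = s + m * j" by (simp only: of_nat_eq_iff)
  obtain r' s' where rs: "r = Suc r'" "s = Suc s'" using False by (auto simp: gr0_conv_Suc)
  have "(r' + m * i) div m = (s' + m * j) div m" using e rs by simp
  moreover have "r' < m" "s' < m" using assms rs by auto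
  ultimately have "i = j" by simp
  then show ?thesis using e by simp
qed

lemma sym_of_neq_Bl [simp]: "sym_of b \<noteq> Bl" by (simp add: sym_of_def)
lemma sym_of_eq_S1 [simp]: "(sym_of b = S1) = b" by (simp add: sym_of_def)

lemma rep_org: "rep m \<sigma> T \<Longrightarrow> r \<le> m \<Longrightarrow> T (org r) = Bl"
  by (simp add: rep_def)

lemma rep_pos: "rep m \<sigma> T \<Longrightarrow> r \<le> m \<Longrightarrow>
    T (pos m r i) = (if i < length (\<sigma> r) then sym_of (rev (\<sigma> r) ! i) else Bl)"
  by (simp add: rep_def)

lemma rep_push:
  assumes "rep m \<sigma> T" "r \<le> m"
  shows "rep m (\<sigma>(r := b # \<sigma> r)) (T(pos m r (length (\<sigma> r)) := sym_of b))"
  unfolding rep_def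
proof (intro allI impI conjI)
  fix s assume s: "s \<le> m"
  show "(T(pos m r (length (\<sigma> r)) := sym_of b)) (org s) = Bl"
    using pos_noteq_org[OF assms(2) s, of "length (\<sigma> r)"] rep_org[OF assms(1) s] by simp
  fix i
  show "(T(pos m r (length (\<sigma> r)) := sym_of b)) (pos m s i) =
     (if i < length ((\<sigma>(r := b # \<sigma> r)) s) then sym_of (rev ((\<sigma>(r := b # \<sigma> r)) s) ! i) else Bl)"
    using pos_inj[OF s assms(2), of i "length (\<sigma> r)"] rep_pos[OF assms(1) s, of i]
    by (auto simp: nth_append less_Suc_eq)
qed

lemma rep_pop:
  assumes "rep m \<sigma> T" "r \<le> m" "\<sigma> r = b # bs"
  shows "rep m (\<sigma>(r := bs)) (T(pos m r (length bs) := Bl))"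
  unfolding rep_def
proof (intro allI impI conjI)
  fix s assume s: "s \<le> m"
  show "(T(pos m r (length bs) := Bl)) (org s) = Bl"
    using pos_noteq_org[OF assms(2) s, of "length bs"] rep_org[OF assms(1) s] by simp
  fix i
  show "(T(pos m r (length bs) := Bl)) (pos m s i) =
     (if i < length ((\<sigma>(r := bs)) s) then sym_of (rev ((\<sigma>(r := bs)) s) ! i) else Bl)"
    using pos_inj[OF s assms(2), of i "length bs"] rep_pos[OF assms(1) s, of i] assms(3)
    by (auto simp: nth_append less_Suc_eq)
qed

abbreviation mrun :: "nat \<Rightarrow> nat \<Rightarrow> mst fconfig \<Rightarrow> mst fconfig" where
  "mrun m t \<equiv> fstep (mdelta m) ^^ t"

lemma mrun_move: "mrun m (nat \<bar>z\<bar>) (St K p z, q, T) = (St K p 0, q + z, T)"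
proof (induction "nat \<bar>z\<bar>" arbitrary: z q)
  case (Suc t)
  define z' where "z' = (if z > 0 then z - 1 else z + 1)"
  have z: "z \<noteq> 0" using Suc(2) by auto
  then have t: "t = nat \<bar>z'\<bar>" using Suc(2) by (auto simp: z'_def)
  have "fstep (mdelta m) (St K p z, q, T) = (St K p z', q + (z - z'), T)"
    using z by (auto simp: z'_def)
  then have "mrun m (Suc t) (St K p z, q, T) = (St K p 0, q + (z - z') + z', T)"
    using Suc(1)[OF t, of "q + (z - z')"] t by (simp only: funpow_Suc_app)
  then show ?case using Suc(2) by simp
qed simp

lemma mrun_act_move:
  assumes "act m K p (T q) = (St K p' z, b, MvN)"
  shows "mrun m (Suc (nat \<bar>z\<bar>)) (St K p 0, q, T) = (St K p' 0, q + z, T(q := b))"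
  using assms by (simp only: funpow_Suc_app) (simp add: mrun_move)

lemma mrun_find:
  assumes "target c = Some r" "\<And>j. i \<le> j \<Longrightarrow> j < i + n \<Longrightarrow> T (pos m r j) \<noteq> Bl"
  shows "mrun m (n * Suc (nat \<bar>dlt m r\<bar>)) (St (c # K) Find 0, pos m r i, T)
    = (St (c # K) Find 0, pos m r (i + n), T)"
  using assms(2)
proof (induction n arbitrary: i)
  case (Suc n)
  have "mrun m (Suc (nat \<bar>dlt m r\<bar>)) (St (c # K) Find 0, pos m r i, T)
      = (St (c # K) Find 0, pos m r i + dlt m r, T(pos m r i := T (pos m r i)))"
    by (rule mrun_act_move) (use Suc(2)[of i] assms(1) in simp)
  then have 1: "mrun m (Suc (nat \<bar>dlt m r\<bar>)) (St (c # K) Find 0, pos m r i, T)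
      = (St (c # K) Find 0, pos m r (Suc i), T)" by (simp only: pos_Suc fun_upd_triv)
  have 2: "mrun m (n * Suc (nat \<bar>dlt m r\<bar>)) (St (c # K) Find 0, pos m r (Suc i), T)
    = (St (c # K) Find 0, pos m r (Suc i + n), T)"
    by (rule Suc(1)) (simp add: Suc(2))
  show ?case using funpow_trans[OF 1 2] by (simp only: mult_Suc add_Suc_right add_Suc)
qed simp

text \<open>The starting cell \<open>pos m r n - dlt m r\<close> is element \<open>n - 1\<close>, or
  the origin if \<open>n = 0\<close>; this form covers both. The blank at the origin stops the
  walk.\<close>

lemma mrun_back:
  assumes "target c = Some r" "\<And>j. j < n \<Longrightarrow> T (pos m r j) \<noteq> Bl" "T (org r) = Bl"
  shows "mrun m (n * Suc (nat \<bar>dlt m r\<bar>) + Suc (nat \<bar>- 1 - org r\<bar>))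
      (St (c # K) (Back v) 0, pos m r n - dlt m r, T) = (St (c # K) (Home v) 0, - 1, T)"
  using assms(2)
proof (induction n)
  case 0
  have "mrun m (Suc (nat \<bar>- 1 - org r\<bar>)) (St (c # K) (Back v) 0, org r, T)
      = (St (c # K) (Home v) 0, org r + (- 1 - org r), T(org r := T (org r)))"
    by (rule mrun_act_move) (use assms in simp)
  then show ?case by (simp add: pos_0)
next
  case (Suc n)
  have e: "pos m r (Suc n) - dlt m r = pos m r n" by (simp add: pos_Suc)
  have 1: "mrun m (Suc (nat \<bar>- dlt m r\<bar>)) (St (c # K) (Back v) 0, pos m r n, T)
      = (St (c # K) (Back v) 0, pos m r n + - dlt m r, T(pos m r n := T (pos m r n)))"
    by (rule mrun_act_move) (use Suc(2)[of n] assms(1) in simp)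
  have 2: "mrun m (n * Suc (nat \<bar>dlt m r\<bar>) + Suc (nat \<bar>- 1 - org r\<bar>))
      (St (c # K) (Back v) 0, pos m r n + - dlt m r, T(pos m r n := T (pos m r n))) = (St (c # K) (Home v) 0, - 1, T)"
    using Suc by simp
  show ?case unfolding e using funpow_trans[OF 1 2]
    by (simp only: mult_Suc add.assoc abs_minus_cancel)
qed

lemma mrun_home: "mrun m 1 (St K (Home v) 0, - 1, T) = (St (nxt K v) At 0, - 1, T)"
  by simp

text \<open>The bound pays for a walk along the stack and back, with at most \<open>m + 2\<close>
  steps per element, plus a fixed number of jumps of length linear in \<open>m\<close>.\<close>

lemma mrun_cstep:
  assumes "rep m \<sigma> T" "\<And>r. target c = Some r \<Longrightarrow> r \<le> m"
    and "\<And>r. r \<le> m \<Longrightarrow> length (\<sigma> r) \<le> L" "cstep (c # K, \<sigma>) = (K', \<sigma>')"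
  shows "\<exists>t\<le>(m + 3) * (2 * L + 8). \<exists>T'.
    mrun m t (St (c # K) At 0, - 1, T) = (St K' At 0, - 1, T') \<and> rep m \<sigma>' T'"
proof (cases "target c")
  case None
  then have "mrun m 1 (St (c # K) At 0, - 1, T) = (St K' At 0, - 1, T)" "\<sigma>' = \<sigma>"
    using assms(4) by auto
  then show ?thesis using assms(1) by (intro exI[of _ 1]) auto
next
  case (Some r)
  let ?d = "Suc (nat \<bar>dlt m r\<bar>)" and ?n = "length (\<sigma> r)" and ?h = "Suc (nat \<bar>- 1 - org r\<bar>)"
  let ?s = "Suc (nat \<bar>org r + dlt m r + 1\<bar>)"
  have r: "r \<le> m" and n: "?n \<le> L" using assms Some by auto
  have "?d \<le> m + 2" "?h \<le> m + 2" "?s \<le> 2 * m + 2"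
    using r by (auto simp: dlt_def org_def)
  have d: "k * ?d \<le> k * (m + 2)" for k by (rule mult_left_mono) (use \<open>?d \<le> m + 2\<close> in auto)
  \<comment> \<open>The total costs of a push, of popping a nonempty stack, and of testing an empty
    one.\<close>
  have bound: "?s + (?n * ?d + (?d + ((k * ?d + ?h) + 1))) \<le> (m + 3) * (2 * L + 8)"
    and bound': "?s + (?n * ?d + (?d + (?d + ((k * ?d + ?h) + 1)))) \<le> (m + 3) * (2 * L + 8)"
    and bound0: "?s + (?n * ?d + (?d + (?h + 1))) \<le> (m + 3) * (2 * L + 8)"
    if "k \<le> ?n" for k
  proof -
    have "k * ?d \<le> L * (m + 2)" "?n * ?d \<le> L * (m + 2)"
      using d[of k] d[of ?n] n that by (meson le_trans mult_le_mono1)+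
    moreover have "(m + 3) * (2 * L + 8) = 2 * (L * (m + 2)) + 2 * L + 8 * m + 24"
      by (simp add: algebra_simps)
    ultimately show "?s + (?n * ?d + (?d + ((k * ?d + ?h) + 1))) \<le> (m + 3) * (2 * L + 8)"
     "?s + (?n * ?d + (?d + (?d + ((k * ?d + ?h) + 1)))) \<le> (m + 3) * (2 * L + 8)"
     "?s + (?n * ?d + (?d + (?h + 1))) \<le> (m + 3) * (2 * L + 8)"
      using \<open>?d \<le> m + 2\<close> \<open>?h \<le> m + 2\<close> \<open>?s \<le> 2 * m + 2\<close> by linarith+
  qed
  have "mrun m ?s (St (c # K) At 0, - 1, T)
      = (St (c # K) Find 0, - 1 + (org r + dlt m r + 1), T(- 1 := T (- 1)))"
  proof -
    have "fstep (mdelta m) (St (c # K) At 0, - 1, T) = (St (c # K) Find (org r + dlt m r + 1), - 1, T)"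
      using Some by simp
    then show ?thesis by (simp only: funpow_Suc_app) (simp add: mrun_move)
  qed
  then have 1: "mrun m ?s (St (c # K) At 0, - 1, T) = (St (c # K) Find 0, pos m r 0, T)"
    by (simp add: pos_0)
  have 2: "mrun m (?n * ?d) (St (c # K) Find 0, pos m r 0, T) = (St (c # K) Find 0, pos m r ?n, T)"
    using mrun_find[OF Some, of 0 ?n T m K] rep_pos[OF assms(1) r] by simp
  have b: "T (pos m r ?n) = Bl" using rep_pos[OF assms(1) r, of ?n] by simp
  note h = mrun_home[of m "c # K"]
  show ?thesis
  proof (cases "pushed c")
    case (Some b')
    let ?T = "T(pos m r ?n := sym_of b')"
    have e: "K' = nxt (c # K) (Some b')" "\<sigma>' = \<sigma>(r := b' # \<sigma> r)"
      using assms(4) Some \<open>target c = Some r\<close> by auto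
    have 3: "mrun m (Suc (nat \<bar>- dlt m r\<bar>)) (St (c # K) Find 0, pos m r ?n, T)
      = (St (c # K) (Back (Some b')) 0, pos m r ?n + - dlt m r, ?T)"
      by (rule mrun_act_move) (use Some \<open>target c = Some r\<close> b in simp)
    have rp: "rep m \<sigma>' ?T" unfolding e by (rule rep_push[OF assms(1) r])
    have "length (\<sigma>' r) = Suc ?n" by (simp add: e(2))
    then have nb: "?T (pos m r j) \<noteq> Bl" if "j < ?n" for j
      using rep_pos[OF rp r, of j] that by (simp del: fun_upd_apply)
    have "mrun m (?n * ?d + ?h) (St (c # K) (Back (Some b')) 0, pos m r ?n - dlt m r, ?T)
       = (St (c # K) (Home (Some b')) 0, - 1, ?T)"
      by (rule mrun_back[OF \<open>target c = Some r\<close> nb rep_org[OF rp r]])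
    then have 4: "mrun m (?n * ?d + ?h) (St (c # K) (Back (Some b')) 0, pos m r ?n + - dlt m r, ?T)
       = (St (c # K) (Home (Some b')) 0, - 1, ?T)" by simp
    have "mrun m (?s + (?n * ?d + (?d + ((?n * ?d + ?h) + 1)))) (St (c # K) At 0, - 1, T) = (St K' At 0, - 1, ?T)"
      using funpow_trans[OF 1 funpow_trans[OF 2 funpow_trans[OF 3 funpow_trans[OF 4 h]]]]
      unfolding e by (simp only: abs_minus_cancel)
    then show ?thesis using rp bound[OF order_refl] by blast
  next
    case None
    have tk: "mrun m (Suc (nat \<bar>- dlt m r\<bar>)) (St (c # K) Find 0, pos m r ?n, T)
      = (St (c # K) Take 0, pos m r ?n + - dlt m r, T(pos m r ?n := T (pos m r ?n)))"
      by (rule mrun_act_move) (use None \<open>target c = Some r\<close> b in simp)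
    show ?thesis
    proof (cases "\<sigma> r")
      case Nil
      have e: "K' = nxt (c # K) None" "\<sigma>' = \<sigma>"
        using assms(4) Nil None \<open>target c = Some r\<close> by auto
      have 4: "mrun m ?h (St (c # K) Take 0, org r, T)
        = (St (c # K) (Home None) 0, org r + (- 1 - org r), T(org r := T (org r)))"
        by (rule mrun_act_move) (use \<open>target c = Some r\<close> rep_org[OF assms(1) r] in simp)
      have find: "mrun m ?d (St (c # K) Find 0, pos m r ?n, T) = (St (c # K) Take 0, org r, T)"
      proof -
        have "pos m r ?n + - dlt m r = org r" using Nil by (simp add: pos_0)
        then show ?thesis using tk by (simp only: fun_upd_triv abs_minus_cancel)
      qed
      have home: "mrun m ?h (St (c # K) Take 0, org r, T) = (St (c # K) (Home None) 0, - 1, T)"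
        using 4 by simp
      have "mrun m (?s + (?n * ?d + (?d + (?h + 1)))) (St (c # K) At 0, - 1, T) = (St K' At 0, - 1, T)"
        using funpow_trans[OF 1 funpow_trans[OF 2 funpow_trans[OF find funpow_trans[OF home h]]]]
        unfolding e .
      then show ?thesis using assms(1) bound0[OF order_refl] e by blast
    next
      case (Cons b' bs)
      let ?k = "length bs" let ?T = "T(pos m r ?k := Bl)"
      have e: "K' = nxt (c # K) (Some b')" "\<sigma>' = \<sigma>(r := bs)"
        using assms(4) Cons None \<open>target c = Some r\<close> by auto
      have rp: "rep m \<sigma>' ?T" unfolding e by (rule rep_pop[OF assms(1) r Cons])
      have "?n = Suc ?k" using Cons by simp
      then have "pos m r ?n + - dlt m r = pos m r ?k" by (simp only: pos_Suc add_uminus_conv_diff add_diff_cancel_right' diff_add_cancel)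
      then have find: "mrun m ?d (St (c # K) Find 0, pos m r ?n, T) = (St (c # K) Take 0, pos m r ?k, T)"
        using tk by (simp only: fun_upd_triv abs_minus_cancel)
      have ss: "T (pos m r ?k) = sym_of b'"
        using rep_pos[OF assms(1) r, of ?k] Cons by (simp add: nth_append)
      have 4: "mrun m (Suc (nat \<bar>- dlt m r\<bar>)) (St (c # K) Take 0, pos m r ?k, T)
        = (St (c # K) (Back (Some b')) 0, pos m r ?k + - dlt m r, ?T)"
        by (rule mrun_act_move) (use \<open>target c = Some r\<close> ss in simp)
      have "length (\<sigma>' r) = ?k" by (simp add: e(2))
      then have nb: "?T (pos m r j) \<noteq> Bl" if "j < ?k" for j
        using rep_pos[OF rp r, of j] that by (simp del: fun_upd_apply)
      have "mrun m (?k * ?d + ?h) (St (c # K) (Back (Some b')) 0, pos m r ?k - dlt m r, ?T)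
         = (St (c # K) (Home (Some b')) 0, - 1, ?T)"
        by (rule mrun_back[OF \<open>target c = Some r\<close> nb rep_org[OF rp r]])
      then have 5: "mrun m (?k * ?d + ?h) (St (c # K) (Back (Some b')) 0, pos m r ?k + - dlt m r, ?T)
         = (St (c # K) (Home (Some b')) 0, - 1, ?T)" by simp
      have "mrun m (?s + (?n * ?d + (?d + (?d + ((?k * ?d + ?h) + 1))))) (St (c # K) At 0, - 1, T)
          = (St K' At 0, - 1, ?T)"
        using funpow_trans[OF 1 funpow_trans[OF 2 funpow_trans[OF find funpow_trans[OF 4 funpow_trans[OF 5 h]]]]]
        unfolding e by (simp only: abs_minus_cancel)
      moreover have "?k \<le> ?n" using Cons by simp
      ultimately show ?thesis using rp bound'[of ?k] by blast
    qed
  qed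
qed

section \<open>The machine for a fixed program has finitely many states\<close>

fun vars_le :: "nat \<Rightarrow> com \<Rightarrow> bool" where
  "vars_le m Skip = True"
| "vars_le m (Push r b) = (r \<le> m)"
| "vars_le m (Branch r e f g) = (r \<le> m \<and> vars_le m e \<and> vars_le m f \<and> vars_le m g)"
| "vars_le m (Loop r f g) = (r \<le> m \<and> vars_le m f \<and> vars_le m g)"
| "vars_le m (Seq a b) = (vars_le m a \<and> vars_le m b)"

lemma vars_le_mono: "vars_le m c \<Longrightarrow> m \<le> n \<Longrightarrow> vars_le n c"
  by (induction c) auto

lemma ex_vars_le: "\<exists>m. vars_le m c"
proof (induction c)
  case (Branch r e f g)
  then obtain i j k where "vars_le i e" "vars_le j f" "vars_le k g" by auto
  then have "vars_le (r + i + j + k) (Branch r e f g)"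
    by (auto elim: vars_le_mono)
  then show ?case by blast
next
  case (Loop r f g)
  then obtain j k where "vars_le j f" "vars_le k g" by auto
  then have "vars_le (r + j + k) (Loop r f g)"
    by (auto elim: vars_le_mono)
  then show ?case by blast
next
  case (Seq f g)
  then obtain j k where "vars_le j f" "vars_le k g" by auto
  then have "vars_le (j + k) (Seq f g)"
    by (auto elim: vars_le_mono)
  then show ?case by blast
qed auto

lemma target_le: "vars_le m c \<Longrightarrow> target c = Some r \<Longrightarrow> r \<le> m"
  by (cases c) auto

lemma nxt_vars_le: "list_all (vars_le m) K \<Longrightarrow> list_all (vars_le m) (nxt K v)"
  by (cases "(K, v)" rule: nxt.cases) (auto split: option.split)

lemma cstep_fst: "\<exists>v. fst (cstep (K, \<sigma>)) = nxt K v"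
  by (cases K) (auto split: option.split list.split)

text \<open>\<open>L + n\<close> bounds all stack heights during the run, since each command adds at
  most one element.\<close>

lemma mrun_csteps:
  assumes "(cstep ^^ n) (K, \<sigma>) = ([], \<sigma>')" "list_all (vars_le m) K" "rep m \<sigma> T"
    and "\<And>r. r \<le> m \<Longrightarrow> length (\<sigma> r) \<le> L"
  shows "\<exists>t\<le>n * ((m + 3) * (2 * (L + n) + 8)). \<exists>T'.
    mrun m t (St K At 0, - 1, T) = (St [] At 0, - 1, T') \<and> rep m \<sigma>' T'"
  using assms
proof (induction n arbitrary: K \<sigma> T L)
  case 0
  then show ?case by auto
next
  case (Suc n)
  show ?case
  proof (cases K)
    case Nil
    have "(cstep ^^ k) ([], \<sigma>) = ([], \<sigma>)" for k by (induction k) auto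
    then have "\<sigma>' = \<sigma>" using Suc.prems(1) Nil by (metis prod.inject)
    then show ?thesis using Nil Suc.prems(3) by (intro exI[of _ 0]) auto
  next
    case (Cons c K')
    obtain K1 \<sigma>1 where st: "cstep (c # K', \<sigma>) = (K1, \<sigma>1)" by fastforce
    have c: "vars_le m c" using Suc.prems(2) Cons by simp
    obtain t1 T1 where t1: "t1 \<le> (m + 3) * (2 * L + 8)"
      "mrun m t1 (St (c # K') At 0, - 1, T) = (St K1 At 0, - 1, T1)" "rep m \<sigma>1 T1"
      using mrun_cstep[OF Suc.prems(3) target_le[OF c] Suc.prems(4) st] by blast
    have "(cstep ^^ n) (K1, \<sigma>1) = ([], \<sigma>')"
      using Suc.prems(1) Cons st by (simp only: funpow_Suc_app)
    moreover have "list_all (vars_le m) K1"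
      using cstep_fst[of "c # K'" \<sigma>] nxt_vars_le Suc.prems(2) Cons st by (metis fst_conv)
    moreover have "length (\<sigma>1 r) \<le> L + 1" if "r \<le> m" for r
      using length_cstep[of "c # K'" \<sigma> r] Suc.prems(4)[OF that] st by simp
    ultimately obtain t2 T2 where t2: "t2 \<le> n * ((m + 3) * (2 * (L + 1 + n) + 8))"
      "mrun m t2 (St K1 At 0, - 1, T1) = (St [] At 0, - 1, T2)" "rep m \<sigma>' T2"
      using Suc.IH[of K1 \<sigma>1 T1 "L + 1"] t1(3) by blast
    have "(m + 3) * (2 * L + 8) \<le> (m + 3) * (2 * (L + Suc n) + 8)" by (rule mult_le_mono2) simp
    then have "t1 \<le> (m + 3) * (2 * (L + Suc n) + 8)" by (rule le_trans[OF t1(1)])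
    moreover have "t2 \<le> n * ((m + 3) * (2 * (L + Suc n) + 8))" using t2(1) by simp
    ultimately have "t1 + t2 \<le> Suc n * ((m + 3) * (2 * (L + Suc n) + 8))"
      unfolding mult_Suc by (rule add_mono)
    then show ?thesis using funpow_trans[OF t1(2) t2(2)] t2(3) Cons by blast
  qed
qed

text \<open>The continuations that can occur while \<open>c\<close> runs in front of
  \<open>K\<close>. They are finitely many because the body of a loop returns to the same
  continuation that started it.\<close>

fun conts :: "com \<Rightarrow> com list \<Rightarrow> com list set" where
  "conts Skip K = {Skip # K}"
| "conts (Push r b) K = {Push r b # K}"
| "conts (Seq a b) K = insert (Seq a b # K) (conts a (b # K) \<union> conts b K)"
| "conts (Branch r e f g) K =
    insert (Branch r e f g # K) (conts e K \<union> conts f K \<union> conts g K)"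
| "conts (Loop r f g) K =
    insert (Loop r f g # K) (conts f (Loop r f g # K) \<union> conts g (Loop r f g # K))"

lemma finite_conts: "finite (conts c K)"
  by (induction c arbitrary: K) auto

lemma conts_self: "c # K \<in> conts c K"
  by (cases c) auto

lemma conts_nxt: "K' \<in> conts c K \<Longrightarrow> nxt K' v \<in> insert K (conts c K)"
proof (induction c arbitrary: K K')
  case (Branch r e f g)
  then show ?case using conts_self
    by (auto split: option.split; blast)
next
  case (Loop r f g)
  then show ?case using conts_self
    by (auto split: option.split)
next
  case (Seq a b)
  then show ?case using conts_self
    by fastforce
qed auto

lemma conts_vars_le:
  "vars_le m c \<Longrightarrow> list_all (vars_le m) K \<Longrightarrow> K' \<in> conts c K \<Longrightarrow> list_all (vars_le m) K'"
proof (induction c arbitrary: K)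
  case (Seq a b)
  then show ?case using Seq.IH(1)[of "b # K"] Seq.IH(2)[of K] by auto
next
  case (Branch r e f g)
  then show ?case using Branch.IH[of K] by auto
next
  case (Loop r f g)
  then show ?case using Loop.IH[of "Loop r f g # K"] by auto
qed auto

text \<open>Outside phase \<open>At\<close> the current command must have a target, which keeps
  \<open>the (target (hd K))\<close> meaningful. The bound \<open>2 * m + 2\<close> covers the
  longest jump, from cell \<open>-1\<close> to the bottom of a stack.\<close>

definition states :: "nat \<Rightarrow> com \<Rightarrow> mst set" where
  "states m c = insert Fin ((\<lambda>(K, p, z). St K p z) `
     {(K, p, z). K \<in> insert [] (conts c []) \<and> (p = At \<or> K \<noteq> [] \<and> target (hd K) \<noteq> None)
        \<and> \<bar>z\<bar> \<le> 2 * int m + 2})"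

lemma in_states: "St K p z \<in> states m c \<longleftrightarrow>
    K \<in> insert [] (conts c []) \<and> (p = At \<or> K \<noteq> [] \<and> target (hd K) \<noteq> None)
        \<and> \<bar>z\<bar> \<le> 2 * int m + 2"
  by (auto simp: states_def image_def)

lemma finite_states: "finite (states m c)"
proof -
  have "range Back = Back ` {None, Some True, Some False}" "range Home = Home ` {None, Some True, Some False}"
    by (auto simp: image_def)
  then have "finite (range Back)" "finite (range Home)" by (metis finite.emptyI finite.insertI finite_imageI)+
  moreover have "(UNIV :: phase set) = {At, Find, Take} \<union> range Back \<union> range Home"
    by (auto simp: image_def) (metis phase.exhaust)
  ultimately have "finite (UNIV :: phase set)" by (metis finite.emptyI finite.insertI finite_UnI)
  then have "finite (insert [] (conts c []) \<times> (UNIV :: phase set) \<times> {- (2 * int m + 2)..2 * int m + 2})"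
    using finite_conts by blast
  then have "finite {(K, p, z). K \<in> insert [] (conts c []) \<and> (p = At \<or> K \<noteq> [] \<and> target (hd K) \<noteq> None)
        \<and> \<bar>z\<bar> \<le> 2 * int m + 2}"
    by (rule rev_finite_subset) auto
  then show ?thesis unfolding states_def by blast
qed

lemma mdelta_states:
  assumes "vars_le m c" "s \<in> states m c"
  shows "fst (mdelta m s a) \<in> states m c"
proof (cases s)
  case Fin
  then show ?thesis by (simp add: states_def)
next
  case (St K p z)
  then have K: "K \<in> insert [] (conts c [])" "p = At \<or> K \<noteq> [] \<and> target (hd K) \<noteq> None"
    "\<bar>z\<bar> \<le> 2 * int m + 2"
    using assms(2) by (auto simp: in_states)
  have nx: "nxt K v \<in> insert [] (conts c [])" for v
    using K(1) conts_nxt[of K c "[]" v] by auto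
  show ?thesis
  proof (cases "z = 0")
    case True
    show ?thesis
    proof (cases "K = [] \<or> target (hd K) = None")
      case True
      then have p: "p = At" using K(2) by auto
      have "Fin \<in> states m c" by (simp add: states_def)
      then show ?thesis using St \<open>z = 0\<close> True p nx[of None]
        by (cases K) (simp_all add: in_states)
    next
      case False
      then obtain c' K' r where e: "K = c' # K'" "target c' = Some r"
        by (cases K) auto
      have "list_all (vars_le m) K" using K(1) assms(1) conts_vars_le[of m c "[]" K] by auto
      then have "r \<le> m" using e target_le by auto
      then have "\<bar>dlt m r\<bar> \<le> 2 * int m + 2" "\<bar>org r + dlt m r + 1\<bar> \<le> 2 * int m + 2"
        "\<bar>- 1 - org r\<bar> \<le> 2 * int m + 2"
        by (auto simp: dlt_def org_def)
      then show ?thesis using St \<open>z = 0\<close> K(1) nx e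
        by (cases p) (auto simp: in_states Let_def split: option.split)
    qed
  next
    case False
    then show ?thesis using St K by (auto simp: in_states)
  qed
qed

section \<open>From integer-indexed tapes to list configurations\<close>

definition look :: "sym list \<Rightarrow> nat \<Rightarrow> sym" where
  "look xs i = (if i < length xs then xs ! i else Bl)"

lemma look_simps [simp]: "look [] i = Bl" "look (x # xs) 0 = x" "look (x # xs) (Suc i) = look xs i"
  by (simp_all add: look_def)

lemma look_tl: "look (tl xs) i = look xs (Suc i)"
  by (cases xs) auto

text \<open>A relation rather than a function, because list configurations may carry explicit blanks
  at their ends.\<close>

definition tape_of :: "int \<Rightarrow> (int \<Rightarrow> sym) \<Rightarrow> sym list \<Rightarrow> sym list \<Rightarrow> bool" where
  "tape_of p T ls rs \<longleftrightarrow> (\<forall>i. T (p + int i) = look rs i) \<and> (\<forall>i. T (p - 1 - int i) = look ls i)"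

lemma tm_step_look:
  "tm_step \<delta> (q, ls, rs) = (if q = 1 then (q, ls, rs) else
     (case \<delta> q (look rs 0) of (q', b, v) \<Rightarrow>
       (case v of MvL \<Rightarrow> (q', tl ls, look ls 0 # b # tl rs)
        | MvN \<Rightarrow> (q', ls, b # tl rs)
        | MvR \<Rightarrow> (q', b # ls, tl rs))))"
  by (auto simp: Let_def split: list.split dir.split prod.split)

lemma tape_of_move:
  assumes "tape_of p T ls rs"
  shows "tape_of (p - 1) (T(p := b)) (tl ls) (look ls 0 # b # tl rs)"
    and "tape_of p (T(p := b)) ls (b # tl rs)"
    and "tape_of (p + 1) (T(p := b)) (b # ls) (tl rs)"
proof -
  have R: "T (p + int i) = look rs i" and L: "T (p - 1 - int i) = look ls i" for i
    using assms by (auto simp: tape_of_def)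
  have R': "T (p + (1 + int i)) = look (tl rs) i" and L': "T (p - 2 - int i) = look (tl ls) i" for i
    using R[of "Suc i"] L[of "Suc i"] by (simp_all add: look_tl algebra_simps)
  have "(T(p := b)) (p + int i) = look (b # tl rs) i" for i
    using R' by (cases i) auto
  moreover have "(T(p := b)) (p - 1 - int i) = look ls i" for i
    using L by auto
  ultimately show "tape_of p (T(p := b)) ls (b # tl rs)" by (simp add: tape_of_def)
  have "(T(p := b)) (p - 1 + int i) = look (look ls 0 # b # tl rs) i" for i
  proof (cases i)
    case 0
    then show ?thesis using L[of 0] by simp
  next
    case (Suc j)
    then show ?thesis using R'[of "j - 1"] by (cases j) (auto simp: algebra_simps)
  qed
  moreover have "(T(p := b)) (p - 1 - 1 - int i) = look (tl ls) i" for i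
    using L'[of i] by simp
  ultimately show "tape_of (p - 1) (T(p := b)) (tl ls) (look ls 0 # b # tl rs)"
    by (simp add: tape_of_def)
  have "(T(p := b)) (p + 1 + int i) = look (tl rs) i" for i
    using R'[of i] by (simp add: add.assoc)
  moreover have "(T(p := b)) (p + 1 - 1 - int i) = look (b # ls) i" for i
    using L[of "i - 1"] by (cases i) (auto simp: algebra_simps)
  ultimately show "tape_of (p + 1) (T(p := b)) (b # ls) (tl rs)" by (simp add: tape_of_def)
qed

text \<open>The numbers 0 and 1 are reserved for the start and halting states and the others are
  shifted by 2. Numbers outside the image get an arbitrary transition that respects
  \<open>tm_wf\<close>.\<close>

lemma ex_numbering:
  assumes "finite S" "s0 \<in> S" "h \<in> S" "s0 \<noteq> h" "\<And>s a. s \<in> S \<Longrightarrow> fst (d s a) \<in> S"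
  shows "\<exists>Q \<delta> \<nu>. tm_wf Q \<delta> \<and> \<nu> s0 = 0 \<and> \<nu> h = 1 \<and> (\<forall>s\<in>S. \<nu> s = (1::nat) \<longrightarrow> s = h)
    \<and> (\<forall>s\<in>S. \<forall>a. \<delta> (\<nu> s) a = (\<nu> (fst (d s a)), snd (d s a)))"
proof -
  obtain g where g: "bij_betw g S {0..<card S}"
    using ex_bij_betw_finite_nat[OF assms(1)] by blast
  define \<nu> where "\<nu> s = (if s = s0 then 0 else if s = h then 1 else 2 + g s)" for s
  have inj: "inj_on \<nu> S"
    using g by (auto simp: inj_on_def \<nu>_def bij_betw_def)
  have lt: "\<nu> s < 2 + card S" if "s \<in> S" for s
    using g that by (auto simp: \<nu>_def bij_betw_def)
  define \<delta> where "\<delta> q a = (if q \<in> \<nu> ` S then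
     (let s = inv_into S \<nu> q in (\<nu> (fst (d s a)), snd (d s a))) else (0, a, MvN))" for q a
  have "tm_wf (2 + card S) \<delta>"
    unfolding tm_wf_def \<delta>_def Let_def
    using lt assms(5) by (auto simp: inv_into_into inj)
  moreover have "\<delta> (\<nu> s) a = (\<nu> (fst (d s a)), snd (d s a))" if "s \<in> S" for s a
    using that inj by (simp add: \<delta>_def)
  moreover have "\<nu> s0 = 0" "\<nu> h = 1" "\<forall>s\<in>S. \<nu> s = 1 \<longrightarrow> s = h"
    using assms(4) by (auto simp: \<nu>_def)
  ultimately show ?thesis by blast
qed

text \<open>\<open>tm_step\<close> freezes in state 1, so the simulated machine has to idle in
  \<open>h\<close>. Then both stay synchronous after halting as well.\<close>

lemma tm_simulates:
  assumes "\<And>s a. s \<in> S \<Longrightarrow> fst (d s a) \<in> S" "\<And>a. d h a = (h, a, MvN)"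
    and "\<nu> h = 1" "\<And>s. s \<in> S \<Longrightarrow> \<nu> s = (1::nat) \<Longrightarrow> s = h"
    and "\<And>s a. s \<in> S \<Longrightarrow> \<delta> (\<nu> s) a = (\<nu> (fst (d s a)), snd (d s a))"
    and "(fstep d ^^ t) (s, p, T) = (s', p', T')" "s \<in> S" "tape_of p T ls rs"
  shows "\<exists>ls' rs'. (tm_step \<delta> ^^ t) (\<nu> s, ls, rs) = (\<nu> s', ls', rs') \<and> tape_of p' T' ls' rs'"
  using assms(6-8)
proof (induction t arbitrary: s p T ls rs)
  case (Suc t)
  obtain s1 b v where d: "d s (T p) = (s1, b, v)" by (cases "d s (T p)")
  have s1: "s1 \<in> S" using assms(1)[OF Suc.prems(2), of "T p"] d by simp
  have r: "(fstep d ^^ t) (s1, p + shift v, T(p := b)) = (s', p', T')"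
    using Suc.prems(1) d by (simp only: funpow_Suc_app fstep.simps) simp
  have Tp: "T p = look rs 0" using Suc.prems(3) by (auto simp: tape_of_def dest: spec[of _ 0])
  have "\<exists>ls1 rs1. tm_step \<delta> (\<nu> s, ls, rs) = (\<nu> s1, ls1, rs1) \<and> tape_of (p + shift v) (T(p := b)) ls1 rs1"
  proof (cases "s = h")
    case True
    then show ?thesis using d assms(2,3) Suc.prems(3) by auto
  next
    case False
    then have "\<nu> s \<noteq> 1" using assms(4) Suc.prems(2) by blast
    then show ?thesis
      using assms(5)[OF Suc.prems(2), of "T p"] d Tp tape_of_move[OF Suc.prems(3), of b]
      by (cases v) (auto simp: tm_step_look simp del: tm_step.simps)
  qed
  then obtain ls1 rs1 where "tm_step \<delta> (\<nu> s, ls, rs) = (\<nu> s1, ls1, rs1)"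
    "tape_of (p + shift v) (T(p := b)) ls1 rs1" by blast
  then show ?case using Suc.IH[OF r s1] by (simp only: funpow_Suc_app)
qed auto

lemma tm_output_look:
  assumes "\<And>i. look rs i = look (map sym_of y) i"
  shows "tm_output (q, ls, rs) = y"
proof -
  have "takeWhile (\<lambda>s. s \<noteq> Bl) rs = map sym_of y"
    using assms
  proof (induction y arbitrary: rs)
    case Nil
    then show ?case using Nil[of 0] by (cases rs) auto
  next
    case (Cons b y)
    have "rs \<noteq> []" using Cons.prems[of 0] sym_of_neq_Bl[of b] by (intro notI) simp
    then obtain a rs' where "rs = a # rs'" by (cases rs) auto
    then show ?case using Cons.prems[of 0] Cons.IH[of rs'] Cons.prems[of "Suc i" for i] by auto
  qed
  then show ?thesis by (simp add: tm_output_def comp_def)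
qed

text \<open>The stack holds \<open>rev x\<close>, since its bottom is cell 0 and the input is
  written from there to the right; for the same reason the result is read in reverse.\<close>

lemma poly_time_computable_com:
  assumes "\<And>x. \<exists>\<sigma>'. runs c ((\<lambda>_. [])(0 := rev x)) (C * (length x + 1) ^ e) \<sigma>' \<and> rev (\<sigma>' 0) = \<mu> x"
  shows "poly_time_computable \<mu>"
proof -
  obtain m where m: "vars_le m c" using ex_vars_le by blast
  \<comment> \<open>The machine starts with its head on cell 0 but a command expects it on
    \<open>-1\<close>; the initial displacement corrects this.\<close>
  let ?s0 = "St [c] At (- 1)"
  have s0: "?s0 \<in> states m c" by (simp add: in_states conts_self)
  obtain Q \<delta> \<nu> where \<nu>: "tm_wf Q \<delta>" "\<nu> ?s0 = 0" "\<nu> Fin = 1"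
      "\<forall>s\<in>states m c. \<nu> s = (1::nat) \<longrightarrow> s = Fin"
      "\<forall>s\<in>states m c. \<forall>a. \<delta> (\<nu> s) a = (\<nu> (fst (mdelta m s a)), snd (mdelta m s a))"
    using ex_numbering[OF finite_states s0, of Fin "mdelta m"] mdelta_states[OF m]
    by (auto simp: states_def)
  \<comment> \<open>There are at most \<open>C * N ^ e\<close> commands, each costing at most a
    multiple of \<open>N ^ (e + 1)\<close> because stacks may have grown with time. The summand 2
    pays for the steps that enter and leave cell \<open>-1\<close>.\<close>
  have "\<exists>t\<le>(C * (m + 3) * (2 * C + 10) + 2) * (length x + 1) ^ (2 * e + 1).
          fst ((tm_step \<delta> ^^ t) (tm_init x)) = 1 \<and> tm_output ((tm_step \<delta> ^^ t) (tm_init x)) = \<mu> x" for x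
  proof -
    let ?\<sigma> = "(\<lambda>_. [])(0 := rev x) :: store" let ?N = "length x + 1"
    obtain \<sigma>' n where n: "n \<le> C * ?N ^ e" "(cstep ^^ n) ([c], ?\<sigma>) = ([], \<sigma>')" "rev (\<sigma>' 0) = \<mu> x"
      using assms[of x] unfolding runs_def by blast
    define T where "T p = (if p < 0 then Bl else look (map sym_of x) (nat p))" for p :: int
    have T0: "tape_of 0 T [] (map sym_of x)"
      by (auto simp: tape_of_def T_def)
    have rp: "rep m ?\<sigma> T"
      unfolding rep_def
    proof (intro allI impI conjI)
      fix r i
      show "T (org r) = Bl" by (simp add: T_def org_def)
      show "T (pos m r i) = (if i < length (?\<sigma> r) then sym_of (rev (?\<sigma> r) ! i) else Bl)"
        using pos_neg[of r m i] pos_nonneg[of m i] by (cases "r = 0") (auto simp: T_def look_def)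
    qed
    have len: "length (?\<sigma> r) \<le> length x" for r by simp
    obtain t T' where t: "t \<le> n * ((m + 3) * (2 * (length x + n) + 8))"
      "mrun m t (St [c] At 0, - 1, T) = (St [] At 0, - 1, T')" "rep m \<sigma>' T'"
      using mrun_csteps[OF n(2) _ rp len] m by auto
    have "mrun m 1 (?s0, 0, T) = (St [c] At 0, - 1, T)" by simp
    moreover have "mrun m 1 (St [] At 0, - 1, T') = (Fin, 0, T')" by simp
    ultimately have "mrun m (1 + (t + 1)) (?s0, 0, T) = (Fin, 0, T')"
      by (intro funpow_trans[OF _ funpow_trans[OF t(2)]])
    then have "\<exists>ls rs. (tm_step \<delta> ^^ (1 + (t + 1))) (\<nu> ?s0, [], map sym_of x) = (\<nu> Fin, ls, rs)
        \<and> tape_of 0 T' ls rs"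
      using \<nu>(3-5) by (intro tm_simulates[where S = "states m c" and d = "mdelta m" and h = Fin,
          OF mdelta_states[OF m] _ _ _ _ _ s0 T0]) auto
    then obtain ls rs where tm: "(tm_step \<delta> ^^ (1 + (t + 1))) (\<nu> ?s0, [], map sym_of x) = (\<nu> Fin, ls, rs)"
      "tape_of 0 T' ls rs" by blast
    have "look rs i = look (map sym_of (\<mu> x)) i" for i
      using tm(2) rep_pos[OF t(3), of 0 i] n(3)[symmetric]
      by (auto simp: tape_of_def pos_nonneg look_def)
    then have "tm_output (\<nu> Fin, ls, rs) = \<mu> x" by (rule tm_output_look)
    moreover have "1 + (t + 1) \<le> (C * (m + 3) * (2 * C + 10) + 2) * ?N ^ (2 * e + 1)"
    proof -
      define N where "N = ?N"
      have N: "1 \<le> N" by (simp add: N_def)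
      have p: "N ^ e \<le> N ^ (e + 1)" "N \<le> N ^ (e + 1)" "1 \<le> N ^ (e + 1)" "1 \<le> N ^ (2 * e + 1)"
        using N by (simp_all only: power_increasing self_le_power one_le_power le_add1 zero_less_one
            add_gr_0 simp_thms)
      have n1: "n \<le> C * N ^ e" using n(1) by (simp add: N_def)
      have "C * N ^ e \<le> C * N ^ (e + 1)" using p(1) by (rule mult_le_mono2)
      then have "n \<le> C * N ^ (e + 1)" using n1 by linarith
      moreover have "2 * length x + 8 \<le> 10 * N ^ (e + 1)"
      proof -
        have "2 * length x + 8 \<le> 10 * N" by (simp add: N_def)
        then show ?thesis using p(2) by linarith
      qed
      ultimately have "2 * (length x + n) + 8 \<le> 2 * (C * N ^ (e + 1)) + 10 * N ^ (e + 1)"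
        by simp
      also have "\<dots> = (2 * C + 10) * N ^ (e + 1)" by (simp only: distrib_right mult.assoc)
      finally have "2 * (length x + n) + 8 \<le> (2 * C + 10) * N ^ (e + 1)" .
      then have "n * ((m + 3) * (2 * (length x + n) + 8))
          \<le> (C * N ^ e) * ((m + 3) * ((2 * C + 10) * N ^ (e + 1)))"
        by (intro mult_le_mono n1) auto
      also have "\<dots> = C * (m + 3) * (2 * C + 10) * (N ^ e * N ^ (e + 1))"
        by (simp only: mult_ac)
      also have "N ^ e * N ^ (e + 1) = N ^ (2 * e + 1)"
        by (simp only: power_add[symmetric] mult_2 add.assoc)
      finally show ?thesis using t(1) p(4) unfolding N_def[symmetric] distrib_right by linarith
    qed
    ultimately show ?thesis using tm(1) \<nu>(2,3) unfolding tm_init_def by (metis fst_conv)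
  qed
  then show ?thesis using \<nu>(1) unfolding poly_time_computable_def by blast
qed

section \<open>Basic stack programs\<close>

notation Seq (infixr ";;" 60)

lemma runs_weaken: "runs c \<sigma> t \<sigma>1 \<Longrightarrow> t \<le> u \<Longrightarrow> \<sigma>1 = \<sigma>2 \<Longrightarrow> runs c \<sigma> u \<sigma>2"
  using runs_mono by blast

lemma runs_Branch_Cons:
  "\<sigma> r = b # xs \<Longrightarrow> runs (if b then g else f) (\<sigma>(r := xs)) t \<sigma>' \<Longrightarrow>
    runs (Branch r e f g) \<sigma> (Suc t) \<sigma>'"
  by (cases b) (auto intro: runs_Branch)

lemma runs_Loop_False:
  "\<sigma> r = False # xs \<Longrightarrow> runs f (\<sigma>(r := xs)) s \<sigma>1 \<Longrightarrow> runs (Loop r f g) \<sigma>1 t \<sigma>2 \<Longrightarrow>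
    runs (Loop r f g) \<sigma> (Suc (s + t)) \<sigma>2"
  by (rule runs_Loop_Cons[where b = False]) auto

lemma runs_Loop_True:
  "\<sigma> r = True # xs \<Longrightarrow> runs g (\<sigma>(r := xs)) s \<sigma>1 \<Longrightarrow> runs (Loop r f g) \<sigma>1 t \<sigma>2 \<Longrightarrow>
    runs (Loop r f g) \<sigma> (Suc (s + t)) \<sigma>2"
  by (rule runs_Loop_Cons[where b = True]) auto

definition mv :: "nat \<Rightarrow> nat \<Rightarrow> com" where
  "mv a b = Loop a (Push b False) (Push b True)"

definition mv2 :: "nat \<Rightarrow> nat \<Rightarrow> nat \<Rightarrow> com" where
  "mv2 a b c = Loop a (Push b False ;; Push c False) (Push b True ;; Push c True)"

definition clr :: "nat \<Rightarrow> com" where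
  "clr a = Loop a Skip Skip"

fun pushl :: "nat \<Rightarrow> bool list \<Rightarrow> com" where
  "pushl r [] = Skip"
| "pushl r (b # bs) = pushl r bs ;; Push r b"

lemma runs_mv:
  "a \<noteq> b \<Longrightarrow> runs (mv a b) \<sigma> (2 * length (\<sigma> a) + 1) (\<sigma>(a := [], b := rev (\<sigma> a) @ \<sigma> b))"
proof (induction "\<sigma> a" arbitrary: \<sigma>)
  case Nil
  then show ?case unfolding mv_def
    by (intro runs_weaken[OF runs_Loop_Nil]) (auto simp: fun_eq_iff)
next
  case (Cons x xs)
  let ?\<sigma> = "\<sigma>(a := xs, b := x # \<sigma> b)"
  have 1: "runs (if x then Push b True else Push b False) (\<sigma>(a := xs)) 1 ?\<sigma>"
    using Cons(3) runs_Push[of b x "\<sigma>(a := xs)"] by (cases x) auto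
  have 2: "runs (mv a b) ?\<sigma> (2 * length xs + 1) (\<sigma>(a := [], b := rev (\<sigma> a) @ \<sigma> b))"
    by (rule runs_weaken[OF Cons(1)]) (use Cons(2,3) in \<open>auto simp: fun_eq_iff Cons(2)[symmetric]\<close>)
  show ?case unfolding mv_def
    by (rule runs_weaken[OF runs_Loop_Cons[OF _ 1 2[unfolded mv_def]]]) (auto simp: Cons(2)[symmetric])
qed

lemma runs_mv2:
  "a \<noteq> b \<Longrightarrow> a \<noteq> c \<Longrightarrow> b \<noteq> c \<Longrightarrow> runs (mv2 a b c) \<sigma> (4 * length (\<sigma> a) + 1)
    (\<sigma>(a := [], b := rev (\<sigma> a) @ \<sigma> b, c := rev (\<sigma> a) @ \<sigma> c))"
proof (induction "\<sigma> a" arbitrary: \<sigma>)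
  case Nil
  then show ?case unfolding mv2_def
    by (intro runs_weaken[OF runs_Loop_Nil]) (auto simp: fun_eq_iff)
next
  case (Cons x xs)
  let ?\<sigma> = "\<sigma>(a := xs, b := x # \<sigma> b, c := x # \<sigma> c)"
  have "runs (Push b x ;; Push c x) (\<sigma>(a := xs)) 3 ?\<sigma>"
    by (rule runs_weaken[OF runs_Seq[OF runs_Push runs_Push]]) (use Cons(3-) in auto)
  then have 1: "runs (if x then Push b True ;; Push c True else Push b False ;; Push c False) (\<sigma>(a := xs)) 3 ?\<sigma>"
    by (cases x) auto
  have 2: "runs (mv2 a b c) ?\<sigma> (4 * length xs + 1)
      (\<sigma>(a := [], b := rev (\<sigma> a) @ \<sigma> b, c := rev (\<sigma> a) @ \<sigma> c))"
    by (rule runs_weaken[OF Cons(1)]) (use Cons(3-) in \<open>auto simp: fun_eq_iff Cons(2)[symmetric]\<close>)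
  show ?case unfolding mv2_def
    by (rule runs_weaken[OF runs_Loop_Cons[OF _ 1 2[unfolded mv2_def]]]) (auto simp: Cons(2)[symmetric])
qed

lemma runs_clr: "runs (clr a) \<sigma> (2 * length (\<sigma> a) + 1) (\<sigma>(a := []))"
proof (induction "\<sigma> a" arbitrary: \<sigma>)
  case Nil
  then show ?case unfolding clr_def
    by (intro runs_weaken[OF runs_Loop_Nil]) (auto simp: fun_eq_iff)
next
  case (Cons x xs)
  let ?\<sigma> = "\<sigma>(a := xs)"
  have 1: "runs (if x then Skip else Skip) ?\<sigma> 1 ?\<sigma>"
    using runs_Skip by (cases x) auto
  have 2: "runs (clr a) ?\<sigma> (2 * length xs + 1) (\<sigma>(a := []))"
    by (rule runs_weaken[OF Cons(1)]) (auto simp: fun_eq_iff)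
  show ?case unfolding clr_def
    by (rule runs_weaken[OF runs_Loop_Cons[OF _ 1 2[unfolded clr_def]]]) (auto simp: Cons(2)[symmetric])
qed

lemma runs_pushl: "runs (pushl r bs) \<sigma> (2 * length bs + 1) (\<sigma>(r := bs @ \<sigma> r))"
proof (induction bs)
  case Nil
  show ?case by (simp add: runs_Skip[simplified])
next
  case (Cons b bs)
  show ?case by (simp, rule runs_weaken[OF runs_Seq[OF Cons runs_Push]]) auto
qed

text \<open>A move reverses the order of the bits, so a faithful copy takes two moves.\<close>

definition dup :: "nat \<Rightarrow> com" where
  "dup k = mv 0 k ;; mv2 k 0 (Suc k)"

lemma runs_dup:
  assumes "0 < k" "\<sigma> k = []" "\<sigma> (Suc k) = []"
  shows "runs (dup k) \<sigma> (6 * length (\<sigma> 0) + 3) (\<sigma>(Suc k := \<sigma> 0))"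
  unfolding dup_def
  by (rule runs_weaken[OF runs_Seq[OF runs_mv runs_mv2]]) (use assms in \<open>auto simp: fun_eq_iff\<close>)

definition restore :: "nat \<Rightarrow> nat \<Rightarrow> com" where
  "restore k j = mv j k ;; mv k 0"

lemma runs_restore:
  assumes "0 < k" "k \<noteq> j" "0 < j" "\<sigma> k = []" "\<sigma> 0 = []"
  shows "runs (restore k j) \<sigma> (4 * length (\<sigma> j) + 3) (\<sigma>(0 := \<sigma> j, j := []))"
  unfolding restore_def
  by (rule runs_weaken[OF runs_Seq[OF runs_mv runs_mv]]) (use assms in \<open>auto simp: fun_eq_iff\<close>)

text \<open>A self-delimiting code: \<open>True\<close> announces a further bit and
  \<open>False\<close> ends the word, so \<open>dbl x @ y\<close> can be split uniquely.\<close>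

fun dbl :: "bool list \<Rightarrow> bool list" where
  "dbl [] = [False]"
| "dbl (b # bs) = True # b # dbl bs"

lemma length_dbl [simp]: "length (dbl x) = 2 * length x + 1"
  by (induction x) auto

lemma dbl_append_eq: "dbl x @ y = dbl x' @ y' \<longleftrightarrow> x = x' \<and> y = y'"
proof (induction x arbitrary: x')
  case Nil
  show ?case by (cases x') auto
next
  case (Cons b x)
  then show ?case by (cases x') auto
qed

text \<open>The code is built from its end, so stack \<open>k\<close> has to hold the word in
  reverse.\<close>

definition dblpush :: "nat \<Rightarrow> com" where
  "dblpush k = Push 0 False ;; Loop k (Push 0 False ;; Push 0 True) (Push 0 True ;; Push 0 True)"

lemma runs_dblpush_loop:
  "0 < k \<Longrightarrow> \<sigma> 0 = dbl u @ v \<Longrightarrow> runs (Loop k (Push 0 False ;; Push 0 True) (Push 0 True ;; Push 0 True))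
     \<sigma> (4 * length (\<sigma> k) + 1) (\<sigma>(k := [], 0 := dbl (rev (\<sigma> k) @ u) @ v))"
proof (induction "\<sigma> k" arbitrary: \<sigma> u)
  case Nil
  then show ?case
    by (intro runs_weaken[OF runs_Loop_Nil]) (auto simp: fun_eq_iff)
next
  case (Cons x xs)
  let ?\<sigma> = "\<sigma>(k := xs, 0 := dbl (x # u) @ v)"
  have "runs (Push 0 x ;; Push 0 True) (\<sigma>(k := xs)) 3 ?\<sigma>"
    by (rule runs_weaken[OF runs_Seq[OF runs_Push runs_Push]]) (use Cons(3-) in \<open>auto simp: fun_eq_iff\<close>)
  then have 1: "runs (if x then Push 0 True ;; Push 0 True else Push 0 False ;; Push 0 True) (\<sigma>(k := xs)) 3 ?\<sigma>"
    by (cases x) auto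
  have 2: "runs (Loop k (Push 0 False ;; Push 0 True) (Push 0 True ;; Push 0 True)) ?\<sigma> (4 * length xs + 1)
      (\<sigma>(k := [], 0 := dbl (rev (\<sigma> k) @ u) @ v))"
    by (rule runs_weaken[OF Cons(1)[where u = "x # u"]])
      (use Cons(3-) in \<open>auto simp: fun_eq_iff Cons(2)[symmetric]\<close>)
  show ?case
    by (rule runs_weaken[OF runs_Loop_Cons[OF _ 1 2]]) (auto simp: Cons(2)[symmetric])
qed

lemma runs_dblpush:
  assumes "0 < k"
  shows "runs (dblpush k) \<sigma> (4 * length (\<sigma> k) + 3) (\<sigma>(k := [], 0 := dbl (rev (\<sigma> k)) @ \<sigma> 0))"
  unfolding dblpush_def
  by (rule runs_weaken[OF runs_Seq[OF runs_Push runs_dblpush_loop[where u = "[]" and v = "\<sigma> 0"]]])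
    (use assms in \<open>auto simp: fun_eq_iff\<close>)

text \<open>The terminating False of the first component makes \<open>mv 0 y\<close> empty stack 0, which ends the loop.\<close>
definition split :: "nat \<Rightarrow> nat \<Rightarrow> com" where
  "split t y = Loop 0 (mv 0 y) (Branch 0 Skip (Push t False) (Push t True))"

lemma runs_split:
  assumes "0 < t" "0 < y" "t \<noteq> y"
  shows "\<sigma> 0 = dbl u @ v \<Longrightarrow> runs (split t y) \<sigma> (3 * length u + 2 * length v + 3)
     (\<sigma>(0 := [], t := rev u @ \<sigma> t, y := rev v @ \<sigma> y))"
proof (induction u arbitrary: \<sigma>)
  case Nil
  have 1: "runs (mv 0 y) (\<sigma>(0 := v)) (2 * length v + 1) (\<sigma>(0 := [], y := rev v @ \<sigma> y))"
    by (rule runs_weaken[OF runs_mv]) (use assms in \<open>auto simp: fun_eq_iff\<close>)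
  have 2: "runs (split t y) (\<sigma>(0 := [], y := rev v @ \<sigma> y)) 1 (\<sigma>(0 := [], y := rev v @ \<sigma> y))"
    unfolding split_def by (rule runs_Loop_Nil) (use assms in auto)
  show ?case unfolding split_def
    by (rule runs_weaken[OF runs_Loop_False[OF _ 1 2[unfolded split_def]]])
      (use assms Nil in \<open>auto simp: fun_eq_iff\<close>)
next
  case (Cons b u)
  let ?\<sigma> = "\<sigma>(0 := dbl u @ v, t := b # \<sigma> t)"
  have 1: "runs (Branch 0 Skip (Push t False) (Push t True)) (\<sigma>(0 := b # dbl u @ v)) 2 ?\<sigma>"
  proof (cases b)
    case True
    then show ?thesis
      by (intro runs_weaken[OF runs_Branch(3)[OF _ runs_Push]]) (use assms in \<open>auto simp: fun_eq_iff\<close>)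
  next
    case False
    then show ?thesis
      by (intro runs_weaken[OF runs_Branch(2)[OF _ runs_Push]]) (use assms in \<open>auto simp: fun_eq_iff\<close>)
  qed
  have 2: "runs (split t y) ?\<sigma> (3 * length u + 2 * length v + 3)
      (\<sigma>(0 := [], t := rev (b # u) @ \<sigma> t, y := rev v @ \<sigma> y))"
    by (rule runs_weaken[OF Cons(1)]) (use assms in \<open>auto simp: fun_eq_iff\<close>)
  show ?case unfolding split_def
    by (rule runs_weaken[OF runs_Loop_True[OF _ 1 2[unfolded split_def]]]) (use Cons(2) in auto)
qed

section \<open>Encodings and polynomial-time functions\<close>

class enc =
  fixes enc :: "'a \<Rightarrow> bool list"
  assumes enc_inject: "enc x = enc y \<Longrightarrow> x = y"

instantiation bool :: enc
begin
definition "enc_bool (b::bool) = [b]"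
instance by standard (simp add: enc_bool_def)
end

instantiation nat :: enc
begin
text \<open>Unary, so that a number can directly serve as a loop counter and its size is its
  value.\<close>

definition "enc_nat (n::nat) = replicate n True"
instance by standard (metis enc_nat_def length_replicate)
end

instantiation prod :: (enc, enc) enc
begin
definition "enc_prod p = dbl (enc (fst p)) @ enc (snd p)"
instance by standard (auto simp: enc_prod_def dbl_append_eq prod_eq_iff dest: enc_inject)
end

instantiation list :: (enc) enc
begin
definition "enc_list xs = concat (map (\<lambda>a. dbl (enc a)) xs)"
instance
proof
  fix x y :: "'a list"
  show "enc x = enc y \<Longrightarrow> x = y"
  proof (induction x arbitrary: y)
    case Nil
    then show ?case by (cases y; cases "enc (hd y)") (auto simp: enc_list_def)
  next
    case (Cons a x)
    show ?case
    proof (cases y)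
      case Nil
      then show ?thesis using Cons(2) by (cases "enc a") (auto simp: enc_list_def)
    next
      case (Cons b z)
      then show ?thesis using Cons.IH[of z] Cons.prems
        by (auto simp: enc_list_def dbl_append_eq dest: enc_inject)
    qed
  qed
qed
end

text \<open>Strings encoded as themselves, as on the tape of a machine. As a
  \<open>bool list\<close> each bit would take three bits, by the generic list encoding.\<close>

datatype raw = Raw (unraw: "bool list")

instantiation raw :: enc
begin
definition "enc_raw w = unraw w"
instance by standard (simp add: enc_raw_def raw.expand)
end

instantiation sym :: enc
begin
definition "enc_sym s = (case s of Bl \<Rightarrow> [] | S0 \<Rightarrow> [False] | S1 \<Rightarrow> [True])"
instance by standard (auto simp: enc_sym_def split: sym.splits)
end

instantiation dir :: enc
begin
definition "enc_dir s = (case s of MvL \<Rightarrow> [] | MvN \<Rightarrow> [False] | MvR \<Rightarrow> [True])"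
instance by standard (auto simp: enc_dir_def split: dir.splits)
end

lemma enc_Pair [simp]: "enc (a, b) = dbl (enc a) @ enc b"
  by (simp add: enc_prod_def)

lemma enc_list_simps [simp]: "enc [] = []" "enc (a # as) = dbl (enc a) @ enc as"
  by (simp_all add: enc_list_def)

definition sz :: "'a::enc \<Rightarrow> nat" where
  "sz a = length (enc a)"

lemma sz_Pair [simp]: "sz (a, b) = 2 * sz a + 1 + sz b"
  by (simp add: sz_def)

lemma sz_list_simps [simp]: "sz [] = 0" "sz (a # as) = 2 * sz a + 1 + sz as"
  by (simp_all add: sz_def)

lemma sz_nat [simp]: "sz (n::nat) = n"
  by (simp add: sz_def enc_nat_def)

lemma sz_bool [simp]: "sz (b::bool) = 1"
  by (simp add: sz_def enc_bool_def)

lemma sz_sym: "sz (s::sym) \<le> 1"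
  by (simp add: sz_def enc_sym_def split: sym.split)

section \<open>Polynomial bounds and functions computed by stack programs\<close>

definition pb :: "('a::enc \<Rightarrow> nat) \<Rightarrow> bool" where
  "pb f \<longleftrightarrow> (\<exists>C e. \<forall>a. f a \<le> C * (sz a + 1) ^ e)"

named_theorems pb_intros

lemma pb_mono: "pb g \<Longrightarrow> (\<And>a. f a \<le> g a) \<Longrightarrow> pb f"
  unfolding pb_def by (meson le_trans)

lemma pb_const [pb_intros]: "pb (\<lambda>a. c)"
  unfolding pb_def by (intro exI[of _ c] exI[of _ 0]) simp

lemma pb_sz_arg [pb_intros]: "pb sz"
  unfolding pb_def by (intro exI[of _ 1] exI[of _ 1]) simp

lemma pb_add [pb_intros]:
  fixes f g :: "'a::enc \<Rightarrow> nat"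
  assumes "pb f" "pb g"
  shows "pb (\<lambda>a. f a + g a)"
proof -
  obtain C e D d where *: "f a \<le> C * (sz a + 1) ^ e" "g a \<le> D * (sz a + 1) ^ d" for a
    using assms unfolding pb_def by blast
  have "f a + g a \<le> (C + D) * (sz a + 1) ^ (e + d)" for a
  proof -
    have "(sz a + 1) ^ e \<le> (sz a + 1) ^ (e + d)" "(sz a + 1) ^ d \<le> (sz a + 1) ^ (e + d)"
      by (rule power_increasing; simp)+
    then have "C * (sz a + 1) ^ e \<le> C * (sz a + 1) ^ (e + d)" "D * (sz a + 1) ^ d \<le> D * (sz a + 1) ^ (e + d)"
      by (simp_all only: mult_le_mono2)
    then show ?thesis using *[of a] unfolding distrib_right by linarith
  qed
  then show ?thesis unfolding pb_def by blast
qed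

lemma pb_mult [pb_intros]:
  fixes f g :: "'a::enc \<Rightarrow> nat"
  assumes "pb f" "pb g"
  shows "pb (\<lambda>a. f a * g a)"
proof -
  obtain C e D d where *: "f a \<le> C * (sz a + 1) ^ e" "g a \<le> D * (sz a + 1) ^ d" for a
    using assms unfolding pb_def by blast
  have "f a * g a \<le> (C * D) * (sz a + 1) ^ (e + d)" for a
    using mult_le_mono[OF *(1)[of a] *(2)[of a]] by (simp only: power_add mult_ac)
  then show ?thesis unfolding pb_def by blast
qed

lemma pb_Suc [pb_intros]: "pb f \<Longrightarrow> pb (\<lambda>a. Suc (f a))"
  using pb_add[of f "\<lambda>_. 1"] pb_const by auto

lemma pb_power [pb_intros]: "pb f \<Longrightarrow> pb (\<lambda>a. f a ^ k)"
  by (induction k) (auto intro: pb_intros)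

text \<open>A polynomially bounded function need not be monotone, but its bound is; so the bound may
  be evaluated at any estimate of the size.\<close>

lemma pb_bound: "pb g \<Longrightarrow> \<exists>C e. \<forall>a n. sz a \<le> n \<longrightarrow> g a \<le> C * (n + 1) ^ e"
proof -
  assume "pb g"
  then obtain C e where "\<And>a. g a \<le> C * (sz a + 1) ^ e" unfolding pb_def by blast
  moreover have "C * (sz a + 1) ^ e \<le> C * (n + 1) ^ e" if "sz a \<le> n" for a n
    using that by (intro mult_le_mono2 power_mono) auto
  ultimately show ?thesis by (meson le_trans)
qed

definition clean :: "nat \<Rightarrow> store \<Rightarrow> bool" where
  "clean k \<sigma> \<longleftrightarrow> (\<forall>r. 0 < r \<and> r < k \<longrightarrow> \<sigma> r = [])"

text \<open>A program for \<open>f\<close> works on stack 0, uses the stacks below \<open>k\<close> as scratch space that it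
  finds and leaves empty, and does not touch the other stacks.\<close>
definition computes :: "com \<Rightarrow> nat \<Rightarrow> ('a::enc \<Rightarrow> nat) \<Rightarrow> ('a \<Rightarrow> 'b::enc) \<Rightarrow> bool" where
  "computes c k T f \<longleftrightarrow> pb T \<and>
     (\<forall>a \<sigma>. \<sigma> 0 = enc a \<longrightarrow> clean k \<sigma> \<longrightarrow> runs c \<sigma> (T a) (\<sigma>(0 := enc (f a))))"

definition pt :: "('a::enc \<Rightarrow> 'b::enc) \<Rightarrow> bool" where
  "pt f \<longleftrightarrow> (\<exists>c k T. computes c k T f)"

lemma ptI:
  assumes "pb T" "\<And>a \<sigma>. \<sigma> 0 = enc a \<Longrightarrow> clean k \<sigma> \<Longrightarrow> runs c \<sigma> (T a) (\<sigma>(0 := enc (f a)))"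
  shows "pt f"
  using assms unfolding pt_def computes_def by blast

lemma computesD:
  assumes "computes c k T f"
  shows "pb T" and "\<sigma> 0 = enc a \<Longrightarrow> clean k \<sigma> \<Longrightarrow> runs c \<sigma> (T a) (\<sigma>(0 := enc (f a)))"
  using assms unfolding computes_def by blast+

lemma clean_mono: "clean k \<sigma> \<Longrightarrow> j \<le> k \<Longrightarrow> clean j \<sigma>"
  by (auto simp: clean_def)

lemma cleanD: "clean k \<sigma> \<Longrightarrow> 0 < r \<Longrightarrow> r < k \<Longrightarrow> \<sigma> r = []"
  by (auto simp: clean_def)

lemma clean_upd0 [simp]: "clean k (\<sigma>(0 := x)) = clean k \<sigma>"
  by (auto simp: clean_def)

lemma clean_upd_ge [simp]: "k \<le> r \<Longrightarrow> clean k (\<sigma>(r := x)) = clean k \<sigma>"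
  by (auto simp: clean_def)

lemma clean_upd_Nil [simp]: "clean k \<sigma> \<Longrightarrow> clean k (\<sigma>(r := []))"
  by (auto simp: clean_def)

lemma pt_retype:
  fixes f :: "'a::enc \<Rightarrow> 'b::enc"
  assumes "\<And>a. enc (f a) = enc a"
  shows "pt f"
proof (rule ptI[of "\<lambda>_. 1" 0 Skip])
  fix a :: 'a and \<sigma> :: store
  assume "\<sigma> 0 = enc a"
  then show "runs Skip \<sigma> 1 (\<sigma>(0 := enc (f a)))"
    by (intro runs_weaken[OF runs_Skip]) (auto simp: fun_eq_iff assms)
qed (intro pb_intros)

text \<open>A program cannot output more bits than its input length plus its running time.\<close>

lemma pb_sz: "pt f \<Longrightarrow> pb (\<lambda>a. sz (f a))"
proof -
  assume "pt f"
  then obtain c k T where "computes c k T f" unfolding pt_def by blast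
  note T = computesD(1)[OF this] and c = computesD(2)[OF this]
  have "sz (f a) \<le> sz a + T a" for a
    using runs_length[OF c[of "(\<lambda>_. [])(0 := enc a)" a], of 0] by (simp add: clean_def sz_def)
  then show ?thesis by (rule pb_mono[rotated]) (intro pb_intros T)
qed

lemma pb_comp:
  assumes "pb g" "pt f"
  shows "pb (\<lambda>a. g (f a))"
proof -
  obtain C e where g: "g a \<le> C * (sz a + 1) ^ e" for a using assms(1) unfolding pb_def by blast
  have "pb (\<lambda>a. C * (sz (f a) + 1) ^ e)" by (intro pb_intros pb_sz assms(2))
  then show ?thesis by (rule pb_mono) (rule g)
qed

lemma pt_comp:
  fixes g :: "'b::enc \<Rightarrow> 'c::enc" and f :: "'a::enc \<Rightarrow> 'b"
  assumes "pt g" "pt f"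
  shows "pt (\<lambda>a. g (f a))"
proof -
  obtain c k T where f0: "computes c k T (\<lambda>a. (f a))"
    using assms(2) unfolding pt_def by blast
  note f = computesD[OF f0]
  obtain c' k' T' where g0: "computes c' k' T' (\<lambda>a. (g a))"
    using assms(1) unfolding pt_def by blast
  note g = computesD[OF g0]
  show ?thesis
  proof (rule ptI)
    show "pb (\<lambda>a. Suc (T a + T' (f a)))"
      by (intro pb_intros f pb_comp[OF g(1) assms(2)])
    fix a :: 'a and \<sigma> :: store
    assume a: "\<sigma> 0 = enc a" "clean (max k k') \<sigma>"
    then have "clean k \<sigma>" "clean k' \<sigma>" by (auto elim: clean_mono)
    then show "runs (c ;; c') \<sigma> (Suc (T a + T' (f a))) (\<sigma>(0 := enc (g (f a))))"
      using a g(2)[of "\<sigma>(0 := enc (f a))" "f a"] by (intro runs_Seq[OF f(2)]) auto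
  qed
qed

lemma pt_id: "pt (\<lambda>a. a)"
  by (rule pt_retype) simp

lemma pt_const:
  fixes b :: "'b::enc"
  shows "pt (\<lambda>a::'a::enc. b)"
proof (rule ptI)
  show "pb (\<lambda>a::'a. Suc ((2 * sz a + 1) + (2 * sz b + 1)))" by (intro pb_intros)
  fix a :: 'a and \<sigma> :: store
  assume "\<sigma> 0 = enc a" "clean 0 \<sigma>"
  then show "runs (clr 0 ;; pushl 0 (enc b)) \<sigma> (Suc ((2 * sz a + 1) + (2 * sz b + 1))) (\<sigma>(0 := enc b))"
    by (intro runs_weaken[OF runs_Seq[OF runs_clr runs_pushl]]) (auto simp: sz_def)
qed

lemma pt_Pair:
  fixes f :: "'a::enc \<Rightarrow> 'b::enc" and g :: "'a \<Rightarrow> 'c::enc"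
  assumes "pt f" "pt g"
  shows "pt (\<lambda>a. (f a, g a))"
proof -
  obtain c i T where f0: "computes c i T (\<lambda>a. (f a))"
    using assms(1) unfolding pt_def by blast
  note f = computesD[OF f0]
  obtain c' j T' where g0: "computes c' j T' (\<lambda>a. (g a))"
    using assms(2) unfolding pt_def by blast
  note g = computesD[OF g0]
  define k where "k = Suc (i + j)"
  let ?t = "\<lambda>a. Suc ((6 * sz a + 3) + Suc (T a + Suc ((2 * sz (f a) + 1) +
      Suc ((4 * sz a + 3) + Suc (T' a + (4 * sz (f a) + 3))))))"
  show ?thesis
  proof (rule ptI[of ?t])
    show "pb ?t" by (intro pb_intros f(1) g(1) pb_sz assms)
    fix a :: 'a and \<sigma> :: store
    assume 0: "\<sigma> 0 = enc a" and cl: "clean (k + 3) \<sigma>"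
    have k: "\<sigma> k = []" "\<sigma> (Suc k) = []" "\<sigma> (Suc (Suc k)) = []" "0 < k" "i \<le> k" "j \<le> k"
      using cleanD[OF cl] by (auto simp: k_def)
    have cl': "clean i \<sigma>" "clean j \<sigma>" using clean_mono[OF cl] k by auto
    \<comment> \<open>Stack \<open>Suc k\<close> keeps the argument while \<open>f\<close> runs, and
      stack \<open>k\<close> keeps the value of \<open>f\<close>, reversed as \<open>dblpush\<close>
      expects it, while \<open>g\<close> runs. Both lie above the scratch space of the two
      programs.\<close>
    define \<sigma>1 where "\<sigma>1 = \<sigma>(Suc k := enc a)"
    define \<sigma>2 where "\<sigma>2 = \<sigma>1(0 := enc (f a))"
    define \<sigma>3 where "\<sigma>3 = \<sigma>2(0 := [], k := rev (enc (f a)))"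
    define \<sigma>4 where "\<sigma>4 = \<sigma>3(0 := enc a, Suc k := [])"
    define \<sigma>5 where "\<sigma>5 = \<sigma>4(0 := enc (g a))"
    have 1: "runs (dup k) \<sigma> (6 * sz a + 3) \<sigma>1"
      unfolding \<sigma>1_def by (rule runs_weaken[OF runs_dup]) (use 0 k in \<open>auto simp: sz_def\<close>)
    have 2: "runs c \<sigma>1 (T a) \<sigma>2"
      unfolding \<sigma>2_def by (rule f(2)) (use 0 k cl' in \<open>auto simp: \<sigma>1_def\<close>)
    have 3: "runs (mv 0 k) \<sigma>2 (2 * sz (f a) + 1) \<sigma>3"
      unfolding \<sigma>3_def by (rule runs_weaken[OF runs_mv]) (use k in \<open>auto simp: \<sigma>2_def \<sigma>1_def sz_def\<close>)
    have 4: "runs (restore (Suc (Suc k)) (Suc k)) \<sigma>3 (4 * sz a + 3) \<sigma>4"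
      unfolding \<sigma>4_def by (rule runs_weaken[OF runs_restore])
        (use k in \<open>auto simp: \<sigma>3_def \<sigma>2_def \<sigma>1_def sz_def\<close>)
    have 5: "runs c' \<sigma>4 (T' a) \<sigma>5"
      unfolding \<sigma>5_def by (rule g(2))
        (use k cl' in \<open>auto simp: \<sigma>4_def \<sigma>3_def \<sigma>2_def \<sigma>1_def\<close>)
    have 6: "runs (dblpush k) \<sigma>5 (4 * sz (f a) + 3) (\<sigma>(0 := enc (f a, g a)))"
      by (rule runs_weaken[OF runs_dblpush])
        (use k 0 in \<open>auto simp: fun_eq_iff sz_def \<sigma>5_def \<sigma>4_def \<sigma>3_def \<sigma>2_def \<sigma>1_def\<close>)
    show "runs (dup k ;; c ;; mv 0 k ;; restore (Suc (Suc k)) (Suc k) ;; c' ;; dblpush k) \<sigma> (?t a)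
        (\<sigma>(0 := enc (f a, g a)))"
      by (rule runs_Seq[OF 1 runs_Seq[OF 2 runs_Seq[OF 3 runs_Seq[OF 4 runs_Seq[OF 5 6]]]]])
  qed
qed

lemma pt_If:
  fixes f g :: "'a::enc \<Rightarrow> 'b::enc"
  assumes "pt b" "pt f" "pt g"
  shows "pt (\<lambda>a. if b a then f a else g a)"
proof -
  obtain c i T where f0: "computes c i T (\<lambda>a. (f a))"
    using assms(2) unfolding pt_def by blast
  note f = computesD[OF f0]
  obtain c' j T' where g0: "computes c' j T' (\<lambda>a. (g a))"
    using assms(3) unfolding pt_def by blast
  note g = computesD[OF g0]
  obtain c'' l T'' where b0: "computes c'' l T'' (\<lambda>a. (b a))"
    using assms(1) unfolding pt_def by blast
  note b = computesD[OF b0]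
  define k where "k = Suc (i + j + l)"
  let ?r = "restore k (Suc k)"
  let ?t = "\<lambda>a. Suc ((6 * sz a + 3) + Suc (T'' a + Suc (Suc ((4 * sz a + 3) + (T a + T' a)))))"
  show ?thesis
  proof (rule ptI[of ?t])
    show "pb ?t" by (intro pb_intros f(1) g(1) b(1) assms)
    fix a :: 'a and \<sigma> :: store
    assume 0: "\<sigma> 0 = enc a" and cl: "clean (k + 2) \<sigma>"
    have k: "\<sigma> k = []" "\<sigma> (Suc k) = []" "0 < k" "i \<le> k" "j \<le> k" "l \<le> k"
      using cleanD[OF cl] by (auto simp: k_def)
    have cl': "clean i \<sigma>" "clean j \<sigma>" "clean l \<sigma>" using clean_mono[OF cl] k by auto
    define \<sigma>1 where "\<sigma>1 = \<sigma>(Suc k := enc a)"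
    define \<sigma>2 where "\<sigma>2 = \<sigma>1(0 := enc (b a))"
    have 1: "runs (dup k) \<sigma> (6 * sz a + 3) \<sigma>1"
      unfolding \<sigma>1_def by (rule runs_weaken[OF runs_dup]) (use 0 k in \<open>auto simp: sz_def\<close>)
    have 2: "runs c'' \<sigma>1 (T'' a) \<sigma>2"
      unfolding \<sigma>2_def by (rule b(2)) (use 0 k cl' in \<open>auto simp: \<sigma>1_def\<close>)
    have 3: "runs ?r (\<sigma>2(0 := [])) (4 * sz a + 3) \<sigma>"
      by (rule runs_weaken[OF runs_restore])
        (use 0 k in \<open>auto simp: fun_eq_iff \<sigma>2_def \<sigma>1_def sz_def\<close>)
    have 4: "runs (Branch 0 Skip (?r ;; c') (?r ;; c)) \<sigma>2 (Suc (Suc ((4 * sz a + 3) + (T a + T' a))))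
        (\<sigma>(0 := enc (if b a then f a else g a)))"
    proof (cases "b a")
      case True
      show ?thesis
        by (rule runs_weaken[OF runs_Branch(3)[OF _ runs_Seq[OF 3 f(2)]]])
          (use True 0 cl' in \<open>auto simp: \<sigma>2_def enc_bool_def\<close>)
    next
      case False
      show ?thesis
        by (rule runs_weaken[OF runs_Branch(2)[OF _ runs_Seq[OF 3 g(2)]]])
          (use False 0 cl' in \<open>auto simp: \<sigma>2_def enc_bool_def\<close>)
    qed
    show "runs (dup k ;; c'' ;; Branch 0 Skip (?r ;; c') (?r ;; c)) \<sigma> (?t a)
        (\<sigma>(0 := enc (if b a then f a else g a)))"
      by (rule runs_Seq[OF 1 runs_Seq[OF 2 4]])
  qed
qed

lemma runs_fst:
  assumes "\<sigma> 0 = dbl u @ v" "\<sigma> 1 = []" "\<sigma> 2 = []"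
  shows "runs (split 1 2 ;; clr 2 ;; mv 1 0) \<sigma> (5 * length u + 4 * length v + 8) (\<sigma>(0 := u))"
  by (rule runs_weaken[OF runs_Seq[OF runs_split runs_Seq[OF runs_clr runs_mv]]])
    (use assms in \<open>auto simp: fun_eq_iff\<close>)

lemma runs_snd:
  assumes "\<sigma> 0 = dbl u @ v" "\<sigma> 1 = []" "\<sigma> 2 = []"
  shows "runs (split 1 2 ;; clr 1 ;; mv 2 0) \<sigma> (5 * length u + 4 * length v + 8) (\<sigma>(0 := v))"
  by (rule runs_weaken[OF runs_Seq[OF runs_split runs_Seq[OF runs_clr runs_mv]]])
    (use assms in \<open>auto simp: fun_eq_iff\<close>)

lemma pt_fst: "pt fst"
proof (rule ptI[of "\<lambda>p. 9 * sz p + 8" 3])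
  fix p :: "'a \<times> 'b" and \<sigma> :: store
  assume "\<sigma> 0 = enc p" "clean 3 \<sigma>"
  then show "runs (split 1 2 ;; clr 2 ;; mv 1 0) \<sigma> (9 * sz p + 8) (\<sigma>(0 := enc (fst p)))"
    by (intro runs_weaken[OF runs_fst[where u = "enc (fst p)" and v = "enc (snd p)"]])
      (auto simp: cleanD sz_def enc_prod_def)
qed (intro pb_intros)

lemma pt_snd: "pt snd"
proof (rule ptI[of "\<lambda>p. 9 * sz p + 8" 3])
  fix p :: "'a \<times> 'b" and \<sigma> :: store
  assume "\<sigma> 0 = enc p" "clean 3 \<sigma>"
  then show "runs (split 1 2 ;; clr 1 ;; mv 2 0) \<sigma> (9 * sz p + 8) (\<sigma>(0 := enc (snd p)))"
    by (intro runs_weaken[OF runs_snd[where u = "enc (fst p)" and v = "enc (snd p)"]])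
      (auto simp: cleanD sz_def enc_prod_def)
qed (intro pb_intros)

lemma pt_enc_Nil: "pt (\<lambda>a::'a::enc. enc a = [])"
proof (rule ptI[of "\<lambda>a. 2 * sz a + 4" 0])
  fix a :: 'a and \<sigma> :: store
  let ?d = "clr 0 ;; Push 0 False"
  assume 0: "\<sigma> 0 = enc a" "clean 0 \<sigma>"
  show "runs (Branch 0 (Push 0 True) ?d ?d) \<sigma> (2 * sz a + 4) (\<sigma>(0 := enc (enc a = [])))"
  proof (cases "enc a")
    case Nil
    then show ?thesis using 0
      by (intro runs_weaken[OF runs_Branch(1)[OF _ runs_Push]]) (auto simp: enc_bool_def)
  next
    case (Cons b x)
    show ?thesis
    proof (cases b)
      case True
      show ?thesis
        by (rule runs_weaken[OF runs_Branch(3)[OF _ runs_Seq[OF runs_clr runs_Push]]])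
          (use 0 Cons True in \<open>auto simp: enc_bool_def sz_def\<close>)
    next
      case False
      show ?thesis
        by (rule runs_weaken[OF runs_Branch(2)[OF _ runs_Seq[OF runs_clr runs_Push]]])
          (use 0 Cons False in \<open>auto simp: enc_bool_def sz_def\<close>)
    qed
  qed
qed (intro pb_intros)

lemma enc_list_eq_Nil [simp]: "enc xs = [] \<longleftrightarrow> xs = []"
  by (metis enc_inject enc_list_simps(1))

lemma pt_null: "pt (\<lambda>xs::'a::enc list. xs = [])"
  using pt_enc_Nil[where 'a = "'a list"] by (simp only: enc_list_eq_Nil)

lemma pt_nat_0: "pt (\<lambda>n::nat. n = 0)"
  using pt_enc_Nil[where 'a = nat] by (simp add: enc_nat_def)

lemma pt_Suc: "pt Suc"
  by (rule ptI[of "\<lambda>_. 1" 0 "Push 0 True"])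
    (auto intro: pb_intros runs_weaken[OF runs_Push] simp: enc_nat_def)

lemma pt_pred: "pt (\<lambda>n::nat. n - 1)"
proof (rule ptI[of "\<lambda>_. 2" 0 "Branch 0 Skip Skip Skip"])
  fix a :: nat and \<sigma> :: store
  assume "\<sigma> 0 = enc a" "clean 0 \<sigma>"
  then show "runs (Branch 0 Skip Skip Skip) \<sigma> 2 (\<sigma>(0 := enc (a - 1)))"
    by (cases a) (auto simp: enc_nat_def fun_eq_iff intro: runs_weaken[OF runs_Branch(1)[OF _ runs_Skip]]
        runs_weaken[OF runs_Branch(3)[OF _ runs_Skip]])
qed (intro pb_intros)

text \<open>A nonempty list has the same code as the pair of its head and tail, so nothing has to be
  done.\<close>

lemma pt_Cons: "pt (\<lambda>p. fst p # snd p)"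
  by (rule pt_retype) (simp add: enc_prod_def)

text \<open>\<open>Branch\<close> consumes the bit that it tests; pushing it again turns it into a
  test for emptiness.\<close>

lemma runs_peek:
  assumes "\<sigma> r = [] \<Longrightarrow> runs c \<sigma> t \<sigma>'" "\<sigma> r \<noteq> [] \<Longrightarrow> runs d \<sigma> t \<sigma>'"
  shows "runs (Branch r c (Push r False ;; d) (Push r True ;; d)) \<sigma> (t + 3) \<sigma>'"
proof (cases "\<sigma> r")
  case Nil
  show ?thesis by (rule runs_weaken[OF runs_Branch(1)[OF Nil assms(1)[OF Nil]]]) auto
next
  case (Cons b x)
  then have d: "runs d \<sigma> t \<sigma>'" using assms(2) by simp
  have p: "runs (Push r b) (\<sigma>(r := x)) 1 \<sigma>"
    by (rule runs_weaken[OF runs_Push]) (use Cons in \<open>auto simp: fun_eq_iff\<close>)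
  have "runs (if b then Push r True ;; d else Push r False ;; d) (\<sigma>(r := x)) (Suc (1 + t)) \<sigma>'"
    using runs_Seq[OF p d] by (cases b) auto
  then show ?thesis
    by (intro runs_weaken[OF runs_Branch_Cons[where r = r and b = b and xs = x and \<sigma> = \<sigma>]])
      (use Cons in auto)
qed

lemma pt_tl: "pt (tl :: 'a::enc list \<Rightarrow> 'a list)"
proof (rule ptI[of "\<lambda>p. (9 * sz p + 8) + 3" 3])
  fix xs :: "'a list" and \<sigma> :: store
  let ?d = "split 1 2 ;; clr 1 ;; mv 2 0"
  assume "\<sigma> 0 = enc xs" "clean 3 \<sigma>"
  moreover from this have "runs ?d \<sigma> (9 * sz xs + 8) (\<sigma>(0 := enc (tl xs)))" if "\<sigma> 0 \<noteq> []"
    using that by (intro runs_weaken[OF runs_snd[where u = "enc (hd xs)" and v = "enc (tl xs)"]])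
      (cases xs; auto simp: cleanD sz_def)+
  ultimately show "runs (Branch 0 Skip (Push 0 False ;; ?d) (Push 0 True ;; ?d)) \<sigma> ((9 * sz xs + 8) + 3)
     (\<sigma>(0 := enc (tl xs)))"
    by (intro runs_peek) (auto intro!: runs_weaken[OF runs_Skip] simp: fun_eq_iff eq_commute[of "[]"])
qed (intro pb_intros)

text \<open>\<open>hd []\<close> is unspecified but is a fixed value, so the program can output its
  code as a constant.\<close>

lemma pt_hd: "pt (hd :: 'a::enc list \<Rightarrow> 'a)"
proof (rule ptI[of "\<lambda>p. (9 * sz p + 8 + 2 * sz (hd [] :: 'a)) + 3" 3])
  fix xs :: "'a list" and \<sigma> :: store
  let ?d = "split 1 2 ;; clr 2 ;; mv 1 0" and ?e = "pushl 0 (enc (hd [] :: 'a))"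
  assume 0: "\<sigma> 0 = enc xs" "clean 3 \<sigma>"
  then have "runs ?d \<sigma> (9 * sz xs + 8 + 2 * sz (hd [] :: 'a)) (\<sigma>(0 := enc (hd xs)))" if "\<sigma> 0 \<noteq> []"
    using that by (intro runs_weaken[OF runs_fst[where u = "enc (hd xs)" and v = "enc (tl xs)"]])
      (cases xs; auto simp: cleanD sz_def)+
  moreover have "runs ?e \<sigma> (9 * sz xs + 8 + 2 * sz (hd [] :: 'a)) (\<sigma>(0 := enc (hd xs)))" if "\<sigma> 0 = []"
    by (rule runs_weaken[OF runs_pushl]) (use that 0 in \<open>auto simp: sz_def\<close>)
  ultimately show "runs (Branch 0 ?e (Push 0 False ;; ?d) (Push 0 True ;; ?d)) \<sigma>
     ((9 * sz xs + 8 + 2 * sz (hd [] :: 'a)) + 3) (\<sigma>(0 := enc (hd xs)))"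
    by (intro runs_peek) auto
qed (intro pb_intros)

text \<open>A decision tree of depth \<open>N\<close>: every consumed bit is absorbed into
  \<open>g\<close>, and words of length at least \<open>N\<close> get the default
  \<open>d\<close>.\<close>

lemma ex_decision_program:
  "\<exists>c t. \<forall>\<sigma>. runs c \<sigma> (2 * length (\<sigma> 0) + t) (\<sigma>(0 := if length (\<sigma> 0) < N then g (\<sigma> 0) else d))"
proof (induction N arbitrary: g)
  case 0
  have "runs (clr 0 ;; pushl 0 d) \<sigma> (2 * length (\<sigma> 0) + (2 * length d + 3)) (\<sigma>(0 := d))" for \<sigma>
    by (intro runs_weaken[OF runs_Seq[OF runs_clr runs_pushl]]) auto
  then show ?case by (intro exI[of _ "clr 0 ;; pushl 0 d"] exI[of _ "2 * length d + 3"])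
      (simp del: fun_upd_apply)
next
  case (Suc N)
  obtain c t where c: "runs c \<sigma> (2 * length (\<sigma> 0) + t)
      (\<sigma>(0 := if length (\<sigma> 0) < N then g (False # \<sigma> 0) else d))" for \<sigma>
    using Suc[of "\<lambda>x. g (False # x)"] by blast
  obtain c' t' where c': "runs c' \<sigma> (2 * length (\<sigma> 0) + t')
      (\<sigma>(0 := if length (\<sigma> 0) < N then g (True # \<sigma> 0) else d))" for \<sigma>
    using Suc[of "\<lambda>x. g (True # x)"] by blast
  have "runs (Branch 0 (pushl 0 (g [])) c c') \<sigma> (2 * length (\<sigma> 0) + (t + t' + 2 * length (g []) + 2))
     (\<sigma>(0 := if length (\<sigma> 0) < Suc N then g (\<sigma> 0) else d))" for \<sigma>
  proof (cases "\<sigma> 0")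
    case Nil
    then show ?thesis
      by (intro runs_weaken[OF runs_Branch(1)[OF _ runs_pushl]]) auto
  next
    case (Cons b x)
    show ?thesis
    proof (cases b)
      case True
      show ?thesis
        by (rule runs_weaken[OF runs_Branch(3)[OF _ c']]) (use Cons True in auto)
    next
      case False
      show ?thesis
        by (rule runs_weaken[OF runs_Branch(2)[OF _ c]]) (use Cons False in auto)
    qed
  qed
  then show ?case by blast
qed

lemma pt_table:
  fixes g :: "'a::enc \<Rightarrow> 'b::enc"
  assumes "finite S"
  shows "pt (\<lambda>x. if x \<in> S then g x else d)"
proof -
  define N where "N = Suc (Max (insert 0 (sz ` S)))"
  have N: "sz x < N" if "x \<in> S" for x
    using that assms by (simp add: N_def less_Suc_eq_le)
  define h where "h w = (if w \<in> enc ` S then enc (g (inv_into S enc w)) else enc d)" for w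
  have inj: "inj_on enc S" by (auto intro: inj_onI enc_inject)
  obtain c t where c: "runs c \<sigma> (2 * length (\<sigma> 0) + t)
      (\<sigma>(0 := if length (\<sigma> 0) < N then h (\<sigma> 0) else enc d))" for \<sigma>
    using ex_decision_program by blast
  have e: "(if length (enc x) < N then h (enc x) else enc d) = enc (if x \<in> S then g x else d)" for x
    using N[of x] inj by (auto simp: h_def sz_def dest: enc_inject)
  show ?thesis
  proof (rule ptI)
    show "pb (\<lambda>a::'a. 2 * sz a + t)" by (intro pb_intros)
    fix a :: 'a and \<sigma> :: store
    assume 0: "\<sigma> 0 = enc a" "clean 0 \<sigma>"
    show "runs c \<sigma> (2 * sz a + t) (\<sigma>(0 := enc (if a \<in> S then g a else d)))"
      using c[of \<sigma>] unfolding 0(1) e sz_def .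
  qed
qed

lemma pt_finite: "finite (UNIV :: 'a::enc set) \<Longrightarrow> pt (g :: 'a \<Rightarrow> 'b::enc)"
  using pt_table[of UNIV g] by simp

lemma runs_Loop_unary:
  assumes c: "\<And>a \<sigma>. \<sigma> 0 = enc a \<Longrightarrow> clean k \<sigma> \<Longrightarrow> runs c \<sigma> (T a) (\<sigma>(0 := enc (h a)))" and k: "k \<le> j" "0 < j"
  shows "\<sigma> j = replicate n True \<Longrightarrow> \<sigma> 0 = enc a \<Longrightarrow> clean k \<sigma> \<Longrightarrow> (\<And>i. i < n \<Longrightarrow> T ((h ^^ i) a) \<le> B) \<Longrightarrow>
    runs (Loop j c c) \<sigma> (n * Suc B + 1) (\<sigma>(j := [], 0 := enc ((h ^^ n) a)))"
proof (induction n arbitrary: \<sigma> a)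
  case 0
  then show ?case
    by (intro runs_weaken[OF runs_Loop_Nil]) (auto simp: fun_eq_iff)
next
  case (Suc n)
  let ?\<sigma> = "\<sigma>(j := replicate n True)"
  have 1: "runs (if True then c else c) ?\<sigma> B (?\<sigma>(0 := enc (h a)))"
    using runs_mono[OF c[of ?\<sigma> a]] Suc.prems(2-3) Suc.prems(4)[of 0] k by simp
  have B: "T ((h ^^ i) (h a)) \<le> B" if "i < n" for i
    using Suc.prems(4)[of "Suc i"] that by (simp add: funpow_swap1)
  have cl: "clean k (?\<sigma>(0 := enc (h a)))" using k Suc.prems(3) by (simp del: fun_upd_apply)
  have 2: "runs (Loop j c c) (?\<sigma>(0 := enc (h a))) (n * Suc B + 1)
      (?\<sigma>(0 := enc (h a), j := [], 0 := enc ((h ^^ n) (h a))))"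
    by (rule Suc.IH[OF _ _ cl B]) (use k in simp_all)
  show ?case
    by (rule runs_weaken[OF runs_Loop_Cons[OF _ 1 2]])
      (use k Suc.prems in \<open>auto simp: fun_eq_iff funpow_swap1\<close>)
qed

text \<open>The bound \<open>P\<close> prevents results from doubling in size at each of
  polynomially many iterations. It concerns \<open>i < n a\<close>, that is, exactly the arguments
  on which the program for \<open>h\<close> is run.\<close>

lemma pt_funpow:
  fixes h :: "'s::enc \<Rightarrow> 's" and s :: "'a::enc \<Rightarrow> 's"
  assumes "pt h" "pt n" "pt s" "pb P" and P: "\<And>a i. i < n a \<Longrightarrow> sz ((h ^^ i) (s a)) \<le> P a"
  shows "pt (\<lambda>a. (h ^^ n a) (s a))"
proof -
  obtain c k T where c0: "computes c k T (\<lambda>a. (h a))"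
    using assms(1) unfolding pt_def by blast
  note c = computesD[OF c0]
  obtain C e where B: "\<And>a m. sz a \<le> m \<Longrightarrow> T a \<le> C * (m + 1) ^ e"
    using pb_bound[OF c(1)] by blast
  obtain d l U where d0: "computes d l U (\<lambda>a. (n a, s a))"
    using pt_Pair[OF assms(2,3)] unfolding pt_def by blast
  note d = computesD[OF d0]
  define j where "j = Suc (k + l)"
  let ?B = "\<lambda>a. C * (P a + 1) ^ e"
  let ?t = "\<lambda>a. Suc (U a + Suc ((3 * n a + 2 * sz (s a) + 3) + Suc ((2 * sz (s a) + 1) + (n a * Suc (?B a) + 1))))"
  show ?thesis
  proof (rule ptI[of ?t])
    have "pb n" using pb_sz[OF assms(2)] by simp
    then show "pb ?t" by (intro pb_intros d(1) assms pb_sz)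
    fix a :: 'a and \<sigma> :: store
    assume 0: "\<sigma> 0 = enc a" and cl: "clean (j + 2) \<sigma>"
    have j: "\<sigma> j = []" "\<sigma> (Suc j) = []" "0 < j" "k \<le> j" "l \<le> j"
      using cleanD[OF cl] by (auto simp: j_def)
    have cl': "clean k \<sigma>" "clean l \<sigma>" using clean_mono[OF cl] j by auto
    define \<sigma>1 where "\<sigma>1 = \<sigma>(0 := enc (n a, s a))"
    define \<sigma>2 where "\<sigma>2 = \<sigma>(0 := [], j := replicate (n a) True, Suc j := rev (enc (s a)))"
    define \<sigma>3 where "\<sigma>3 = \<sigma>(0 := enc (s a), j := replicate (n a) True)"
    have 1: "runs d \<sigma> (U a) \<sigma>1"
      unfolding \<sigma>1_def by (rule d(2)) (use 0 cl' in auto)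
    have 2: "runs (split j (Suc j)) \<sigma>1 (3 * n a + 2 * sz (s a) + 3) \<sigma>2"
      by (rule runs_weaken[OF runs_split[where u = "enc (n a)" and v = "enc (s a)"]])
        (use j in \<open>auto simp: \<sigma>1_def \<sigma>2_def sz_def enc_nat_def fun_eq_iff\<close>)
    have 3: "runs (mv (Suc j) 0) \<sigma>2 (2 * sz (s a) + 1) \<sigma>3"
      by (rule runs_weaken[OF runs_mv]) (use j in \<open>auto simp: \<sigma>2_def \<sigma>3_def sz_def fun_eq_iff\<close>)
    have 4: "runs (Loop j c c) \<sigma>3 (n a * Suc (?B a) + 1) (\<sigma>3(j := [], 0 := enc ((h ^^ n a) (s a))))"
    proof (rule runs_Loop_unary[OF c(2)])
      show "T ((h ^^ i) (s a)) \<le> ?B a" if "i < n a" for i using B[OF P[OF that]] .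
      show "clean k \<sigma>3" using j cl' by (simp add: \<sigma>3_def del: fun_upd_apply)
    qed (use j in \<open>simp_all add: \<sigma>3_def\<close>)
    have 5: "\<sigma>3(j := [], 0 := enc ((h ^^ n a) (s a))) = \<sigma>(0 := enc ((h ^^ n a) (s a)))"
      using j by (auto simp: fun_eq_iff \<sigma>3_def)
    show "runs (d ;; split j (Suc j) ;; mv (Suc j) 0 ;; Loop j c c) \<sigma> (?t a)
        (\<sigma>(0 := enc ((h ^^ n a) (s a))))"
      using runs_Seq[OF 1 runs_Seq[OF 2 runs_Seq[OF 3 4]]] unfolding 5 .
  qed
qed

section \<open>Conversion between strings and their encodings\<close>

text \<open>The three bits of \<open>dbl [b]\<close>, last one first.\<close>

definition push3 :: "bool \<Rightarrow> com" where
  "push3 b = Push 0 False ;; Push 0 b ;; Push 0 True"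

lemma runs_unraw_loop:
  "\<sigma> 0 = enc ys \<Longrightarrow> runs (Loop 1 (push3 False) (push3 True)) \<sigma> (6 * length (\<sigma> 1) + 1)
    (\<sigma>(1 := [], 0 := enc (rev (\<sigma> 1) @ ys)))"
proof (induction "\<sigma> 1" arbitrary: \<sigma> ys)
  case Nil
  then show ?case
    by (intro runs_weaken[OF runs_Loop_Nil]) (auto simp: fun_eq_iff)
next
  case (Cons x xs)
  let ?\<sigma> = "\<sigma>(1 := xs, 0 := enc (x # ys))"
  have "runs (push3 x) (\<sigma>(1 := xs)) 5 ?\<sigma>"
    unfolding push3_def
    by (rule runs_weaken[OF runs_Seq[OF runs_Push runs_Seq[OF runs_Push runs_Push]]])
      (use Cons(3-) in \<open>auto simp: fun_eq_iff enc_bool_def\<close>)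
  then have 1: "runs (if x then push3 True else push3 False) (\<sigma>(1 := xs)) 5 ?\<sigma>"
    by (cases x) auto
  have 2: "runs (Loop 1 (push3 False) (push3 True)) ?\<sigma> (6 * length xs + 1)
      (\<sigma>(1 := [], 0 := enc (rev (\<sigma> 1) @ ys)))"
    by (rule runs_weaken[OF Cons(1)[where ys = "x # ys"]])
      (use Cons(3-) in \<open>auto simp: fun_eq_iff Cons(2)[symmetric] simp del: One_nat_def\<close>)
  show ?case
    by (rule runs_weaken[OF runs_Loop_Cons[OF _ 1 2]]) (auto simp: Cons(2)[symmetric] simp del: One_nat_def)
qed

lemma pt_unraw: "pt unraw"
proof (rule ptI[of "\<lambda>a. 8 * sz a + 3" 2])
  fix a :: raw and \<sigma> :: store
  assume 0: "\<sigma> 0 = enc a" "clean 2 \<sigma>"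
  show "runs (mv 0 1 ;; Loop 1 (push3 False) (push3 True)) \<sigma> (8 * sz a + 3) (\<sigma>(0 := enc (unraw a)))"
    by (rule runs_weaken[OF runs_Seq[OF runs_mv runs_unraw_loop[where ys = "[]"]]])
      (use 0 cleanD[of 2 \<sigma> 1] in \<open>auto simp: fun_eq_iff enc_raw_def sz_def\<close>)
qed (intro pb_intros)

text \<open>The leading \<open>True\<close> of each element has already been consumed by the
  surrounding loop; the inner \<open>Branch\<close> discards the closing
  \<open>False\<close>.\<close>

definition pop3 :: com where
  "pop3 = Branch 0 Skip (Push 1 False ;; Branch 0 Skip Skip Skip) (Push 1 True ;; Branch 0 Skip Skip Skip)"

lemma runs_raw_loop:
  "\<sigma> 0 = enc ys \<Longrightarrow> runs (Loop 0 Skip pop3) \<sigma> (6 * length ys + 1) (\<sigma>(0 := [], 1 := rev ys @ \<sigma> 1))"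
proof (induction ys arbitrary: \<sigma>)
  case Nil
  then show ?case
    by (intro runs_weaken[OF runs_Loop_Nil]) (auto simp: fun_eq_iff)
next
  case (Cons y ys)
  let ?\<sigma> = "\<sigma>(0 := enc ys, 1 := y # \<sigma> 1)"
  have b: "runs (Branch 0 Skip Skip Skip) (\<sigma>(0 := False # enc ys, 1 := y # \<sigma> 1)) 2 ?\<sigma>"
    by (rule runs_weaken[OF runs_Branch(2)[OF _ runs_Skip]]) (auto simp: fun_eq_iff)
  have p: "runs (Push 1 y) (\<sigma>(0 := False # enc ys)) 1 (\<sigma>(0 := False # enc ys, 1 := y # \<sigma> 1))"
    by (rule runs_weaken[OF runs_Push]) (auto simp: fun_eq_iff)
  let ?b = "Branch 0 Skip Skip Skip"
  have "runs (if y then Push 1 True ;; ?b else Push 1 False ;; ?b) (\<sigma>(0 := False # enc ys)) (Suc (1 + 2)) ?\<sigma>"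
    using runs_Seq[OF p b] by (cases y) auto
  then have 1: "runs pop3 (\<sigma>(0 := y # False # enc ys)) 5 ?\<sigma>"
    unfolding pop3_def by (intro runs_weaken[OF runs_Branch_Cons[where b = y and xs = "False # enc ys"]]) auto
  have 2: "runs (Loop 0 Skip pop3) ?\<sigma> (6 * length ys + 1) (\<sigma>(0 := [], 1 := rev (y # ys) @ \<sigma> 1))"
    by (rule runs_weaken[OF Cons(1)]) (auto simp: fun_eq_iff)
  show ?case
    by (rule runs_weaken[OF runs_Loop_True[OF _ 1 2]])
      (use Cons(2) in \<open>auto simp: enc_bool_def\<close>)
qed

lemma length_le_sz: "length (xs :: 'a::enc list) \<le> sz xs"
  by (induction xs) auto

lemma pt_Raw: "pt Raw"
proof (rule ptI[of "\<lambda>a. 8 * sz a + 3" 2])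
  fix a :: "bool list" and \<sigma> :: store
  assume 0: "\<sigma> 0 = enc a" "clean 2 \<sigma>"
  show "runs (Loop 0 Skip pop3 ;; mv 1 0) \<sigma> (8 * sz a + 3) (\<sigma>(0 := enc (Raw a)))"
    by (rule runs_weaken[OF runs_Seq[OF runs_raw_loop[where ys = a] runs_mv]])
      (use 0 cleanD[of 2 \<sigma> 1] length_le_sz[of a] in \<open>auto simp: fun_eq_iff enc_raw_def\<close>)
qed (intro pb_intros)

lemma poly_time_computableI:
  assumes "pt \<mu>"
  shows "poly_time_computable \<mu>"
proof -
  have "pt (\<lambda>w. Raw (\<mu> (unraw w)))"
    by (intro pt_comp[OF pt_Raw] pt_comp[OF assms] pt_unraw)
  then obtain c k T where c0: "computes c k T (\<lambda>w. Raw (\<mu> (unraw w)))"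
    unfolding pt_def by blast
  note c = computesD[OF c0]
  have sT: "pb (\<lambda>a. sz (Raw (\<mu> (unraw a))))"
    using \<open>pt (\<lambda>w. Raw (\<mu> (unraw w)))\<close> by (rule pb_sz)
  \<comment> \<open>The machine presents its input with the last bit on top, whereas codes start at
    the top. Three moves through stacks 1 and 2 reverse stack 0.\<close>
  let ?rv = "mv 0 1 ;; mv 1 2 ;; mv 2 0"
  have rv: "runs ?rv \<sigma> (6 * length (\<sigma> 0) + 5) (\<sigma>(0 := rev (\<sigma> 0)))" if "\<sigma> 1 = []" "\<sigma> 2 = []" for \<sigma>
    by (rule runs_weaken[OF runs_Seq[OF runs_mv runs_Seq[OF runs_mv runs_mv]]])
      (use that in \<open>auto simp: fun_eq_iff\<close>)
  let ?t = "\<lambda>w. Suc ((6 * sz w + 5) + Suc (T w + (6 * sz (Raw (\<mu> (unraw w))) + 5)))"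
  have "pb ?t" by (intro pb_intros c(1) sT)
  then obtain C e where t: "?t a \<le> C * (sz a + 1) ^ e" for a unfolding pb_def by blast
  have "\<exists>\<sigma>'. runs (?rv ;; c ;; ?rv) ((\<lambda>_. [])(0 := rev x)) (C * (length x + 1) ^ e) \<sigma>' \<and> rev (\<sigma>' 0) = \<mu> x" for x
  proof -
    let ?\<sigma> = "(\<lambda>_. []) :: store"
    have 1: "runs ?rv (?\<sigma>(0 := rev x)) (6 * sz (Raw x) + 5) (?\<sigma>(0 := x))"
      by (rule runs_weaken[OF rv]) (auto simp: sz_def enc_raw_def)
    have 2: "runs c (?\<sigma>(0 := x)) (T (Raw x)) (?\<sigma>(0 := \<mu> x))"
      by (rule runs_weaken[OF c(2)[of _ "Raw x"]]) (auto simp: clean_def enc_raw_def)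
    have 3: "runs ?rv (?\<sigma>(0 := \<mu> x)) (6 * sz (Raw (\<mu> x)) + 5) (?\<sigma>(0 := rev (\<mu> x)))"
      by (rule runs_weaken[OF rv]) (auto simp: sz_def enc_raw_def)
    have "runs (?rv ;; c ;; ?rv) (?\<sigma>(0 := rev x)) (C * (length x + 1) ^ e) (?\<sigma>(0 := rev (\<mu> x)))"
      by (rule runs_mono[OF runs_Seq[OF 1 runs_Seq[OF 2 3]]]) (use t[of "Raw x"] in \<open>simp add: sz_def enc_raw_def\<close>)
    then show ?thesis by (intro exI conjI) auto
  qed
  then show ?thesis by (rule poly_time_computable_com)
qed

section \<open>Closure properties of the polynomial-time functions\<close>

named_theorems pt_intros

declare pt_id [pt_intros] pt_const [pt_intros] pt_Pair [pt_intros] pt_If [pt_intros]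

lemmas pt_lift [pt_intros] = pt_comp[OF pt_fst] pt_comp[OF pt_snd] pt_comp[OF pt_hd] pt_comp[OF pt_tl]
  pt_comp[OF pt_null] pt_comp[OF pt_nat_0] pt_comp[OF pt_Suc] pt_comp[OF pt_pred]

lemma pt_ConsI [pt_intros]: "pt f \<Longrightarrow> pt g \<Longrightarrow> pt (\<lambda>x. f x # g x)"
  using pt_comp[OF pt_Cons pt_Pair] by simp

lemma pt_boolI: "pt f \<Longrightarrow> pt (\<lambda>x. (g :: bool \<Rightarrow> 'b::enc) (f x))"
  by (rule pt_comp[OF pt_finite]) simp_all

lemma pt_bool2I: "pt f \<Longrightarrow> pt g \<Longrightarrow> pt (\<lambda>x. (h :: bool \<Rightarrow> bool \<Rightarrow> 'b::enc) (f x) (g x))"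
  using pt_comp[OF pt_finite[of "\<lambda>p. h (fst p) (snd p)"] pt_Pair, of f g] by simp

lemma pt_Not [pt_intros]: "pt f \<Longrightarrow> pt (\<lambda>x. \<not> f x)"
  by (rule pt_boolI)

lemma pt_conj [pt_intros]: "pt f \<Longrightarrow> pt g \<Longrightarrow> pt (\<lambda>x. f x \<and> g x)"
  by (rule pt_bool2I)

lemma pt_disj [pt_intros]: "pt f \<Longrightarrow> pt g \<Longrightarrow> pt (\<lambda>x. f x \<or> g x)"
  by (rule pt_bool2I)

lemma pt_bool_eq [pt_intros]: "pt f \<Longrightarrow> pt g \<Longrightarrow> pt (\<lambda>x. (f x :: bool) = g x)"
  by (rule pt_bool2I)

lemma pt_nat_table [pt_intros]: "pt f \<Longrightarrow> pt (\<lambda>x. if f x < (Q::nat) then g (f x) else d)"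
  using pt_comp[OF pt_table[of "{..<Q}" g d]] by simp

lemma pt_in_finite: "finite S \<Longrightarrow> pt f \<Longrightarrow> pt (\<lambda>x. f x \<in> S)"
proof -
  assume "finite S" "pt f"
  then have "pt (\<lambda>x. if f x \<in> S then True else False)" by (intro pt_comp[OF pt_table])
  moreover have "(\<lambda>x. if f x \<in> S then True else False) = (\<lambda>x. f x \<in> S)" by auto
  ultimately show ?thesis by simp
qed

lemma pt_nat_eq_const [pt_intros]: "pt f \<Longrightarrow> pt (\<lambda>x. f x = (c::nat))"
  using pt_in_finite[of "{c}" f] by simp

lemma pt_nat_less_const [pt_intros]: "pt f \<Longrightarrow> pt (\<lambda>x. f x < (c::nat))"
  using pt_in_finite[of "{..<c}" f] by simp

lemma pt_app2: "pt (\<lambda>p. h (fst p) (snd p)) \<Longrightarrow> pt f \<Longrightarrow> pt g \<Longrightarrow> pt (\<lambda>x. h (f x) (g x))"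
  using pt_comp[OF _ pt_Pair, of "\<lambda>p. h (fst p) (snd p)" f g] by simp

lemma pt_app3: "pt (\<lambda>p. h (fst p) (fst (snd p)) (snd (snd p))) \<Longrightarrow> pt f \<Longrightarrow> pt g \<Longrightarrow> pt k \<Longrightarrow>
    pt (\<lambda>x. h (f x) (g x) (k x))"
  using pt_comp[OF _ pt_Pair[OF _ pt_Pair], of "\<lambda>p. h (fst p) (fst (snd p)) (snd (snd p))" f g k] by simp

lemma pb_nat: "pt f \<Longrightarrow> pb f"
  using pb_sz[of f] by simp

text \<open>The parameter \<open>a\<close> is carried along unchanged as the first component of the
  state.\<close>

lemma pt_funpow_ctx:
  fixes h :: "'a::enc \<Rightarrow> 's::enc \<Rightarrow> 's"
  assumes "pt (\<lambda>p. h (fst p) (snd p))" "pt n" "pt s" "pb P"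
    and P: "\<And>a i. i < n a \<Longrightarrow> sz ((h a ^^ i) (s a)) \<le> P a"
  shows "pt (\<lambda>a. (h a ^^ n a) (s a))"
proof -
  define H where "H p = (fst p, h (fst p) (snd p))" for p
  have H: "(H ^^ i) (a, b) = (a, (h a ^^ i) b)" for i a b
    by (induction i) (auto simp: H_def)
  have pt: "pt H" unfolding H_def by (intro pt_intros assms)
  have "pt (\<lambda>a. (H ^^ n a) (a, s a))"
  proof (rule pt_funpow[OF pt assms(2)])
    show "pb (\<lambda>a. 2 * sz a + 1 + P a)" by (intro pb_intros assms)
    show "sz ((H ^^ i) (a, s a)) \<le> 2 * sz a + 1 + P a" if "i < n a" for a i
      using P[OF that] by (simp add: H)
  qed (intro pt_intros assms)
  then have "pt (\<lambda>a. snd ((H ^^ n a) (a, s a)))" by (intro pt_intros)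
  then show ?thesis by (simp add: H)
qed

lemma runs_sz_loop:
  "runs (Loop 0 (Push 1 True) (Push 1 True)) \<sigma> (2 * length (\<sigma> 0) + 1)
    (\<sigma>(0 := [], 1 := replicate (length (\<sigma> 0)) True @ \<sigma> 1))"
proof (induction "\<sigma> 0" arbitrary: \<sigma>)
  case Nil
  then show ?case
    by (intro runs_weaken[OF runs_Loop_Nil]) (auto simp: fun_eq_iff)
next
  case (Cons x xs)
  let ?\<sigma> = "\<sigma>(0 := xs, 1 := True # \<sigma> 1)"
  have 1: "runs (if x then Push 1 True else Push 1 True) (\<sigma>(0 := xs)) 1 ?\<sigma>"
    by (simp, rule runs_weaken[OF runs_Push]) auto
  have 2: "runs (Loop 0 (Push 1 True) (Push 1 True)) ?\<sigma> (2 * length xs + 1)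
     (\<sigma>(0 := [], 1 := replicate (length (\<sigma> 0)) True @ \<sigma> 1))"
    by (rule runs_weaken[OF Cons(1)])
      (auto simp: fun_eq_iff Cons(2)[symmetric] replicate_append_same simp del: One_nat_def)
  show ?case
    by (rule runs_weaken[OF runs_Loop_Cons[OF _ 1 2]]) (auto simp: Cons(2)[symmetric])
qed

lemma pt_sz: "pt sz"
proof (rule ptI[of "\<lambda>a. 4 * sz a + 3" 2])
  fix a :: 'a and \<sigma> :: store
  assume 0: "\<sigma> 0 = enc a" "clean 2 \<sigma>"
  show "runs (Loop 0 (Push 1 True) (Push 1 True) ;; mv 1 0) \<sigma> (4 * sz a + 3) (\<sigma>(0 := enc (sz a)))"
    by (rule runs_weaken[OF runs_Seq[OF runs_sz_loop runs_mv]])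
      (use 0 cleanD[of 2 \<sigma> 1] in \<open>auto simp: fun_eq_iff enc_nat_def sz_def\<close>)
qed (intro pb_intros)

lemmas pt_szI [pt_intros] = pt_comp[OF pt_sz]

lemma sz_in_set: "x \<in> set xs \<Longrightarrow> sz x \<le> sz xs"
  by (induction xs) auto

lemma sz_append [simp]: "sz (xs @ ys) = sz xs + sz ys"
  by (induction xs) auto

lemma pt_foldl:
  fixes h :: "'a::enc \<Rightarrow> 's::enc \<Rightarrow> 'e::enc \<Rightarrow> 's"
  assumes h: "pt (\<lambda>p. h (fst p) (fst (snd p)) (snd (snd p)))" and xs: "pt xs" and s: "pt s"
    and P: "pb P" "\<And>a i. i \<le> length (xs a) \<Longrightarrow> sz (foldl (h a) (s a) (take i (xs a))) \<le> P a"
  shows "pt (\<lambda>a. foldl (h a) (s a) (xs a))"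
proof -
  \<comment> \<open>The state pairs the unread rest of the list with the accumulator.
    \<open>G\<close> idles when the list is used up, so \<open>sz (xs a)\<close> iterations do as
    well as the exact length.\<close>
  define G where "G a p = (if fst p = [] then p else (tl (fst p), h a (snd p) (hd (fst p))))" for a p
  have G: "(G a ^^ i) (ys, b) = (drop i ys, foldl (h a) b (take i ys))" for a i ys b
  proof (induction i arbitrary: ys b)
    case (Suc i)
    show ?case
    proof (cases ys)
      case Nil
      then show ?thesis using Suc[of "[]" b] by (simp only: funpow_Suc_app G_def) simp
    next
      case (Cons y ys')
      then show ?thesis using Suc[of ys' "h a b y"] by (simp only: funpow_Suc_app G_def) simp
    qed
  qed simp
  have "pt (\<lambda>p. G (fst p) (snd p))"
    unfolding G_def by (intro pt_intros pt_app3[OF h])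
  then have "pt (\<lambda>a. (G a ^^ sz (xs a)) (xs a, s a))"
  proof (rule pt_funpow_ctx)
    show "pb (\<lambda>a. 2 * sz (xs a) + 1 + P a)" by (intro pb_intros pb_sz xs P)
    fix a i
    have "sz (foldl (h a) (s a) (take i (xs a))) \<le> P a"
      using P(2)[of i a] P(2)[of "length (xs a)" a] by (cases "i \<le> length (xs a)") auto
    moreover have "sz (drop i (xs a)) \<le> sz (take i (xs a) @ drop i (xs a))" by (simp only: sz_append)
    ultimately show "sz ((G a ^^ i) (xs a, s a)) \<le> 2 * sz (xs a) + 1 + P a"
      by (simp add: G)
  qed (intro pt_intros xs s)+
  then have "pt (\<lambda>a. snd ((G a ^^ sz (xs a)) (xs a, s a)))" by (intro pt_intros)
  then show ?thesis by (simp add: G length_le_sz)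
qed

text \<open>The measure \<open>m\<close> replaces \<open>sz\<close> because moving data between the components of a pair
  changes its size by a factor.\<close>
lemma pt_foldl_growth:
  fixes h :: "'a::enc \<Rightarrow> 's::enc \<Rightarrow> 'e::enc \<Rightarrow> 's"
  assumes h: "pt (\<lambda>p. h (fst p) (fst (snd p)) (snd (snd p)))" and xs: "pt xs" and s: "pt s"
    and D: "pb D" and m: "pb (\<lambda>a. m (s a))" "\<And>st. sz st \<le> K * m st + K"
    and step: "\<And>a st e. e \<in> set (xs a) \<Longrightarrow> m (h a st e) \<le> m st + D a"
  shows "pt (\<lambda>a. foldl (h a) (s a) (xs a))"
proof (rule pt_foldl[OF h xs s])
  show "pb (\<lambda>a. K * (m (s a) + sz (xs a) * D a) + K)" by (intro pb_intros pb_sz xs D m(1))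
  fix a i assume i: "i \<le> length (xs a)"
  then have "m (foldl (h a) (s a) (take i (xs a))) \<le> m (s a) + i * D a"
  proof (induction i)
    case (Suc i)
    then have "take (Suc i) (xs a) = take i (xs a) @ [xs a ! i]" by (simp add: take_Suc_conv_app_nth)
    then show ?case using step[of "xs a ! i" a "foldl (h a) (s a) (take i (xs a))"] Suc by simp
  qed simp
  moreover have "i * D a \<le> sz (xs a) * D a"
    using i length_le_sz[of "xs a"] by (intro mult_le_mono1) simp
  ultimately have "m (foldl (h a) (s a) (take i (xs a))) \<le> m (s a) + sz (xs a) * D a" by linarith
  then have "K * m (foldl (h a) (s a) (take i (xs a))) \<le> K * (m (s a) + sz (xs a) * D a)"
    by (rule mult_le_mono2)
  then show "sz (foldl (h a) (s a) (take i (xs a))) \<le> K * (m (s a) + sz (xs a) * D a) + K"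
    using m(2)[of "foldl (h a) (s a) (take i (xs a))"] by linarith
qed

lemma pt_add [pt_intros]: "pt f \<Longrightarrow> pt g \<Longrightarrow> pt (\<lambda>x. f x + g x :: nat)"
proof -
  assume *: "pt f" "pt g"
  note pb = pb_nat[OF *(1)] pb_nat[OF *(2)]
  have e: "(Suc ^^ i) n = i + n" for i n by (induction i) auto
  have "pt (\<lambda>x. (Suc ^^ f x) (g x))"
    by (rule pt_funpow[OF pt_Suc *, where P = "\<lambda>a. sz (f a) + sz (g a)"])
      (auto intro!: pb_intros pb * simp: e)
  then show ?thesis by (simp add: e)
qed

lemma pt_mult [pt_intros]: "pt f \<Longrightarrow> pt g \<Longrightarrow> pt (\<lambda>x. f x * g x :: nat)"
proof -
  assume *: "pt f" "pt g"
  note pb = pb_nat[OF *(1)] pb_nat[OF *(2)]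
  have e: "((\<lambda>c. c + k) ^^ i) 0 = i * k" for i k :: nat by (induction i) auto
  have "pt (\<lambda>x. ((\<lambda>c. c + g x) ^^ f x) 0)"
    by (rule pt_funpow_ctx[where P = "\<lambda>a. sz (f a) * sz (g a)"])
      (auto intro!: pb_intros pb pt_intros * pt_comp[OF *(2)] simp: e)
  then show ?thesis by (simp add: e)
qed

lemma pt_power [pt_intros]: "pt f \<Longrightarrow> pt (\<lambda>x. f x ^ k :: nat)"
  by (induction k) (auto intro!: pt_intros)

lemma pt_diff [pt_intros]: "pt f \<Longrightarrow> pt g \<Longrightarrow> pt (\<lambda>x. f x - g x :: nat)"
proof -
  assume *: "pt f" "pt g"
  have e: "((\<lambda>n. n - 1) ^^ i) n = n - i" for i n :: nat by (induction i) auto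
  have "pt (\<lambda>x. ((\<lambda>n. n - 1) ^^ g x) (f x))"
    by (rule pt_funpow[OF pt_pred *(2,1), where P = "\<lambda>a. sz (f a)"])
      (auto intro!: pb_nat * simp: e[simplified])
  then show ?thesis by (simp add: e[simplified])
qed

lemma pt_rev_append: "pt f \<Longrightarrow> pt g \<Longrightarrow> pt (\<lambda>x. rev (f x) @ g x)"
proof -
  assume *: "pt f" "pt g"
  have e: "foldl (\<lambda>s e. e # s) ys xs = rev xs @ ys" for xs ys :: "'b list"
    by (induction xs arbitrary: ys) auto
  have "pt (\<lambda>x. foldl (\<lambda>s e. e # s) (g x) (f x))"
    by (rule pt_foldl_growth[where m = sz and K = 1 and D = "\<lambda>a. 2 * sz (f a) + 1"])
      (auto intro!: pt_intros pb_intros pb_nat pb_sz * simp: sz_in_set)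
  then show ?thesis by (simp add: e)
qed

lemma pt_rev [pt_intros]: "pt f \<Longrightarrow> pt (\<lambda>x. rev (f x))"
  using pt_rev_append[OF _ pt_const, of f "[]"] by simp

lemma pt_append [pt_intros]: "pt f \<Longrightarrow> pt g \<Longrightarrow> pt (\<lambda>x. f x @ g x)"
  using pt_rev_append[OF pt_rev, of f g] by simp

lemma pt_length [pt_intros]: "pt f \<Longrightarrow> pt (\<lambda>x. length (f x))"
proof -
  assume *: "pt f"
  have e: "foldl (\<lambda>n _. Suc n) k xs = k + length xs" for k and xs :: "'b list"
    by (induction xs arbitrary: k) auto
  have "pt (\<lambda>x. foldl (\<lambda>n _. Suc n) 0 (f x))"
    by (rule pt_foldl_growth[where m = sz and K = 1 and D = "\<lambda>a. 1"])
      (auto intro!: pt_intros pb_intros *)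
  then show ?thesis by (simp add: e)
qed

lemma sz_replicate [simp]: "sz (replicate n a) = n * (2 * sz a + 1)"
  by (induction n) auto

lemma pt_replicate [pt_intros]: "pt f \<Longrightarrow> pt g \<Longrightarrow> pt (\<lambda>x. replicate (f x) (g x))"
proof -
  assume *: "pt f" "pt g"
  have e: "((#) a ^^ n) [] = replicate n a" for a :: 'b and n by (induction n) auto
  have "pt (\<lambda>x. ((#) (g x) ^^ f x) [])"
    by (rule pt_funpow_ctx[where P = "\<lambda>a. sz (f a) * (2 * sz (g a) + 1)"])
      (auto intro!: pb_intros pb_nat pb_sz pt_intros * pt_comp[OF *(2)] simp: e simp del: sz_list_simps mult_Suc_right)
  then show ?thesis by (simp add: e)
qed

lemma pt_map [pt_intros]:
  fixes f :: "'a::enc \<Rightarrow> 'e::enc \<Rightarrow> 'b::enc"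
  assumes "pt (\<lambda>p. f (fst p) (snd p))" "pt xs"
  shows "pt (\<lambda>x. map (f x) (xs x))"
proof -
  obtain C e where Ce: "\<And>p n. sz p \<le> n \<Longrightarrow> sz (f (fst p) (snd p)) \<le> C * (n + 1) ^ e"
    using pb_bound[OF pb_sz[OF assms(1)]] by blast
  have eq: "foldl (\<lambda>s e. f x e # s) ys zs = rev (map (f x) zs) @ ys" for x ys zs
    by (induction zs arbitrary: ys) auto
  have "pt (\<lambda>x. foldl (\<lambda>s e. f x e # s) [] (xs x))"
  proof (rule pt_foldl_growth[where m = sz and K = 1 and
        D = "\<lambda>x. 2 * (C * ((2 * sz x + 1 + sz (xs x)) + 1) ^ e) + 1"])
    fix a st e' assume "e' \<in> set (xs a)"
    then have "sz (a, e') \<le> 2 * sz a + 1 + sz (xs a)" by (simp add: sz_in_set)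
    then have "sz (f a e') \<le> C * ((2 * sz a + 1 + sz (xs a)) + 1) ^ e" using Ce[of "(a, e')"] by simp
    then show "sz (f a e' # st) \<le> sz st + (2 * (C * ((2 * sz a + 1 + sz (xs a)) + 1) ^ e) + 1)" by simp
  qed (auto intro!: pt_intros pb_intros pb_nat pb_sz assms pt_app2[OF assms(1)])
  then have "pt (\<lambda>x. rev (foldl (\<lambda>s e. f x e # s) [] (xs x)))" by (intro pt_intros)
  then show ?thesis by (simp add: eq)
qed

lemma pt_concat [pt_intros]: "pt f \<Longrightarrow> pt (\<lambda>x. concat (f x))"
proof -
  assume *: "pt f"
  have e: "foldl (@) ys xs = ys @ concat xs" for ys :: "'b list" and xs
    by (induction xs arbitrary: ys) auto
  have "pt (\<lambda>x. foldl (@) [] (f x))"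
    by (rule pt_foldl_growth[where m = sz and K = 1 and D = "\<lambda>a. sz (f a)"])
      (auto intro!: pt_intros pb_intros pb_nat pb_sz * simp: sz_in_set)
  then show ?thesis by (simp add: e)
qed

lemma pt_list_all [pt_intros]:
  fixes f :: "'a::enc \<Rightarrow> 'e::enc \<Rightarrow> bool"
  assumes "pt (\<lambda>p. f (fst p) (snd p))" "pt xs"
  shows "pt (\<lambda>x. list_all (f x) (xs x))"
proof -
  have eq: "foldl (\<lambda>s e. s \<and> f x e) b zs \<longleftrightarrow> b \<and> list_all (f x) zs" for x b zs
    by (induction zs arbitrary: b) auto
  have "pt (\<lambda>x. foldl (\<lambda>s e. s \<and> f x e) True (xs x))"
    by (rule pt_foldl_growth[where m = sz and K = 1 and D = "\<lambda>a. 1"])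
      (auto intro!: pt_intros pb_intros pb_nat pb_sz assms pt_app2[OF assms(1)])
  then show ?thesis by (simp add: eq)
qed

lemma pt_dropWhile [pt_intros]:
  assumes "pt P" "pt f"
  shows "pt (\<lambda>x. dropWhile P (f x))"
proof -
  define h where "h s = (if s \<noteq> [] \<and> P (hd s) then tl s else s)" for s
  have h: "pt h" unfolding h_def by (intro pt_intros pt_comp[OF assms(1)])
  have s: "sz (h xs) \<le> sz xs" for xs by (cases xs) (auto simp: h_def)
  have sz: "sz ((h ^^ i) xs) \<le> sz xs" for i xs
    by (induction i) (auto intro: le_trans[OF s])
  have d: "(h ^^ i) xs = dropWhile P xs" if "length xs \<le> i" for i xs
    using that
  proof (induction i arbitrary: xs)
    case (Suc i)
    show ?case
    proof (cases "xs \<noteq> [] \<and> P (hd xs)")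
      case True
      then have "h xs = tl xs" "dropWhile P xs = dropWhile P (tl xs)" by (cases xs; simp add: h_def)+
      then show ?thesis using Suc.IH[of "tl xs"] Suc.prems by (simp only: funpow_Suc_app) simp
    next
      case False
      then have "h xs = xs" "dropWhile P xs = xs" by (cases xs; auto simp: h_def)+
      moreover from this have "(h ^^ i) xs = xs" for i by (induction i) auto
      ultimately show ?thesis by metis
    qed
  qed simp
  have "pt (\<lambda>x. (h ^^ length (f x)) (f x))"
    by (rule pt_funpow[OF h _ _ pb_sz[OF assms(2)]]) (auto intro!: pt_intros assms sz)
  then show ?thesis by (simp add: d)
qed

lemma pt_takeWhile [pt_intros]:
  assumes "pt P" "pt f"
  shows "pt (\<lambda>x. takeWhile P (f x))"
proof -
  define h where "h s e = (if fst s then s else if P e then (False, snd s @ [e]) else (True, snd s))" for s e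
  have T: "foldl h (True, ys) xs = (True, ys)" for ys xs by (induction xs) (auto simp: h_def)
  have F: "snd (foldl h (False, ys) xs) = ys @ takeWhile P xs" for ys xs
    by (induction xs arbitrary: ys) (auto simp: h_def T)
  have "pt (\<lambda>x. foldl h (False, []) (f x))"
    by (rule pt_foldl_growth[where m = sz and K = 1 and D = "\<lambda>a. 2 * sz (f a) + 1"])
      (auto intro!: pt_intros pb_intros pb_nat pb_sz assms pt_comp[OF assms(1)] simp: h_def sz_in_set)
  then have "pt (\<lambda>x. snd (foldl h (False, []) (f x)))" by (intro pt_intros)
  then show ?thesis by (simp add: F)
qed

lemma pt_nat_list_eq_const [pt_intros]: "pt f \<Longrightarrow> pt (\<lambda>x. f x = (cs :: nat list))"
proof (induction cs arbitrary: f)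
  case Nil
  then show ?case by (intro pt_intros)
next
  case (Cons c cs)
  have "pt (\<lambda>x. f x \<noteq> [] \<and> hd (f x) = c \<and> tl (f x) = cs)"
    by (intro pt_intros Cons)
  moreover have "f x \<noteq> [] \<and> hd (f x) = c \<and> tl (f x) = cs \<longleftrightarrow> f x = c # cs" for x
    by (cases "f x") auto
  ultimately show ?case by simp
qed

section \<open>Simulation of Turing machines\<close>

lemma finite_sym: "finite (UNIV :: sym set)"
proof -
  have "(UNIV :: sym set) = {Bl, S0, S1}" by (auto intro: sym.exhaust)
  then show ?thesis by (metis finite.emptyI finite.insertI)
qed

lemma finite_dir: "finite (UNIV :: dir set)"
proof -
  have "(UNIV :: dir set) = {MvL, MvN, MvR}" by (auto intro: dir.exhaust)
  then show ?thesis by (metis finite.emptyI finite.insertI)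
qed

text \<open>Restricting the transition function to states below \<open>Q\<close> makes it a finite
  table.\<close>

definition table :: "nat \<Rightarrow> tm \<Rightarrow> nat \<times> sym \<Rightarrow> nat \<times> sym \<times> dir" where
  "table Q \<delta> p = (if p \<in> {..<Q} \<times> UNIV then \<delta> (fst p) (snd p) else (1, Bl, MvN))"

definition sim_step :: "nat \<Rightarrow> tm \<Rightarrow> config \<Rightarrow> config" where
  "sim_step Q \<delta> c = (if fst c = 1 then c else
     (let ls = fst (snd c); rs = snd (snd c); r = table Q \<delta> (fst c, if rs = [] then Bl else hd rs);
          q = fst r; b = fst (snd r)
      in if snd (snd r) = MvL then (q, tl ls, (if ls = [] then Bl else hd ls) # b # tl rs)
         else if snd (snd r) = MvN then (q, ls, b # tl rs)
         else (q, b # ls, tl rs)))"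

lemma look_0: "look xs 0 = (if xs = [] then Bl else hd xs)"
  by (cases xs) auto

lemma sim_step_eq: "fst c < Q \<Longrightarrow> sim_step Q \<delta> c = tm_step \<delta> c"
  by (cases c) (auto simp: sim_step_def table_def tm_step_look look_0 Let_def split: prod.split dir.split
      simp del: tm_step.simps)

lemma pt_sim_step: "pt (sim_step Q \<delta>)"
proof -
  have "finite ({..<Q} \<times> (UNIV :: sym set))" using finite_sym by simp
  then have "pt (table Q \<delta>)" unfolding table_def by (rule pt_table)
  note 1 = pt_comp[OF this]
  have 2: "pt (\<lambda>x. g x = v)" if "pt g" for g :: "config \<Rightarrow> dir" and v
    by (rule pt_comp[OF pt_finite[OF finite_dir] that])
  show ?thesis unfolding sim_step_def Let_def by (intro pt_intros 1 2)
qed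

definition tape_len :: "config \<Rightarrow> nat" where
  "tape_len c = length (fst (snd c)) + length (snd (snd c))"

text \<open>Two cells can appear at once: on an empty tape a left move creates the written cell and
  the new cell under the head.\<close>

lemma tape_len_step: "tape_len (tm_step \<delta> c) \<le> tape_len c + 2"
  by (cases c) (auto simp: tape_len_def tm_step_look split: prod.split dir.split simp del: tm_step.simps)

lemma sz_sym_list: "sz (xs :: sym list) \<le> 3 * length xs"
proof (induction xs)
  case (Cons x xs)
  then show ?case using sz_sym[of x] by simp
qed simp

lemma pt_tm_run:
  assumes "tm_wf Q \<delta>" "pt n" "pt f"
  shows "pt (\<lambda>x. (tm_step \<delta> ^^ n x) (0, [], f x))"
proof -
  have q: "fst ((tm_step \<delta> ^^ i) (0, [], y)) < Q" for i y
  proof (induction i)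
    case (Suc i)
    obtain q ls rs where c: "(tm_step \<delta> ^^ i) (0, [], y) = (q, ls, rs)" by (cases "(tm_step \<delta> ^^ i) (0, [], y)")
    then have "fst (\<delta> q a) < Q" for a using Suc assms(1) by (auto simp: tm_wf_def)
    then show ?case using Suc c
      by (auto simp: tm_step_look split: prod.split dir.split simp del: tm_step.simps) (metis fst_conv)+
  qed (use assms(1) in \<open>auto simp: tm_wf_def\<close>)
  have e: "(sim_step Q \<delta> ^^ i) (0, [], y) = (tm_step \<delta> ^^ i) (0, [], y)" for i y
    by (induction i) (auto simp: sim_step_eq[OF q] simp del: tm_step.simps)
  have t: "tape_len ((tm_step \<delta> ^^ i) (0, [], y)) \<le> length y + 2 * i" for i y
  proof (induction i)
    case (Suc i)
    then show ?case using tape_len_step[of \<delta> "(tm_step \<delta> ^^ i) (0, [], y)"] by simp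
  qed (simp add: tape_len_def)
  have s: "sz c \<le> 2 * Q + 2 + 6 * tape_len c" if "fst c < Q" for c :: config
    using that sz_sym_list[of "fst (snd c)"] sz_sym_list[of "snd (snd c)"]
    by (cases c) (auto simp: tape_len_def)
  have "pt (\<lambda>x. (sim_step Q \<delta> ^^ n x) (0, [], f x))"
  proof (rule pt_funpow[OF pt_sim_step assms(2)])
    show "pb (\<lambda>x. 2 * Q + 2 + 6 * (sz (f x) + 2 * sz (n x)))" by (intro pb_intros pb_sz assms)
    show "sz ((sim_step Q \<delta> ^^ i) (0, [], f x)) \<le> 2 * Q + 2 + 6 * (sz (f x) + 2 * sz (n x))" if "i < n x" for i x
    proof -
      have "tape_len ((tm_step \<delta> ^^ i) (0, [], f x)) \<le> sz (f x) + 2 * sz (n x)"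
        using t[of i "f x"] that length_le_sz[of "f x"] by simp
      then have "6 * tape_len ((tm_step \<delta> ^^ i) (0, [], f x)) \<le> 6 * (sz (f x) + 2 * sz (n x))"
        by (rule mult_le_mono2)
      then show ?thesis using s[OF q, of i "f x"] unfolding e by (meson add_left_mono le_trans)
    qed
  qed (intro pt_intros assms)
  then show ?thesis by (simp only: e)
qed

lemma tm_step_halted: "fst c = 1 \<Longrightarrow> (tm_step \<delta> ^^ i) c = c"
  by (induction i) (cases c; simp)+

theorem poly_time_computable_iff: "poly_time_computable \<mu> \<longleftrightarrow> pt \<mu>"
proof
  assume "poly_time_computable \<mu>"
  then obtain Q \<delta> c k where wf: "tm_wf Q \<delta>" and
    t: "\<And>x. \<exists>t. t \<le> c * (length x + 1) ^ k \<and> fst ((tm_step \<delta> ^^ t) (tm_init x)) = 1 \<and>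
              tm_output ((tm_step \<delta> ^^ t) (tm_init x)) = \<mu> x"
    unfolding poly_time_computable_def by blast
  let ?n = "\<lambda>x::bool list. c * (length x + 1) ^ k"
  have sy: "pt sym_of" by (rule pt_finite) simp
  have t1: "pt (\<lambda>s. s = S1)" and t2: "pt (\<lambda>s. s \<noteq> Bl)" by (rule pt_finite[OF finite_sym])+
  \<comment> \<open>Halting configurations are fixed points, so the unknown halting time may be
    replaced by the bound \<open>?n x\<close>, which is computable.\<close>
  have "\<mu> x = tm_output ((tm_step \<delta> ^^ ?n x) (tm_init x))" for x
  proof -
    obtain t where t: "t \<le> ?n x" "fst ((tm_step \<delta> ^^ t) (tm_init x)) = 1"
      "tm_output ((tm_step \<delta> ^^ t) (tm_init x)) = \<mu> x" using t by blast
    have "(tm_step \<delta> ^^ (t + (?n x - t))) (tm_init x) = (tm_step \<delta> ^^ t) (tm_init x)"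
      by (rule funpow_trans[OF refl tm_step_halted[OF t(2)]])
    then show ?thesis using t by simp
  qed
  moreover have "pt (\<lambda>x. (tm_step \<delta> ^^ ?n x) (0, [], map sym_of x))"
    by (rule pt_tm_run[OF wf]; intro pt_intros pt_comp[OF sy])
  then have "pt (\<lambda>x. tm_output ((tm_step \<delta> ^^ ?n x) (tm_init x)))"
    unfolding tm_output_def tm_init_def
    by (intro pt_intros pt_comp[OF t1] t2)
  ultimately show "pt \<mu>" by presburger
qed (rule poly_time_computableI)

section \<open>Binary numbers\<close>

declare bits.simps [simp del]

definition bval :: "bool list \<Rightarrow> nat" where
  "bval ds = foldl (\<lambda>a b. 2 * a + of_bool b) 0 ds"

lemma bval_Nil [simp]: "bval [] = 0"
  by (simp add: bval_def)

lemma bval_snoc [simp]: "bval (ds @ [b]) = 2 * bval ds + of_bool b"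
  by (simp add: bval_def)

lemma bval_append: "bval (xs @ ys) = bval xs * 2 ^ length ys + bval ys"
proof (induction ys rule: rev_induct)
  case (snoc y ys)
  then show ?case using bval_snoc[of "xs @ ys" y] by (simp add: algebra_simps)
qed simp

lemma bval_replicate [simp]: "bval (replicate k False) = 0"
  by (induction k) (simp_all add: replicate_append_same[symmetric])

lemma bits_0 [simp]: "bits 0 = []"
  by (simp add: bits.simps)

lemma bits_pos: "n \<noteq> 0 \<Longrightarrow> bits n = bits (n div 2) @ [odd n]"
  by (subst bits.simps) simp

lemma bval_bits [simp]: "bval (bits n) = n"
proof (induction n rule: less_induct)
  case (less n)
  show ?case
  proof (cases "n = 0")
    case False
    then show ?thesis using less[of "n div 2"] by (simp add: bits_pos)
  qed simp
qed

text \<open>No leading zeros; these digit lists are exactly the values of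
  \<open>bits\<close>.\<close>

definition canon :: "bool list \<Rightarrow> bool" where
  "canon ds \<longleftrightarrow> ds = [] \<or> hd ds"

lemma bits_neq_Nil: "n \<noteq> 0 \<Longrightarrow> bits n \<noteq> []"
  by (simp add: bits_pos)

lemma canon_bits: "canon (bits n)"
proof (induction n rule: less_induct)
  case (less n)
  show ?case
  proof (cases "n = 0")
    case False
    then show ?thesis using less[of "n div 2"]
      by (cases "n div 2 = 0") (auto simp: bits_pos[of n] canon_def hd_append bits_neq_Nil odd_iff_mod_2_eq_one)
  qed (simp add: canon_def)
qed

lemma bval_ge: "canon ds \<Longrightarrow> ds \<noteq> [] \<Longrightarrow> 2 ^ (length ds - 1) \<le> bval ds"
proof (induction ds rule: rev_induct)
  case (snoc d ds)
  show ?case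
  proof (cases ds)
    case Nil
    then show ?thesis using snoc.prems bval_snoc[of "[]" d] by (simp add: canon_def)
  next
    case (Cons a as)
    then have "2 ^ (length ds - 1) \<le> bval ds" using snoc by (simp add: canon_def)
    moreover have "(2::nat) ^ length ds = 2 * 2 ^ (length ds - 1)" using Cons by simp
    ultimately show ?thesis using bval_snoc[of ds d] by simp
  qed
qed simp

lemma bval_pos: "canon ds \<Longrightarrow> ds \<noteq> [] \<Longrightarrow> bval ds \<noteq> 0"
  using bval_ge[of ds] by (metis le_zero_eq power_not_zero zero_neq_numeral)

lemma bits_bval: "canon ds \<Longrightarrow> bits (bval ds) = ds"
proof (induction ds rule: rev_induct)
  case (snoc d ds)
  show ?case
  proof (cases ds)
    case Nil
    then show ?thesis using snoc.prems bval_snoc[of "[]" d] by (simp add: canon_def bits_pos)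
  next
    case (Cons a as)
    then have "canon ds" using snoc.prems by (simp add: canon_def)
    moreover from this have "bval ds \<noteq> 0" using bval_pos[of ds] Cons by blast
    ultimately show ?thesis using snoc.IH by (simp add: bits_pos[of "2 * bval ds + of_bool d"])
  qed
qed simp

lemma bval_less: "bval ds < 2 ^ length ds"
  by (induction ds rule: rev_induct) auto

lemma length_bits_le: "v < 2 ^ L \<Longrightarrow> length (bits v) \<le> L"
proof (rule ccontr)
  assume v: "v < 2 ^ L" and "\<not> length (bits v) \<le> L"
  then have "L \<le> length (bits v) - 1" "bits v \<noteq> []" by auto
  then have "2 ^ L \<le> (2::nat) ^ (length (bits v) - 1)" "2 ^ (length (bits v) - 1) \<le> v"
    using bval_ge[OF canon_bits, of v] by auto
  then show False using v by linarith
qed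

definition pad :: "nat \<Rightarrow> bool list \<Rightarrow> bool list" where
  "pad L ds = replicate (L - length ds) False @ ds"

lemma bval_pad [simp]: "bval (pad L ds) = bval ds"
  by (simp add: pad_def bval_append)

lemma length_pad: "length ds \<le> L \<Longrightarrow> length (pad L ds) = L"
  by (simp add: pad_def)

text \<open>This turns the renaming of a variable into concatenation of digits. With
  \<open>a \<noteq> 0\<close> the padded part is preceded by a nonzero digit, so the result is
  canonical.\<close>

lemma bits_shift:
  assumes "a \<noteq> 0" "v < 2 ^ L"
  shows "bits (a * 2 ^ L + v) = bits a @ pad L (bits v)"
proof -
  have "canon (bits a @ pad L (bits v))"
    using canon_bits[of a] bits_neq_Nil[OF assms(1)] by (simp add: canon_def)
  moreover have "bval (bits a @ pad L (bits v)) = a * 2 ^ L + v"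
    using length_bits_le[OF assms(2)] by (simp add: bval_append length_pad)
  ultimately show ?thesis using bits_bval by metis
qed

text \<open>A full subtractor; the state holds the difference digits so far and the borrow.\<close>

definition sub1 :: "bool list \<times> bool \<Rightarrow> bool \<times> bool \<Rightarrow> bool list \<times> bool" where
  "sub1 s p = ((fst p \<noteq> (snd p \<noteq> snd s)) # fst s, (\<not> fst p \<and> snd p) \<or> ((\<not> fst p \<or> snd p) \<and> snd s))"

text \<open>Subtraction with borrow of numbers of equal length, most significant digit first;
  the final borrow tells whether the first number is smaller.\<close>
definition subb :: "bool list \<Rightarrow> bool list \<Rightarrow> bool list \<times> bool" where
  "subb xs ys = foldl sub1 ([], False) (zip (rev xs) (rev ys))"

text \<open>The invariant: minuend plus outgoing borrow at its weight equals difference plus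
  subtrahend plus incoming borrow.\<close>

lemma foldl_sub1:
  assumes "length xs = length ys"
  shows "\<exists>zs br'. foldl sub1 (acc, br) (zip xs ys) = (zs @ acc, br') \<and> length zs = length xs \<and>
    bval (rev xs) + 2 ^ length xs * of_bool br' = bval zs + bval (rev ys) + of_bool br"
  using assms
proof (induction xs ys arbitrary: acc br rule: list_induct2)
  case (Cons x xs y ys)
  obtain d br1 where s: "sub1 (acc, br) (x, y) = (d # acc, br1)"
    and d: "of_bool x + 2 * of_bool br1 = of_bool d + of_bool y + (of_bool br :: nat)"
    by (cases x; cases y; cases br) (auto simp: sub1_def)
  obtain zs br' where z: "foldl sub1 (d # acc, br1) (zip xs ys) = (zs @ d # acc, br')" "length zs = length xs"
    "bval (rev xs) + 2 ^ length xs * of_bool br' = bval zs + bval (rev ys) + of_bool br1"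
    using Cons.IH by blast
  have "bval (rev (x # xs)) + 2 ^ length (x # xs) * of_bool br'
      = 2 * (bval (rev xs) + 2 ^ length xs * of_bool br') + of_bool x" by simp
  also have "\<dots> = bval (zs @ [d]) + bval (rev (y # ys)) + of_bool br"
    unfolding z(3) using d by simp
  finally show ?case using z s by (intro exI[of _ "zs @ [d]"] exI[of _ br']) simp
qed simp

lemma subb:
  assumes "length xs = length ys"
  shows "length (fst (subb xs ys)) = length xs"
    and "snd (subb xs ys) \<longleftrightarrow> bval xs < bval ys"
    and "\<not> snd (subb xs ys) \<Longrightarrow> bval (fst (subb xs ys)) = bval xs - bval ys"
proof -
  obtain zs br' where z: "subb xs ys = (zs, br')" "length zs = length xs"
    "bval xs + 2 ^ length xs * of_bool br' = bval zs + bval ys"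
    using foldl_sub1[of "rev xs" "rev ys" "[]" False] assms unfolding subb_def by auto
  show "length (fst (subb xs ys)) = length xs" using z by simp
  show "snd (subb xs ys) \<longleftrightarrow> bval xs < bval ys"
    using z bval_less[of zs] by (cases br') auto
  show "\<not> snd (subb xs ys) \<Longrightarrow> bval (fst (subb xs ys)) = bval xs - bval ys"
    using z by auto
qed

text \<open>The number of the block to which variable \<open>v\<close> of the concatenation
  belongs.\<close>

fun blk :: "nat list \<Rightarrow> nat \<Rightarrow> nat option" where
  "blk [] v = None"
| "blk (m # ms) v = (if v < m then Some 0 else map_option Suc (blk ms (v - m)))"

lemma blk_eq_None_iff: "blk ms v = None \<longleftrightarrow> sum_list ms \<le> v"
proof (induction ms arbitrary: v)
  case (Cons m ms)
  show ?case using Cons[of "v - m"] by (cases "v < m") auto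
qed simp

lemma blk_less: "blk ms v = Some i \<Longrightarrow> i < length ms"
proof (induction ms arbitrary: v i)
  case (Cons m ms)
  then show ?case by (cases "v < m") (auto simp: less_Suc_eq_0_disj)
qed simp

text \<open>\<open>blk\<close> on digit lists: the state holds what is left of the variable number,
  the blocks passed, and whether the block is found. \<open>subb\<close> preserves the length, so
  the next subtraction again has operands of equal length.\<close>

definition find1 :: "bool list \<times> nat \<times> bool \<Rightarrow> bool list \<Rightarrow> bool list \<times> nat \<times> bool" where
  "find1 s d = (if snd (snd s) then s
     else if snd (subb (fst s) d) then (fst s, fst (snd s), True)
     else (fst (subb (fst s) d), Suc (fst (snd s)), False))"

lemma foldl_find1:
  assumes "\<forall>d\<in>set Ds. length d = length v"
  shows "snd (foldl find1 (v, i, False) Ds) =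
    (case blk (map bval Ds) (bval v) of None \<Rightarrow> (i + length Ds, False) | Some k \<Rightarrow> (i + k, True))"
  using assms
proof (induction Ds arbitrary: v i)
  case (Cons d Ds)
  have T: "foldl find1 (u, j, True) Es = (u, j, True)" for u j Es
    by (induction Es) (auto simp: find1_def)
  show ?case
  proof (cases "bval v < bval d")
    case True
    then have "find1 (v, i, False) d = (v, i, True)" using Cons.prems by (simp add: find1_def subb(2))
    then show ?thesis using T True by simp
  next
    case False
    then have "find1 (v, i, False) d = (fst (subb v d), Suc i, False)"
      using Cons.prems by (simp add: find1_def subb(2))
    then show ?thesis using False Cons.prems Cons.IH[of "fst (subb v d)" "Suc i"]
      by (simp add: subb split: option.split)
  qed
qed simp

section \<open>Encoding and parsing of instances\<close>

text \<open>The symbol 4 marks an odd number of bits; it occurs in no encoding.\<close>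
fun syms :: "bool list \<Rightarrow> nat list" where
  "syms (a # b # w) = (2 * of_bool a + of_bool b) # syms w"
| "syms [a] = [4]"
| "syms [] = []"

text \<open>The constant default beyond 4 makes this a finite table, hence computable by
  \<open>pt_nat_table\<close>.\<close>

definition symb :: "nat \<Rightarrow> bool list" where
  "symb s = (if s < 4 then sym_bits s else [])"

definition tobits :: "nat list \<Rightarrow> bool list" where
  "tobits ss = concat (map symb ss)"

lemma tobits_eq: "\<forall>s\<in>set ss. s < 4 \<Longrightarrow> tobits ss = concat (map sym_bits ss)"
  unfolding tobits_def by (induction ss) (auto simp: symb_def)

lemma syms_sym_bits: "s < 4 \<Longrightarrow> syms (sym_bits s @ w) = s # syms w"
proof -
  assume "s < 4"
  then have "s = 0 \<or> s = 1 \<or> s = 2 \<or> s = 3" by linarith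
  then show ?thesis by (auto simp: sym_bits_def)
qed

lemma syms_concat: "\<forall>s\<in>set ss. s < 4 \<Longrightarrow> syms (concat (map sym_bits ss)) = ss"
  by (induction ss) (auto simp: syms_sym_bits)

lemma sym_bits_syms: "4 \<notin> set (syms w) \<Longrightarrow> concat (map sym_bits (syms w)) = w"
  by (induction w rule: syms.induct) (auto simp: sym_bits_def)

definition b2n :: "bool \<Rightarrow> nat" where
  "b2n b = (if b then 1 else 0)"

lemma numenc_eq: "numenc n = map b2n (bits n) @ [2]"
  by (simp add: numenc_def b2n_def[abs_def])

lemma numenc_less: "s \<in> set (numenc n) \<Longrightarrow> s < 4"
  by (auto simp: numenc_eq b2n_def)

lemma fenc_less: "s \<in> set (fenc f) \<Longrightarrow> s < 4"
  by (induction f) (auto dest: numenc_less)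

lemma fenc_neq_Nil [simp]: "fenc f \<noteq> []"
  by (cases f) auto

definition isyms :: "nat list \<times> form \<Rightarrow> nat list" where
  "isyms e = numenc (length (fst e)) @ concat (map numenc (fst e)) @ fenc (snd e)"

lemma isyms_less: "\<forall>s\<in>set (isyms e). s < 4"
  by (auto simp: isyms_def dest: numenc_less fenc_less)

lemma inst_enc_eq: "inst_enc e = tobits (isyms e)"
  using tobits_eq[OF isyms_less[of e]] by (simp add: inst_enc_def isyms_def)

lemma syms_inst_enc: "syms (inst_enc e) = isyms e"
  using syms_concat[OF isyms_less[of e]] by (simp add: inst_enc_def isyms_def)

lemma inj_b2n: "map b2n xs = map b2n ys \<longleftrightarrow> xs = ys"
  by (intro inj_map_eq_map injI) (auto simp: b2n_def split: if_splits)

lemma digits_takeWhile: "takeWhile (\<lambda>a. a \<noteq> 2) (map b2n ds @ 2 # r) = map b2n ds"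
  "dropWhile (\<lambda>a. a \<noteq> 2) (map b2n ds @ 2 # r) = 2 # r"
  by (induction ds) (auto simp: b2n_def)

lemma numenc_append_inj: "numenc m @ x = numenc n @ y \<Longrightarrow> m = n \<and> x = y"
proof -
  assume a: "numenc m @ x = numenc n @ y"
  then have "takeWhile (\<lambda>a. a \<noteq> 2) (map b2n (bits m) @ 2 # x) = takeWhile (\<lambda>a. a \<noteq> 2) (map b2n (bits n) @ 2 # y)"
    by (simp add: numenc_eq)
  then have "bits m = bits n" by (simp add: digits_takeWhile inj_b2n)
  then have "m = n" using bval_bits by metis
  then show ?thesis using a by simp
qed

text \<open>Prefix notation is a prefix-free code; the arbitrary tails \<open>x\<close> and
  \<open>y\<close> let the induction pass through the two arguments of a connective.\<close>

lemma fenc_append_inj: "fenc f @ x = fenc g @ y \<Longrightarrow> f = g \<and> x = y"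
proof (induction f arbitrary: g x y)
  case (FVar v)
  then show ?case by (cases g) (auto dest: numenc_append_inj)
next
  case (FNeg f)
  from FNeg.prems show ?case by (cases g) (auto dest: FNeg.IH)
next
  case (FAnd f1 f2)
  show ?case
  proof (cases g)
    case (FAnd g1 g2)
    then have "fenc f1 @ (fenc f2 @ x) = fenc g1 @ (fenc g2 @ y)" using FAnd.prems by simp
    from FAnd.IH(1)[OF this] FAnd.IH(2) FAnd show ?thesis by blast
  qed (use FAnd.prems in auto)
next
  case (FOr f1 f2)
  show ?case
  proof (cases g)
    case (FOr g1 g2)
    then have "fenc f1 @ (fenc f2 @ x) = fenc g1 @ (fenc g2 @ y)" using FOr.prems by simp
    from FOr.IH(1)[OF this] FOr.IH(2) FOr show ?thesis by blast
  qed (use FOr.prems in auto)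
qed

lemma numencs_append_inj:
  "length ms = length ns \<Longrightarrow> concat (map numenc ms) @ x = concat (map numenc ns) @ y \<Longrightarrow> ms = ns \<and> x = y"
proof (induction ms ns rule: list_induct2)
  case (Cons m ms n ns)
  then have "numenc m @ (concat (map numenc ms) @ x) = numenc n @ (concat (map numenc ns) @ y)" by simp
  from numenc_append_inj[OF this] Cons.IH show ?case by simp
qed simp

lemma inst_enc_inject: "inst_enc d = inst_enc e \<Longrightarrow> d = e"
proof -
  assume "inst_enc d = inst_enc e"
  then have i: "isyms d = isyms e" by (metis syms_inst_enc)
  then have 1: "length (fst d) = length (fst e)"
    "concat (map numenc (fst d)) @ fenc (snd d) = concat (map numenc (fst e)) @ fenc (snd e)"
    unfolding isyms_def by (auto dest: numenc_append_inj)
  then have "fst d = fst e" "fenc (snd d) @ [] = fenc (snd e) @ []"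
    using numencs_append_inj[OF 1] by auto
  then show ?thesis using fenc_append_inj by (metis prod.expand)
qed

lemma decode_inst_enc [simp]: "decode (inst_enc e) = Some e"
proof -
  have "(THE d. inst_enc d = inst_enc e) = e" by (rule the_equality) (auto dest: inst_enc_inject)
  moreover have "\<exists>d. inst_enc d = inst_enc e" by blast
  ultimately show ?thesis unfolding decode_def by simp
qed

lemma decode_SomeD: "decode w = Some e \<Longrightarrow> inst_enc e = w"
proof -
  assume d: "decode w = Some e"
  then obtain e' where e': "inst_enc e' = w" by (auto simp: decode_def split: if_splits)
  then show ?thesis using d decode_inst_enc[of e'] by simp
qed

lemma level_inst_inst_enc:
  "length ms = n \<Longrightarrow> \<forall>m\<in>set ms. 1 \<le> m \<Longrightarrow> fvars_below (sum_list ms) f \<Longrightarrow>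
    level_inst n (inst_enc (ms, f)) = Some (ms, f)"
  by (simp add: level_inst_def)

lemma level_inst_SomeD:
  assumes "level_inst n w = Some (ms, f)"
  shows "w = inst_enc (ms, f)" "length ms = n" "\<forall>m\<in>set ms. 1 \<le> m" "fvars_below (sum_list ms) f"
  using assms by (auto simp: level_inst_def dest: decode_SomeD split: option.splits prod.splits if_splits)

fun rdn :: "nat \<Rightarrow> nat list \<Rightarrow> nat list list \<times> nat list" where
  "rdn 0 s = ([], s)"
| "rdn (Suc k) s = (takeWhile (\<lambda>a. a \<noteq> 2) s # fst (rdn k (tl (dropWhile (\<lambda>a. a \<noteq> 2) s))),
     snd (rdn k (tl (dropWhile (\<lambda>a. a \<noteq> 2) s))))"

lemma rdn_numencs: "rdn (length ns) (concat (map numenc ns) @ r) = (map (\<lambda>n. map b2n (bits n)) ns, r)"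
  by (induction ns) (auto simp: numenc_eq digits_takeWhile)

text \<open>When a terminator is missing, \<open>rdn\<close> runs out of input and leaves
  \<open>[]\<close>. Hence a nonempty rest certifies that all \<open>k\<close> terminators were
  present.\<close>

lemma rdn_sound:
  "snd (rdn k s) \<noteq> [] \<Longrightarrow> s = concat (map (\<lambda>d. d @ [2]) (fst (rdn k s))) @ snd (rdn k s)"
proof (induction k arbitrary: s)
  case (Suc k)
  define t where "t = dropWhile (\<lambda>a. a \<noteq> 2) s"
  have nil: "rdn k [] = (replicate k [], [])" for k by (induction k) auto
  have eq: "rdn (Suc k) s = (takeWhile (\<lambda>a. a \<noteq> 2) s # fst (rdn k (tl t)), snd (rdn k (tl t)))"
    by (simp only: rdn.simps t_def)
  have "t \<noteq> []"
  proof
    assume "t = []"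
    then show False using Suc.prems unfolding eq by (simp add: nil)
  qed
  then have "hd t = 2" using hd_dropWhile[of "\<lambda>a. a \<noteq> 2" s] unfolding t_def by blast
  then have "t = 2 # tl t" using \<open>t \<noteq> []\<close> by (cases t) auto
  moreover have "s = takeWhile (\<lambda>a. a \<noteq> 2) s @ t" by (simp add: t_def)
  ultimately have "s = takeWhile (\<lambda>a. a \<noteq> 2) s @ 2 # tl t" by metis
  also have "tl t = concat (map (\<lambda>d. d @ [2]) (fst (rdn k (tl t)))) @ snd (rdn k (tl t))"
    by (rule Suc.IH) (use Suc.prems eq in simp)
  finally show ?case unfolding eq by simp
qed simp

lemma length_rdn: "length (fst (rdn k s)) = k"
  by (induction k arbitrary: s) auto

text \<open>The leading 1 excludes both leading zeros and the dimension 0.\<close>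

definition digits_ok :: "nat list \<Rightarrow> bool" where
  "digits_ok d \<longleftrightarrow> d \<noteq> [] \<and> hd d = 1 \<and> list_all (\<lambda>a. a < 2) d"

definition n2b :: "nat list \<Rightarrow> bool list" where
  "n2b d = map (\<lambda>a. a = 1) d"

lemma n2b_map_b2n [simp]: "n2b (map b2n ds) = ds"
  by (induction ds) (auto simp: n2b_def b2n_def)

lemma digits_okD:
  assumes "digits_ok d"
  shows "d = map b2n (bits (bval (n2b d)))" "1 \<le> bval (n2b d)"
proof -
  have "canon (n2b d)" "n2b d \<noteq> []" using assms by (auto simp: canon_def n2b_def digits_ok_def hd_map)
  then have "bits (bval (n2b d)) = n2b d" "bval (n2b d) \<noteq> 0" using bits_bval bval_pos by blast+
  moreover have "map b2n (n2b d) = d"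
    using assms by (auto simp: digits_ok_def n2b_def b2n_def list_all_iff intro!: map_idI)
  ultimately show "d = map b2n (bits (bval (n2b d)))" "1 \<le> bval (n2b d)" by simp_all
qed

lemma digits_ok_bits: "1 \<le> m \<Longrightarrow> digits_ok (map b2n (bits m))"
  using canon_bits[of m] bits_neq_Nil[of m]
  by (auto simp: digits_ok_def hd_map canon_def list_all_iff b2n_def)

section \<open>Renaming the variables of a formula\<close>

text \<open>Every block gets dimension \<open>2 ^ (L + 1)\<close>, and variable \<open>v\<close> of block \<open>i\<close> moves to offset
  \<open>2 ^ L + v\<close> in the new block \<open>i\<close>: its digits are those of \<open>2 * i + 1\<close> followed by the padded
  digits of \<open>v\<close>, and offset 0 stays free for a selector.\<close>
fun ren :: "nat list \<Rightarrow> nat \<Rightarrow> form \<Rightarrow> form" where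
  "ren ms L (FVar v) = FVar ((2 * the (blk ms v) + 1) * 2 ^ L + v)"
| "ren ms L (FNeg f) = FNeg (ren ms L f)"
| "ren ms L (FAnd f g) = FAnd (ren ms L f) (ren ms L g)"
| "ren ms L (FOr f g) = FOr (ren ms L f) (ren ms L g)"

text \<open>States of the scanner: (inside a number, number of formulas still expected, digits read,
  output, no error so far).\<close>
type_synonym scan = "bool \<times> nat \<times> bool list \<times> nat list \<times> bool"

abbreviation "in_num (s :: scan) \<equiv> fst s"
abbreviation "need (s :: scan) \<equiv> fst (snd s)"
abbreviation "buf (s :: scan) \<equiv> fst (snd (snd s))"
abbreviation "outp (s :: scan) \<equiv> fst (snd (snd (snd s)))"
abbreviation "ok (s :: scan) \<equiv> snd (snd (snd (snd s)))"

definition fail :: "scan \<Rightarrow> scan" where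
  "fail s = (in_num s, need s, buf s, outp s, False)"

definition prefix_digits :: "nat \<Rightarrow> nat \<Rightarrow> nat list" where
  "prefix_digits n i = (if i < n then map b2n (bits (2 * i + 1)) else [])"

text \<open>Padding to \<open>L\<close> digits serves twice: the block search subtracts numbers of
  equal length, and the same digits form the tail of the new variable number.\<close>

definition close_var :: "nat \<Rightarrow> bool list list \<Rightarrow> nat \<Rightarrow> scan \<Rightarrow> scan" where
  "close_var n Ds L s = (let r = snd (foldl find1 (pad L (buf s), 0, False) Ds)
     in if (buf s = [] \<or> hd (buf s)) \<and> snd r
        then (False, need s, [], outp s @ prefix_digits n (fst r) @ map b2n (pad L (buf s)) @ [2], True)
        else fail s)"

text \<open>The guard \<open>length (buf s) < L\<close> keeps buffers short enough for padding to
  yield exactly \<open>L\<close> digits.\<close>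

definition scan1 :: "nat \<Rightarrow> bool list list \<Rightarrow> nat \<Rightarrow> scan \<Rightarrow> nat \<Rightarrow> scan" where
  "scan1 n Ds L s a = (if \<not> ok s then s
     else if in_num s then
       (if a = 2 then close_var n Ds L s
        else if a < 2 \<and> length (buf s) < L then (True, need s, buf s @ [a = 1], outp s, True)
        else fail s)
     else if need s = 0 then fail s
     else if a = 0 then (True, need s - 1, [], outp s @ [0], True)
     else if a = 1 then (False, need s, [], outp s @ [1], True)
     else if a = 2 then (False, Suc (need s), [], outp s @ [2], True)
     else if a = 3 then (False, Suc (need s), [], outp s @ [3], True)
     else fail s)"

lemma scan1_form [simp]:
  "scan1 n Ds L (False, Suc k, b, out, True) 0 = (True, k, [], out @ [0], True)"
  "scan1 n Ds L (False, Suc k, b, out, True) (Suc 0) = (False, Suc k, [], out @ [1], True)"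
  "scan1 n Ds L (False, Suc k, b, out, True) 2 = (False, Suc (Suc k), [], out @ [2], True)"
  "scan1 n Ds L (False, Suc k, b, out, True) 3 = (False, Suc (Suc k), [], out @ [3], True)"
  by (simp_all add: scan1_def)

definition scan :: "nat \<Rightarrow> bool list list \<Rightarrow> nat \<Rightarrow> nat list \<Rightarrow> scan" where
  "scan n Ds L r = foldl (scan1 n Ds L) (False, 1, [], [], True) r"

locale scanner =
  fixes n L :: nat and Ds :: "bool list list" and ms :: "nat list"
  assumes ms: "ms = map bval Ds" and lenD: "\<forall>d\<in>set Ds. length d = L" and lenms: "length ms = n"
begin

abbreviation run :: "scan \<Rightarrow> nat list \<Rightarrow> scan" where
  "run \<equiv> foldl (scan1 n Ds L)"

lemma run_fail: "\<not> ok s \<Longrightarrow> run s r = s"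
  by (induction r) (auto simp: scan1_def)

lemma close_var_eq:
  assumes "length b \<le> L"
  shows "close_var n Ds L (md, k, b, out, c) = (if canon b \<and> bval b < sum_list ms
     then (False, k, [], out @ map b2n (bits (2 * the (blk ms (bval b)) + 1) @ pad L b) @ [2], True)
     else (md, k, b, out, False))"
proof -
  have f: "snd (foldl find1 (pad L b, 0, False) Ds) =
    (case blk ms (bval b) of None \<Rightarrow> (length Ds, False) | Some k \<Rightarrow> (k, True))"
    using foldl_find1[of Ds "pad L b" 0] lenD by (simp add: length_pad[OF assms] ms split: option.split)
  show ?thesis
  proof (cases "blk ms (bval b)")
    case None
    then show ?thesis using blk_eq_None_iff[of ms "bval b"]
      by (simp add: close_var_def f fail_def)
  next
    case (Some i)
    then have "bval b < sum_list ms" using blk_eq_None_iff[of ms "bval b"] by auto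
    then show ?thesis using Some blk_less[OF Some] lenms
      by (auto simp: close_var_def f fail_def canon_def prefix_digits_def)
  qed
qed

lemma run_digits:
  "length b + length ds \<le> L \<Longrightarrow>
    run (True, k, b, out, True) (map b2n ds) = (True, k, b @ ds, out, True)"
  by (induction ds arbitrary: b) (auto simp: scan1_def b2n_def)

lemma run_numenc:
  assumes "v < sum_list ms" "sum_list ms \<le> 2 ^ L"
  shows "run (True, k, [], out, True) (numenc v) =
    (False, k, [], out @ numenc ((2 * the (blk ms v) + 1) * 2 ^ L + v), True)"
proof -
  have l: "length (bits v) \<le> L" using length_bits_le[of v L] assms by simp
  have "run (True, k, [], out, True) (numenc v) = scan1 n Ds L (True, k, bits v, out, True) 2"
    using run_digits[of "[]" "bits v"] l by (simp add: numenc_eq)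
  also have "\<dots> = close_var n Ds L (True, k, bits v, out, True)" by (simp add: scan1_def)
  also have "\<dots> = (False, k, [], out @ numenc ((2 * the (blk ms v) + 1) * 2 ^ L + v), True)"
    unfolding close_var_eq[OF l] numenc_eq
    using assms canon_bits[of v] bits_shift[of "2 * the (blk ms v) + 1" v L] by simp
  finally show ?thesis .
qed

text \<open>Reading one complete formula lowers the counter by one. It is stated for every counter,
  buffer and output so that it applies to subformulas.\<close>

lemma run_fenc:
  assumes "sum_list ms \<le> 2 ^ L"
  shows "fvars_below (sum_list ms) f \<Longrightarrow>
    \<exists>b'. run (False, Suc k, b, out, True) (fenc f) = (False, k, b', out @ fenc (ren ms L f), True)"
proof (induction f arbitrary: k b out)
  case (FVar v)
  then show ?case using run_numenc[OF _ assms, of v] by simp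
next
  case (FNeg f)
  then obtain b' where "run (False, Suc k, [], out @ [1], True) (fenc f) = (False, k, b', (out @ [1]) @ fenc (ren ms L f), True)"
    using FNeg.IH[of k "[]" "out @ [1]"] FNeg.prems by auto
  then show ?case by simp
next
  case (FAnd f g)
  obtain b1 where 1: "run (False, Suc (Suc k), [], out @ [2], True) (fenc f) = (False, Suc k, b1, (out @ [2]) @ fenc (ren ms L f), True)"
    using FAnd.IH(1)[of "Suc k" "[]" "out @ [2]"] FAnd.prems by auto
  obtain b2 where 2: "run (False, Suc k, b1, (out @ [2]) @ fenc (ren ms L f), True) (fenc g)
     = (False, k, b2, ((out @ [2]) @ fenc (ren ms L f)) @ fenc (ren ms L g), True)"
    using FAnd.IH(2)[of k b1 "(out @ [2]) @ fenc (ren ms L f)"] FAnd.prems by auto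
  show ?case using 1 2 by simp
next
  case (FOr f g)
  obtain b1 where 1: "run (False, Suc (Suc k), [], out @ [3], True) (fenc f) = (False, Suc k, b1, (out @ [3]) @ fenc (ren ms L f), True)"
    using FOr.IH(1)[of "Suc k" "[]" "out @ [3]"] FOr.prems by auto
  obtain b2 where 2: "run (False, Suc k, b1, (out @ [3]) @ fenc (ren ms L f), True) (fenc g)
     = (False, k, b2, ((out @ [3]) @ fenc (ren ms L f)) @ fenc (ren ms L g), True)"
    using FOr.IH(2)[of k b1 "(out @ [3]) @ fenc (ren ms L f)"] FOr.prems by auto
  show ?case using 1 2 by simp
qed

lemma run_num_sound:
  assumes "run (True, k, b, out, True) s = s'" "ok s'" "\<not> in_num s'" "length b \<le> L"
  shows "\<exists>ds r out'. s = map b2n ds @ 2 # r \<and> canon (b @ ds) \<and> bval (b @ ds) < sum_list ms \<and>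
    run (False, k, [], out', True) r = s'"
  using assms
proof (induction s arbitrary: b)
  case (Cons a s)
  let ?t = "scan1 n Ds L (True, k, b, out, True) a"
  have r: "run ?t s = s'" using Cons.prems by simp
  have okt: "ok ?t" using r Cons.prems(2) run_fail[of ?t s] by metis
  show ?case
  proof (cases "a = 2")
    case True
    then have t: "?t = close_var n Ds L (True, k, b, out, True)" by (simp add: scan1_def)
    then have c: "canon b" "bval b < sum_list ms" using okt unfolding close_var_eq[OF Cons.prems(4)]
      by (auto split: if_splits)
    then obtain out' where "?t = (False, k, [], out', True)"
      unfolding t close_var_eq[OF Cons.prems(4)] by simp
    then show ?thesis using c r True by (intro exI[of _ "[]"] exI[of _ s] exI[of _ out']) simp
  next
    case False
    then have a: "a < 2" "length b < L" using okt by (auto simp: scan1_def fail_def split: if_splits)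
    then have "?t = (True, k, b @ [a = 1], out, True)" by (simp add: scan1_def)
    then obtain ds r out' where "s = map b2n ds @ 2 # r" "canon (b @ [a = 1] @ ds)"
      "bval (b @ [a = 1] @ ds) < sum_list ms" "run (False, k, [], out', True) r = s'"
      using Cons.IH[of "b @ [a = 1]"] r Cons.prems a by auto
    moreover have "a = b2n (a = 1)" using a by (auto simp: b2n_def)
    ultimately show ?thesis
      by (intro exI[of _ "(a = 1) # ds"] exI[of _ r] exI[of _ out']) simp
  qed
qed auto

text \<open>Counter \<open>k\<close> demands exactly \<open>k\<close> further formulas. The
  induction is on the length of the rest, because a negation keeps the counter and a binary
  connective raises it.\<close>

lemma run_sound:
  assumes "run (False, k, b, out, True) s = s'" "ok s'" "\<not> in_num s'" "need s' = 0"
  shows "\<exists>fs. length fs = k \<and> s = concat (map fenc fs) \<and> (\<forall>f\<in>set fs. fvars_below (sum_list ms) f)"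
  using assms
proof (induction "length s" arbitrary: s k b out rule: less_induct)
  case less
  show ?case
  proof (cases s)
    case Nil
    then show ?thesis using less.prems by auto
  next
    case (Cons a r)
    let ?t = "scan1 n Ds L (False, k, b, out, True) a"
    have rt: "run ?t r = s'" using less.prems Cons by simp
    have okt: "ok ?t" using rt less.prems(2) run_fail[of ?t r] by metis
    then obtain k' where k: "k = Suc k'" by (cases k) (auto simp: scan1_def fail_def)
    have "a = 0 \<or> a = 1 \<or> a = 2 \<or> a = 3" using okt k by (auto simp: scan1_def fail_def split: if_splits)
    then consider "a = 0" | "a = 1" | "a = 2 \<or> a = 3" by blast
    then show ?thesis
    proof cases
      case 1
      then have "?t = (True, k', [], out @ [0], True)" using k by (simp add: scan1_def)
      then obtain ds q out' where q: "r = map b2n ds @ 2 # q" "canon ds" "bval ds < sum_list ms"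
        "run (False, k', [], out', True) q = s'"
        using run_num_sound[of k' "[]" "out @ [0]" r s'] rt less.prems by auto
      obtain fs where fs: "length fs = k'" "q = concat (map fenc fs)" "\<forall>f\<in>set fs. fvars_below (sum_list ms) f"
        using less.hyps[OF _ q(4)] less.prems q(1) Cons by auto
      have "s = fenc (FVar (bval ds)) @ q" using Cons 1 q by (simp add: numenc_eq bits_bval)
      then show ?thesis using fs q k by (intro exI[of _ "FVar (bval ds) # fs"]) simp
    next
      case 2
      then have "?t = (False, k, [], out @ [1], True)" using k by (simp add: scan1_def)
      then obtain fs where fs: "length fs = k" "r = concat (map fenc fs)" "\<forall>f\<in>set fs. fvars_below (sum_list ms) f"
        using less.hyps[of r k "[]" "out @ [1]"] less.prems rt Cons by auto
      then obtain f fs' where "fs = f # fs'" using k by (cases fs) auto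
      then show ?thesis using fs Cons 2 by (intro exI[of _ "FNeg f # fs'"]) simp
    next
      case 3
      then have "?t = (False, Suc k, [], out @ [a], True)" using k by (auto simp: scan1_def)
      then obtain fs where fs: "length fs = Suc k" "r = concat (map fenc fs)" "\<forall>f\<in>set fs. fvars_below (sum_list ms) f"
        using less.hyps[of r "Suc k" "[]" "out @ [a]"] less.prems rt Cons by auto
      then obtain f g fs' where "fs = f # g # fs'" using k by (cases fs; cases "tl fs") auto
      then show ?thesis using fs Cons 3
        by (intro exI[of _ "(if a = 2 then FAnd f g else FOr f g) # fs'"]) auto
    qed
  qed
qed

end

text \<open>Formulas have no constants; variable 0 exists because there is at least one block and
  its dimension is positive.\<close>

definition falsum :: form where
  "falsum = FAnd (FVar 0) (FNeg (FVar 0))"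

text \<open>The \<open>Suc n\<close> numbers in front are the block count, compared with
  \<open>n\<close>, and the dimensions. Every failed check ends in \<open>falsum\<close>, the
  meaning of an invalid string.\<close>

definition transl :: "nat \<Rightarrow> nat \<Rightarrow> bool list \<Rightarrow> nat list" where
  "transl n L w = (let p = rdn (Suc n) (syms w);
       s = scan n (map (\<lambda>d. pad L (n2b d)) (tl (fst p))) L (snd p)
     in if hd (fst p) = map b2n (bits n) \<and> list_all digits_ok (tl (fst p))
           \<and> ok s \<and> \<not> in_num s \<and> need s = 0
        then outp s else fenc falsum)"

text \<open>Each dimension is below two to the number of its digits, and its terminator symbol pays
  for the doubling caused by the addition.\<close>

lemma sum_list_le_power: "sum_list ms \<le> 2 ^ length (concat (map numenc ms))"
proof (induction ms)
  case (Cons m ms)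
  let ?k = "length (concat (map numenc ms))"
  have "m \<le> 2 ^ length (bits m)" using bval_less[of "bits m"] by simp
  then have "m + sum_list ms \<le> 2 ^ length (bits m) + 2 ^ ?k" using Cons.IH by linarith
  also have "\<dots> \<le> 2 ^ (length (bits m) + ?k) + 2 ^ (length (bits m) + ?k)"
    by (intro add_mono power_increasing) auto
  also have "\<dots> = 2 ^ (length (bits m @ [True]) + ?k)" by simp
  finally show ?case by (simp add: numenc_eq[of m])
qed simp

lemma length_in_concat: "x \<in> set xs \<Longrightarrow> length x \<le> length (concat xs)"
  by (induction xs) auto

lemma transl_valid:
  assumes "level_inst n w = Some (ms, f)" "length (syms w) \<le> L"
  shows "transl n L w = fenc (ren ms L f)" "sum_list ms \<le> 2 ^ L"
proof -
  note i = level_inst_SomeD[OF assms(1)]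
  have w: "syms w = numenc n @ concat (map numenc ms) @ fenc f"
    using i by (simp add: syms_inst_enc isyms_def)
  have p: "rdn (Suc n) (syms w) = (map (\<lambda>n. map b2n (bits n)) (n # ms), fenc f)"
    using rdn_numencs[of "n # ms" "fenc f"] i(2) w by simp
  have lc: "length (concat (map numenc ms)) \<le> L" using assms(2) w by simp
  have "(2::nat) ^ length (concat (map numenc ms)) \<le> 2 ^ L" using lc by (intro power_increasing) auto
  then show s: "sum_list ms \<le> 2 ^ L" using sum_list_le_power[of ms] by linarith
  let ?Ds = "map (\<lambda>d. pad L (n2b d)) (map (\<lambda>n. map b2n (bits n)) ms)"
  have len: "length (bits m) \<le> L" if "m \<in> set ms" for m
  proof -
    have "length (numenc m) \<le> length (concat (map numenc ms))"
      using that by (intro length_in_concat) auto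
    then show ?thesis using lc by (simp add: numenc_eq)
  qed
  interpret scanner n L ?Ds ms
    by standard (use i len in \<open>auto simp: length_pad comp_def\<close>)
  obtain b' where "scan n ?Ds L (fenc f) = (False, 0, b', fenc (ren ms L f), True)"
    using run_fenc[OF s i(4), of 0 "[]" "[]"] by (auto simp: scan_def)
  then show "transl n L w = fenc (ren ms L f)"
    using i(3) digits_ok_bits by (simp add: transl_def p list_all_iff Let_def comp_def del: rdn.simps)
qed

text \<open>Contrapositively, if all checks succeed, the parsed parts reassemble to
  \<open>w\<close>, which is then a valid instance.\<close>

lemma transl_invalid:
  assumes "level_inst n w = None" "length (syms w) \<le> L"
  shows "transl n L w = fenc falsum"
proof (rule ccontr)
  let ?p = "rdn (Suc n) (syms w)"
  let ?Ds = "map (\<lambda>d. pad L (n2b d)) (tl (fst ?p))"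
  let ?s = "scan n ?Ds L (snd ?p)"
  assume "transl n L w \<noteq> fenc falsum"
  then have a: "hd (fst ?p) = map b2n (bits n)" "\<forall>d\<in>set (tl (fst ?p)). digits_ok d" "ok ?s" "\<not> in_num ?s" "need ?s = 0"
    by (auto simp: transl_def Let_def list_all_iff split: if_splits)
  define ms where "ms = map (\<lambda>d. bval (n2b d)) (tl (fst ?p))"
  have fp: "fst ?p = map (\<lambda>m. map b2n (bits m)) (n # ms)"
  proof -
    have "fst ?p \<noteq> []" using length_rdn[of "Suc n" "syms w"] by auto
    then have "fst ?p = hd (fst ?p) # tl (fst ?p)" by simp
    moreover have "tl (fst ?p) = map (\<lambda>m. map b2n (bits m)) ms"
      unfolding ms_def map_map comp_def using a(2) digits_okD(1) by (intro map_idI[symmetric]) metis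
    ultimately show ?thesis using a(1) by simp
  qed
  have lm: "length ms = n" using length_rdn[of "Suc n" "syms w"] by (simp add: ms_def del: rdn.simps)
  have "snd ?p \<noteq> []" using a(5) by (auto simp: scan_def)
  note s = rdn_sound[OF this]
  have len: "length d \<le> L" if "d \<in> set (fst ?p)" for d
  proof -
    have "length (d @ [2]) \<le> length (concat (map (\<lambda>d. d @ [2]) (fst ?p)))"
      using that by (intro length_in_concat) auto
    also have "\<dots> \<le> length (syms w)" by (subst (2) s) simp
    finally show ?thesis using assms(2) by simp
  qed
  have "set (tl (fst ?p)) \<subseteq> set (fst ?p)" by (metis fp list.set_intros(2) list.sel(3) list.simps(9) subsetI)
  then interpret scanner n L ?Ds ms
    by unfold_locales (use lm len in \<open>auto simp: ms_def length_pad n2b_def comp_def simp del: rdn.simps\<close>)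
  obtain fs where fs: "length fs = 1" "snd ?p = concat (map fenc fs)" "\<forall>f\<in>set fs. fvars_below (sum_list ms) f"
    using run_sound[OF refl, of 1 "[]" "[]" "snd ?p"] a(3-5) by (auto simp: scan_def simp del: rdn.simps)
  then obtain f where f: "snd ?p = fenc f" "fvars_below (sum_list ms) f"
    by (cases fs) (auto simp del: rdn.simps)
  have "syms w = isyms (ms, f)"
    using s unfolding fp f by (simp add: isyms_def lm numenc_eq[abs_def] comp_def del: rdn.simps)
  moreover have "\<forall>s\<in>set (isyms (ms, f)). s < 4" by (rule isyms_less)
  ultimately have "w = inst_enc (ms, f)"
    using sym_bits_syms[of w] by (auto simp: inst_enc_def isyms_def)
  moreover have "\<forall>m\<in>set ms. 1 \<le> m" using a(2) digits_okD(2) by (auto simp: ms_def simp del: rdn.simps)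
  ultimately show False using assms(1) level_inst_inst_enc[OF lm _ f(2)] by simp
qed

section \<open>Quantified satisfiability\<close>

lemma sat_cosat_cong:
  "(\<And>z. length z = sum_list ms \<Longrightarrow> g z = h z) \<Longrightarrow> sat ms g = sat ms h \<and> cosat ms g = cosat ms h"
proof (induction ms arbitrary: g h)
  case (Cons m ms)
  have "sat ms (\<lambda>y. g (x @ y)) = sat ms (\<lambda>y. h (x @ y)) \<and> cosat ms (\<lambda>y. g (x @ y)) = cosat ms (\<lambda>y. h (x @ y))"
    if "length x = m" for x
    by (rule Cons.IH) (use that Cons.prems in auto)
  then show ?case by auto
qed auto

lemma sat_cosat_not:
  "sat ms (\<lambda>y. \<not> g y) = (\<not> cosat ms g) \<and> cosat ms (\<lambda>y. \<not> g y) = (\<not> sat ms g)"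
  by (induction ms arbitrary: g) auto

lemma sat_cosat_const: "sat ms (\<lambda>_. c) = c \<and> cosat ms (\<lambda>_. c) = c"
proof (induction ms)
  case (Cons m ms)
  have "\<exists>x :: bool list. length x = m" by (rule exI[of _ "replicate m False"]) simp
  then show ?case using Cons by auto
qed simp

text \<open>Reads the original assignment off an assignment to the widened blocks, with \<open>k = 2 ^ L\<close>.\<close>
fun proj :: "nat \<Rightarrow> nat \<Rightarrow> nat list \<Rightarrow> bool list \<Rightarrow> bool list" where
  "proj k b [] z = []"
| "proj k b (m # ms) z = map (\<lambda>j. z ! (k + b + j)) [0..<m] @ proj k (b + m) ms (drop (2 * k) z)"

lemma proj_Cons_append:
  assumes "length x = 2 * k" "b + m \<le> k"
  shows "proj k b (m # ms) (x @ y) = map (\<lambda>j. x ! (k + b + j)) [0..<m] @ proj k (b + m) ms y"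
  using assms by (auto simp: nth_append)

text \<open>The selected positions start at \<open>k + b > 0\<close>, so position 0 can be
  prescribed independently of them.\<close>

lemma ex_preimage:
  fixes u :: "bool list"
  assumes "length u = m" "b + m \<le> k" "0 < k"
  shows "\<exists>x. length x = 2 * k \<and> hd x = c \<and> map (\<lambda>j. x ! (k + b + j)) [0..<m] = u"
proof -
  define x where "x = map (\<lambda>i. if i = 0 then c else i - (k + b) < m \<and> u ! (i - (k + b))) [0..<2 * k]"
  have "length x = 2 * k" by (simp add: x_def)
  moreover have "hd x = c" using assms by (simp add: x_def hd_map)
  moreover have "map (\<lambda>j. x ! (k + b + j)) [0..<m] = u"
    by (rule nth_equalityI) (use assms in \<open>auto simp: x_def\<close>)
  ultimately show ?thesis by blast
qed

text \<open>Every assignment to a narrow block is read off some widened one, so both quantifiers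
  keep their meaning block by block. \<open>b\<close> is the total dimension of the earlier blocks:
  variables keep their global number as offset.\<close>

lemma sat_cosat_proj:
  "0 < k \<Longrightarrow> b + sum_list ms \<le> k \<Longrightarrow>
    sat (replicate (length ms) (2 * k)) (\<lambda>z. g (proj k b ms z)) = sat ms g \<and>
    cosat (replicate (length ms) (2 * k)) (\<lambda>z. g (proj k b ms z)) = cosat ms g"
proof (induction ms arbitrary: b g)
  case (Cons m ms)
  let ?r = "\<lambda>x::bool list. map (\<lambda>j. x ! (k + b + j)) [0..<m]" and ?ks = "replicate (length ms) (2 * k)"
  have 1: "sat ?ks (\<lambda>y. g (proj k b (m # ms) (x @ y))) = sat ms (\<lambda>y. g (?r x @ y)) \<and>
      cosat ?ks (\<lambda>y. g (proj k b (m # ms) (x @ y))) = cosat ms (\<lambda>y. g (?r x @ y))"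
    if "length x = 2 * k" for x
  proof -
    have "(\<lambda>y. g (proj k b (m # ms) (x @ y))) = (\<lambda>y. g (?r x @ proj k (b + m) ms y))"
      using proj_Cons_append[OF that, of b m ms] Cons.prems by (simp add: fun_eq_iff del: proj.simps)
    then show ?thesis using Cons.IH[of "b + m" "\<lambda>y. g (?r x @ y)"] Cons.prems by simp
  qed
  have 2: "\<exists>x. length x = 2 * k \<and> ?r x = u" if "length u = m" for u :: "bool list"
    using ex_preimage[OF that, of b k] Cons.prems by auto
  have 3: "length (?r x) = m" for x :: "bool list" by simp
  have "(\<exists>x. length x = 2 * k \<and> cosat ms (\<lambda>y. g (?r x @ y))) = (\<exists>u. length u = m \<and> cosat ms (\<lambda>y. g (u @ y)))"
    using 2 3 by metis
  moreover have "(\<forall>x. length x = 2 * k \<longrightarrow> sat ms (\<lambda>y. g (?r x @ y))) = (\<forall>u. length u = m \<longrightarrow> sat ms (\<lambda>y. g (u @ y)))"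
    using 2 3 by metis
  ultimately show ?case using 1 by (simp del: proj.simps cong: conj_cong imp_cong)
qed simp

text \<open>The first bit is free: a witness for the original function can be widened with either
  value of the selector.\<close>

lemma ex_first_block_proj:
  assumes "0 < k" "sum_list (m # ms) \<le> k"
  shows "(\<exists>x. length x = 2 * k \<and> hd x = c \<and>
      cosat (replicate (length ms) (2 * k)) (\<lambda>y. g (proj k 0 (m # ms) (x @ y)))) \<longleftrightarrow> sat (m # ms) g"
proof -
  let ?r = "\<lambda>x::bool list. map (\<lambda>j. x ! (k + 0 + j)) [0..<m]" and ?ks = "replicate (length ms) (2 * k)"
  have 1: "cosat ?ks (\<lambda>y. g (proj k 0 (m # ms) (x @ y))) = cosat ms (\<lambda>y. g (?r x @ y))"
    if "length x = 2 * k" for x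
  proof -
    have "(\<lambda>y. g (proj k 0 (m # ms) (x @ y))) = (\<lambda>y. g (?r x @ proj k m ms y))"
      using proj_Cons_append[OF that, of 0 m ms] assms by (simp add: fun_eq_iff del: proj.simps)
    then show ?thesis using sat_cosat_proj[of k m ms "\<lambda>y. g (?r x @ y)"] assms by simp
  qed
  have 2: "\<exists>x. length x = 2 * k \<and> hd x = c \<and> ?r x = u" if "length u = m" for u :: "bool list"
    using ex_preimage[OF that, of 0 k c] assms by auto
  have 3: "length (?r x) = m" for x :: "bool list" by simp
  have "(\<exists>x. length x = 2 * k \<and> hd x = c \<and> cosat ms (\<lambda>y. g (?r x @ y))) = (\<exists>u. length u = m \<and> cosat ms (\<lambda>y. g (u @ y)))"
    using 2 3 by metis
  then show ?thesis using 1 by (simp del: proj.simps cong: conj_cong)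
qed

lemma nth_proj:
  "blk ms v = Some i \<Longrightarrow> length z = length ms * (2 * k) \<Longrightarrow>
    proj k b ms z ! v = z ! (i * (2 * k) + (k + b + v))"
proof (induction ms arbitrary: b v i z)
  case (Cons m ms)
  show ?case
  proof (cases "v < m")
    case True
    then show ?thesis using Cons.prems by (simp add: nth_append)
  next
    case False
    then obtain i' where i: "blk ms (v - m) = Some i'" "i = Suc i'" using Cons.prems(1) by auto
    have "proj k (b + m) ms (drop (2 * k) z) ! (v - m) = drop (2 * k) z ! (i' * (2 * k) + (k + (b + m) + (v - m)))"
      by (rule Cons.IH[OF i(1)]) (use Cons.prems in simp)
    also have "\<dots> = z ! (2 * k + (i' * (2 * k) + (k + (b + m) + (v - m))))"
      using Cons.prems by (intro nth_drop) simp
    also have "2 * k + (i' * (2 * k) + (k + (b + m) + (v - m))) = i * (2 * k) + (k + b + v)"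
      using False i(2) by simp
    finally show ?thesis using False by (simp add: nth_append)
  qed
qed simp

lemma feval_ren:
  "fvars_below (sum_list ms) f \<Longrightarrow> length z = length ms * (2 * 2 ^ L) \<Longrightarrow>
    feval (ren ms L f) z = feval f (proj (2 ^ L) 0 ms z)"
proof (induction f)
  case (FVar v)
  then obtain i where i: "blk ms v = Some i" using blk_eq_None_iff[of ms v] by fastforce
  \<comment> \<open>Start of block \<open>i\<close> plus the offset \<open>2 ^ L + v\<close> inside
    it.\<close>
  have "(2 * i + 1) * 2 ^ L + v = i * (2 * 2 ^ L) + (2 ^ L + 0 + v)" by (simp add: algebra_simps)
  then show ?case using nth_proj[OF i FVar(2), of 0] by (simp only: feval.simps ren.simps i option.sel)
qed auto

lemma fvars_below_ren:
  "fvars_below (sum_list ms) f \<Longrightarrow> sum_list ms \<le> 2 ^ L \<Longrightarrow>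
    fvars_below (length ms * (2 * 2 ^ L)) (ren ms L f)"
proof (induction f)
  case (FVar v)
  then obtain i where i: "blk ms v = Some i" using blk_eq_None_iff[of ms v] by fastforce
  have "v < 2 ^ L" using FVar by simp
  then have "(2 * i + 1) * 2 ^ L + v < Suc i * (2 * 2 ^ L)" by (simp add: algebra_simps)
  also have "\<dots> \<le> length ms * (2 * 2 ^ L)" using blk_less[OF i] by (intro mult_le_mono1) simp
  finally show ?case using i by simp
qed auto

text \<open>What the merged instance needs to know about a component formula \<open>F\<close> standing for a
  level-\<open>n\<close> instance with values \<open>s = SAT\<close> and \<open>t = coSAT\<close>.\<close>
definition component :: "nat \<Rightarrow> nat \<Rightarrow> form \<Rightarrow> bool \<Rightarrow> bool \<Rightarrow> bool" where
  "component n k F s t \<longleftrightarrow> fvars_below (n * (2 * k)) F \<and> (\<forall>c.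
     (\<exists>x. length x = 2 * k \<and> hd x = c \<and> cosat (replicate (n - 1) (2 * k)) (\<lambda>y. feval F (x @ y))) = s \<and>
     (\<exists>x. length x = 2 * k \<and> hd x = c \<and> cosat (replicate (n - 1) (2 * k)) (\<lambda>y. \<not> feval F (x @ y))) = (\<not> t))"

text \<open>Negation swaps \<open>sat\<close> and \<open>cosat\<close>, which turns failure of coSAT
  into existence of a first block.\<close>

lemma component_ren:
  assumes "length ms = n" "1 \<le> n" "fvars_below (sum_list ms) f" "sum_list ms \<le> 2 ^ L"
  shows "component n (2 ^ L) (ren ms L f) (sat ms (feval f)) (cosat ms (feval f))"
proof -
  obtain m ms' where ms: "ms = m # ms'" using assms(1,2) by (cases ms) auto
  have n: "n - 1 = length ms'" using assms(1) ms by simp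
  let ?ks = "replicate (length ms') (2 * 2 ^ L)"
  have e: "feval (ren ms L f) (x @ y) = feval f (proj (2 ^ L) 0 ms (x @ y))"
    if "length x = 2 * 2 ^ L" "length y = sum_list ?ks" for x y
    using that ms by (intro feval_ren[OF assms(3)]) (simp add: sum_list_replicate)
  have "cosat ?ks (\<lambda>y. feval (ren ms L f) (x @ y)) = cosat ?ks (\<lambda>y. feval f (proj (2 ^ L) 0 ms (x @ y)))"
    "cosat ?ks (\<lambda>y. \<not> feval (ren ms L f) (x @ y)) = cosat ?ks (\<lambda>y. \<not> feval f (proj (2 ^ L) 0 ms (x @ y)))"
    if "length x = 2 * 2 ^ L" for x
    using sat_cosat_cong[of ?ks "\<lambda>y. feval (ren ms L f) (x @ y)" "\<lambda>y. feval f (proj (2 ^ L) 0 ms (x @ y))"]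
      sat_cosat_cong[of ?ks "\<lambda>y. \<not> feval (ren ms L f) (x @ y)" "\<lambda>y. \<not> feval f (proj (2 ^ L) 0 ms (x @ y))"]
      e[OF that] by blast+
  then show ?thesis
    using ex_first_block_proj[of "2 ^ L" m ms' _ "feval f"] ex_first_block_proj[of "2 ^ L" m ms' _ "\<lambda>z. \<not> feval f z"]
      assms(4) fvars_below_ren[OF assms(3,4)] sat_cosat_not[of ms "feval f"] assms(1)
    unfolding component_def n ms[symmetric] by (simp cong: conj_cong)
qed

lemma component_falsum: "1 \<le> n \<Longrightarrow> 0 < k \<Longrightarrow> component n k falsum False False"
proof -
  assume "1 \<le> n" "0 < k"
  moreover have "\<exists>x :: bool list. length x = 2 * k \<and> hd x = c" for c
    using \<open>0 < k\<close> by (intro exI[of _ "replicate (2 * k) c"]) simp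
  ultimately show ?thesis
    using sat_cosat_const[of "replicate (n - 1) (2 * k)"] by (simp add: component_def falsum_def)
qed

definition merged :: "form \<Rightarrow> form \<Rightarrow> form" where
  "merged F G = FOr (FAnd (FVar 0) F) (FAnd (FNeg (FVar 0)) (FNeg G))"

text \<open>\<open>UNIV\<close> arises in two ways: for \<open>s\<close> and not \<open>t'\<close>
  both selectors have witnesses, and for \<open>t'\<close> and not \<open>s\<close> there is none
  and \<open>VAL\<close> allows everything.\<close>

lemma VAL_merged:
  assumes "1 \<le> n" "0 < k" "component n k F s t" "component n k G s' t'"
  shows "VAL n (inst_enc (replicate n (2 * k), merged F G)) \<subseteq>
    (if s then (if t' then {True} else UNIV) else (if t' then UNIV else {False}))"
    (is "_ \<subseteq> ?R")
proof -
  obtain j where n: "n = Suc j" using assms(1) by (cases n) auto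
  let ?h = "merged F G" and ?ks = "replicate n (2 * k)" and ?js = "replicate j (2 * k)"
  have li: "level_inst n (inst_enc (?ks, ?h)) = Some (?ks, ?h)"
    using assms by (intro level_inst_inst_enc) (auto simp: merged_def component_def sum_list_replicate)
  have f: "feval ?h (x @ y) = (if hd x then feval F (x @ y) else \<not> feval G (x @ y))" if "length x = 2 * k" for x y
    using that assms(2) by (cases x) (auto simp: merged_def)
  have e: "cosat ?js (\<lambda>y. feval ?h (x @ y)) =
      (if hd x then cosat ?js (\<lambda>y. feval F (x @ y)) else cosat ?js (\<lambda>y. \<not> feval G (x @ y)))"
    if "length x = 2 * k" for x
    using f[OF that] by (cases "hd x") simp_all
  \<comment> \<open>\<open>W c\<close> says that some witness starts with \<open>c\<close>; thus
    \<open>W\<close> describes the answers allowed by \<open>VAL\<close> whenever there is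
    one.\<close>
  define W where "W c \<longleftrightarrow> (\<exists>x. length x = 2 * k \<and> hd x = c \<and> cosat ?js (\<lambda>y. feval ?h (x @ y)))" for c
  have "(\<exists>x. length x = 2 * k \<and> hd x = True \<and> cosat ?js (\<lambda>y. feval F (x @ y))) = s"
    using assms(3) unfolding component_def n diff_Suc_1 by blast
  then have "W True = s" by (simp add: e W_def cong: conj_cong)
  moreover have "(\<exists>x. length x = 2 * k \<and> hd x = False \<and> cosat ?js (\<lambda>y. \<not> feval G (x @ y))) = (\<not> t')"
    using assms(4) unfolding component_def n diff_Suc_1 by blast
  then have "W False = (\<not> t')" by (simp add: e W_def cong: conj_cong)
  ultimately have W: "W c = (if c then s else \<not> t')" for c by (cases c) auto
  have "VAL n (inst_enc (?ks, ?h)) = (if (\<exists>c. W c) then {c. W c} else UNIV)"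
    unfolding VAL_def li W_def using n by (auto simp: val_def)
  then show ?thesis unfolding W by (cases s; cases t') auto
qed

section \<open>Restricting the first bit\<close>

text \<open>Answer 1 is backed by a witness starting with 1. Answer 0 says that no witness does, so
  any existing witness starts with 0.\<close>

lemma val_sat_and_first:
  assumes "1 \<le> m"
  shows "{sat (m # ms) (\<lambda>z. z ! 0 \<and> g z)} \<subseteq> val (m # ms) g"
proof -
  have "cosat ms (\<lambda>y. (x @ y) ! 0 \<and> g (x @ y)) = (hd x \<and> cosat ms (\<lambda>y. g (x @ y)))" if "length x = m" for x
  proof -
    have "(x @ y) ! 0 = hd x" for y using that assms by (cases x) auto
    then show ?thesis using sat_cosat_const[of ms False] by (cases "hd x") auto
  qed
  then have "sat (m # ms) (\<lambda>z. z ! 0 \<and> g z) \<longleftrightarrow> (\<exists>x. length x = m \<and> hd x \<and> cosat ms (\<lambda>y. g (x @ y)))"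
    by (auto cong: conj_cong)
  then show ?thesis by (cases "sat (m # ms) g") (auto simp: val_def)
qed

text \<open>Answer 1 says that no first block starting with 0 is a witness, so any existing witness
  starts with 1. Answer 0 exhibits one starting with 0.\<close>

lemma val_cosat_or_first:
  assumes "1 \<le> m"
  shows "{cosat (m # ms) (\<lambda>z. z ! 0 \<or> \<not> g z)} \<subseteq> val (m # ms) g"
proof -
  have "sat ms (\<lambda>y. (x @ y) ! 0 \<or> \<not> g (x @ y)) = (hd x \<or> \<not> cosat ms (\<lambda>y. g (x @ y)))" if "length x = m" for x
  proof -
    have "(x @ y) ! 0 = hd x" for y using that assms by (cases x) auto
    then show ?thesis using sat_cosat_const[of ms True] sat_cosat_not[of ms "\<lambda>y. g (x @ y)"] by (cases "hd x") auto
  qed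
  then have "cosat (m # ms) (\<lambda>z. z ! 0 \<or> \<not> g z) \<longleftrightarrow> (\<forall>x. length x = m \<and> \<not> hd x \<longrightarrow> \<not> cosat ms (\<lambda>y. g (x @ y)))"
    by auto
  then show ?thesis by (cases "sat (m # ms) g") (auto simp: val_def)
qed

lemma SAT_prefix_subset_VAL:
  assumes "1 \<le> n" "level_inst n w = Some (ms, f)"
  shows "SAT n (inst_enc (ms, FAnd (FVar 0) f)) \<subseteq> VAL n w"
    and "coSAT n (inst_enc (ms, FOr (FVar 0) (FNeg f))) \<subseteq> VAL n w"
proof -
  note i = level_inst_SomeD[OF assms(2)]
  obtain m ms' where ms: "ms = m # ms'" "1 \<le> m" using assms(1) i by (cases ms) auto
  have "level_inst n (inst_enc (ms, FAnd (FVar 0) f)) = Some (ms, FAnd (FVar 0) f)"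
    "level_inst n (inst_enc (ms, FOr (FVar 0) (FNeg f))) = Some (ms, FOr (FVar 0) (FNeg f))"
    using i ms by (auto intro!: level_inst_inst_enc)
  then show "SAT n (inst_enc (ms, FAnd (FVar 0) f)) \<subseteq> VAL n w"
    "coSAT n (inst_enc (ms, FOr (FVar 0) (FNeg f))) \<subseteq> VAL n w"
    using val_sat_and_first[OF ms(2), of ms' "feval f"] val_cosat_or_first[OF ms(2), of ms' "feval f"] assms(2)
    unfolding SAT_def coSAT_def VAL_def by (simp_all add: ms)
qed

section \<open>The reductions run in polynomial time\<close>

lemma sz_bool_list: "sz (xs :: bool list) = 3 * length xs"
  by (induction xs) auto

lemma pt_sum_bools: "pt f \<Longrightarrow> pt g \<Longrightarrow> pt (\<lambda>x. 2 * of_bool (f x) + of_bool (g x) :: nat)"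
  by (rule pt_bool2I)

lemma pt_tobits: "pt f \<Longrightarrow> pt (\<lambda>x. tobits (f x))"
proof -
  assume *: "pt f"
  have "pt symb" unfolding symb_def by (rule pt_nat_table[OF pt_id])
  then show ?thesis unfolding tobits_def by (intro pt_intros * pt_comp[OF \<open>pt symb\<close>])
qed

text \<open>The first component holds the pending first bit of a pair; one left over at the end
  marks odd length.\<close>

definition syms1 :: "bool list \<times> nat list \<Rightarrow> bool \<Rightarrow> bool list \<times> nat list" where
  "syms1 s b = (if fst s = [] then ([b], snd s)
     else ([], (2 * of_bool (hd (fst s)) + of_bool b) # snd s))"

lemma syms_foldl:
  "rev (snd (foldl syms1 ([], acc) w)) @ (if fst (foldl syms1 ([], acc) w) = [] then [] else [4])
    = rev acc @ syms w"
  by (induction w arbitrary: acc rule: syms.induct) (simp_all add: syms1_def)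

lemma pt_syms: "pt f \<Longrightarrow> pt (\<lambda>x. syms (f x))"
proof -
  assume *: "pt f"
  have "pt (\<lambda>x. foldl syms1 ([], []) (f x))"
  proof (rule pt_foldl_growth[where m = sz and K = 1 and D = "\<lambda>_. 7"])
    show "pt (\<lambda>p::'a \<times> (bool list \<times> nat list) \<times> bool. syms1 (fst (snd p)) (snd (snd p)))"
      unfolding syms1_def by (intro pt_intros pt_sum_bools)
    show "sz (syms1 st e) \<le> sz st + 7" for st e
      by (cases st) (auto simp: syms1_def)
  qed (auto intro!: pb_intros pt_intros *)
  then have "pt (\<lambda>x. rev (snd (foldl syms1 ([], []) (f x))) @
      (if fst (foldl syms1 ([], []) (f x)) = [] then [] else [4]))"
    by (intro pt_intros)
  then show ?thesis by (simp only: syms_foldl rev.simps append_Nil)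
qed

lemma pt_rdn: "pt f \<Longrightarrow> pt (\<lambda>x. rdn k (f x))"
proof (induction k arbitrary: f)
  case 0
  then show ?case by (simp only: rdn.simps) (intro pt_intros)
next
  case (Suc k)
  have "pt (\<lambda>x. rdn k (tl (dropWhile (\<lambda>a. a \<noteq> 2) (f x))))"
    by (rule Suc.IH) (intro pt_intros Suc.prems)
  then show ?case by (simp only: rdn.simps) (intro pt_intros Suc.prems)
qed

lemma pt_digits_ok: "pt f \<Longrightarrow> pt (\<lambda>x. digits_ok (f x))"
  unfolding digits_ok_def by (intro pt_intros)

lemma pt_n2b: "pt f \<Longrightarrow> pt (\<lambda>x. n2b (f x))"
  unfolding n2b_def by (intro pt_intros)

lemma pt_map_b2n: "pt f \<Longrightarrow> pt (\<lambda>x. map b2n (f x))"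
  unfolding b2n_def by (intro pt_intros)

lemma pt_pad: "pt f \<Longrightarrow> pt g \<Longrightarrow> pt (\<lambda>x. pad (f x) (g x))"
  unfolding pad_def by (intro pt_intros)

lemma pt_zip: "pt f \<Longrightarrow> pt g \<Longrightarrow> pt (\<lambda>x. zip (f x) (g x))"
proof -
  assume *: "pt f" "pt g"
  define h where "h s e = (if fst s = [] then s else (tl (fst s), (e, hd (fst s)) # snd s))"
    for s :: "'c list \<times> ('b \<times> 'c) list" and e :: 'b
  have h: "h ([], acc) e = ([], acc)" "h (y # ys, acc) e = (ys, (e, y) # acc)" for y ys acc e
    by (simp_all add: h_def)
  have N: "foldl h ([], acc) xs = ([], acc)" for acc xs by (induction xs) (auto simp: h)
  have Z: "snd (foldl h (ys, acc) xs) = rev (zip xs ys) @ acc" for acc xs ys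
  proof (induction xs arbitrary: ys acc)
    case (Cons x xs)
    show ?case by (cases ys) (simp_all add: N Cons h)
  qed simp
  have "pt (\<lambda>x. foldl h (g x, []) (f x))"
  proof (rule pt_foldl_growth[where m = sz and K = 1 and D = "\<lambda>x. 4 * sz (f x) + 3"])
    show "pt (\<lambda>p::'a \<times> ('c list \<times> ('b \<times> 'c) list) \<times> 'b. h (fst (snd p)) (snd (snd p)))"
      unfolding h_def by (intro pt_intros)
    show "sz (h st e) \<le> sz st + (4 * sz (f x) + 3)" if "e \<in> set (f x)" for x st e
      using sz_in_set[OF that] by (cases st; cases "fst st") (auto simp: h_def)
  qed (auto intro!: pb_intros pb_sz pt_intros *)
  then have "pt (\<lambda>x. rev (snd (foldl h (g x, []) (f x))))" by (intro pt_intros)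
  then show ?thesis by (simp add: Z)
qed

lemma pt_subb: "pt f \<Longrightarrow> pt g \<Longrightarrow> pt (\<lambda>x. subb (f x) (g x))"
proof -
  assume *: "pt f" "pt g"
  have "pt (\<lambda>x. foldl sub1 ([], False) (zip (rev (f x)) (rev (g x))))"
  proof (rule pt_foldl_growth[where m = sz and K = 1 and D = "\<lambda>x. 6"])
    show "pt (\<lambda>p::'a \<times> (bool list \<times> bool) \<times> bool \<times> bool. sub1 (fst (snd p)) (snd (snd p)))"
      unfolding sub1_def by (intro pt_intros)
    show "sz (sub1 st e) \<le> sz st + 6" for st e
      by (cases st) (auto simp: sub1_def)
  qed (auto intro!: pb_intros pb_sz pt_intros pt_zip *)
  then show ?thesis by (simp only: subb_def)
qed

lemma length_subb_le: "length (fst (subb xs ys)) \<le> length xs"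
proof -
  have "length (fst (foldl sub1 s ps)) = length (fst s) + length ps" for s ps
    by (induction ps arbitrary: s) (auto simp: sub1_def)
  then show ?thesis by (simp add: subb_def)
qed

lemma pt_find: "pt v \<Longrightarrow> pt Ds \<Longrightarrow> pt (\<lambda>x. foldl find1 (v x, 0, False) (Ds x))"
proof -
  assume *: "pt v" "pt Ds"
  show ?thesis
  \<comment> \<open>A bit costs 3 in a list and the first component of a pair counts twice, whence
    \<open>K = 6\<close>.\<close>
  proof (rule pt_foldl_growth[where m = "\<lambda>s. length (fst s) + fst (snd s)" and K = 6 and D = "\<lambda>x. 1"])
    show "pt (\<lambda>p::'a \<times> (bool list \<times> nat \<times> bool) \<times> bool list. find1 (fst (snd p)) (snd (snd p)))"
      unfolding find1_def by (intro pt_intros pt_subb)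
    show "pb (\<lambda>x. length (fst (v x, 0, False)) + fst (snd (v x, 0, False)))"
      using pb_nat[OF pt_length[OF *(1)]] by simp
    show "sz st \<le> 6 * (length (fst st) + fst (snd st)) + 6" for st :: "bool list \<times> nat \<times> bool"
      by (cases st) (auto simp: sz_bool_list)
    show "length (fst (find1 st e)) + fst (snd (find1 st e)) \<le> length (fst st) + fst (snd st) + 1" for st e
      using length_subb_le[of "fst st" e] by (auto simp: find1_def)
  qed (auto intro!: pb_intros pt_intros *)
qed

lemma pt_prefix_digits: "pt f \<Longrightarrow> pt (\<lambda>x. prefix_digits n (f x))"
  unfolding prefix_digits_def by (rule pt_nat_table)

lemma pt_close_var:
  "pt Ds \<Longrightarrow> pt L \<Longrightarrow> pt s \<Longrightarrow> pt (\<lambda>x. close_var n (Ds x) (L x) (s x))"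
  unfolding close_var_def fail_def Let_def
  by (intro pt_intros pt_find pt_pad pt_prefix_digits pt_map_b2n)

lemma pt_less [pt_intros]: "pt f \<Longrightarrow> pt g \<Longrightarrow> pt (\<lambda>x. f x < (g x :: nat))"
proof -
  assume *: "pt f" "pt g"
  have "pt (\<lambda>x. g x - f x \<noteq> 0)" by (intro pt_intros *)
  moreover have "(\<lambda>x. g x - f x \<noteq> 0) = (\<lambda>x. f x < g x)" by (auto simp: fun_eq_iff)
  ultimately show ?thesis by simp
qed

lemma pt_scan1:
  "pt Ds \<Longrightarrow> pt L \<Longrightarrow> pt s \<Longrightarrow> pt a \<Longrightarrow> pt (\<lambda>x. scan1 n (Ds x) (L x) (s x) (a x))"
  unfolding scan1_def fail_def
  by (intro pt_intros pt_close_var)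

text \<open>The weight 3 is the size of a digit in a list, so closing a number moves digits from
  \<open>buf\<close> to \<open>outp\<close> without hidden growth.\<close>

definition scan_size :: "scan \<Rightarrow> nat" where
  "scan_size s = need s + 3 * length (buf s) + sz (outp s)"

lemma sz_map_b2n: "sz (map b2n ds) \<le> 3 * length ds"
  by (induction ds) (auto simp: b2n_def)

lemma scan_size_close_var:
  assumes "\<And>i. sz (prefix_digits n i) \<le> B"
  shows "scan_size (close_var n Ds L s) \<le> scan_size s + (B + 3 * L + 5)"
proof -
  have "sz (map b2n (pad L (buf s))) \<le> 3 * L + 3 * length (buf s)"
    using sz_map_b2n[of "pad L (buf s)"] by (simp add: pad_def)
  then show ?thesis
    using assms[of "fst (snd (foldl find1 (pad L (buf s), 0, False) Ds))"]
    by (simp add: scan_size_def close_var_def fail_def Let_def)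
qed

lemma scan_size_scan1:
  assumes "\<And>i. sz (prefix_digits n i) \<le> B"
  shows "scan_size (scan1 n Ds L s a) \<le> scan_size s + (B + 3 * L + 10)"
proof -
  have "scan_size (scan1 n Ds L s a) \<le> scan_size s + 10 \<or> scan1 n Ds L s a = close_var n Ds L s"
    by (auto simp: scan1_def scan_size_def fail_def)
  then show ?thesis using scan_size_close_var[of n B Ds L s] assms by fastforce
qed

lemma pt_scan:
  assumes "pt Ds" "pt L" "pt r"
  shows "pt (\<lambda>x. scan n (Ds x) (L x) (r x))"
proof -
  define B where "B = (\<Sum>i<n. sz (prefix_digits n i))"
  have B: "sz (prefix_digits n i) \<le> B" for i
  proof (cases "i < n")
    case True
    then show ?thesis unfolding B_def by (intro member_le_sum) auto
  next
    case False
    then show ?thesis by (simp add: prefix_digits_def)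
  qed
  have "pt (\<lambda>x. foldl (scan1 n (Ds x) (L x)) (False, 1, [], [], True) (r x))"
  proof (rule pt_foldl_growth[where m = scan_size and K = 7 and D = "\<lambda>x. B + 3 * L x + 10"])
    show "pt (\<lambda>p. scan1 n (Ds (fst p)) (L (fst p)) (fst (snd p)) (snd (snd p)))"
      by (intro pt_scan1 pt_comp[OF assms(1)] pt_comp[OF assms(2)] pt_intros)
    show "pb (\<lambda>x. B + 3 * L x + 10)" by (intro pb_intros pb_nat assms)
    show "sz st \<le> 7 * scan_size st + 7" for st
      by (cases st) (auto simp: scan_size_def sz_bool_list)
    show "scan_size (scan1 n (Ds x) (L x) st e) \<le> scan_size st + (B + 3 * L x + 10)" for x st e
      by (rule scan_size_scan1[OF B])
  qed (intro pb_intros pt_intros assms)+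
  then show ?thesis by (simp only: scan_def)
qed

lemma pt_transl:
  assumes "pt L" "pt w"
  shows "pt (\<lambda>x. transl n (L x) (w x))"
proof -
  have 1: "pt (\<lambda>x. rdn (Suc n) (syms (w x)))" by (intro pt_rdn pt_syms assms)
  have 2: "pt (\<lambda>x. map (\<lambda>d. pad (L x) (n2b d)) (tl (fst (rdn (Suc n) (syms (w x))))))"
    by (intro pt_intros pt_pad pt_n2b 1 pt_comp[OF assms(1)])
  have 3: "pt (\<lambda>x. scan n (map (\<lambda>d. pad (L x) (n2b d)) (tl (fst (rdn (Suc n) (syms (w x)))))) (L x)
      (snd (rdn (Suc n) (syms (w x)))))"
    by (intro pt_scan 2 assms pt_intros 1)
  show ?thesis unfolding transl_def Let_def
    by (intro pt_intros pt_digits_ok 1 3)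
qed

section \<open>Construction of the merged instance\<close>

text \<open>Written directly in symbols: \<open>1 # replicate (Suc L) 0 @ [2]\<close> is the number
  \<open>2 * 2 ^ L\<close>, \<open>[3, 2, 0, 2]\<close> opens \<open>FOr (FAnd (FVar 0) ...\<close>,
  and \<open>[2, 1, 0, 2, 1]\<close> opens \<open>FAnd (FNeg (FVar 0)) (FNeg ...\<close>. The number
  0 has no digits and is just the terminator 2.\<close>

definition merge :: "nat \<Rightarrow> bool list \<Rightarrow> bool list \<Rightarrow> bool list" where
  "merge n u v = (let L = length (syms u) + length (syms v) in
     tobits (numenc n @ concat (replicate n (1 # replicate (Suc L) 0 @ [2])) @
       [3, 2, 0, 2] @ transl n L u @ [2, 1, 0, 2, 1] @ transl n L v))"

lemma pt_merge: "pt f \<Longrightarrow> pt g \<Longrightarrow> pt (\<lambda>x. merge n (f x) (g x))"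
  unfolding merge_def Let_def
  by (intro pt_tobits pt_intros pt_transl pt_syms)

lemma numenc_power: "numenc (2 * 2 ^ L) = 1 # replicate (Suc L) 0 @ [2]"
proof -
  have "bits (1 * 2 ^ Suc L + 0) = bits 1 @ pad (Suc L) (bits 0)" by (rule bits_shift) auto
  then have "bits (2 * 2 ^ L) = True # replicate (Suc L) False" by (simp add: pad_def bits_pos[of "Suc 0"])
  then show ?thesis by (simp add: numenc_eq b2n_def del: replicate_Suc)
qed

lemma merge_eq:
  assumes "L = length (syms u) + length (syms v)" "transl n L u = fenc F" "transl n L v = fenc G"
  shows "merge n u v = inst_enc (replicate n (2 * 2 ^ L), merged F G)"
  using assms unfolding merge_def Let_def inst_enc_eq isyms_def merged_def
  by (simp add: map_replicate numenc_power del: replicate_Suc) (simp add: numenc_eq)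

text \<open>Valid and invalid strings get one interface, so merging needs no case distinction on the
  validity of its two inputs.\<close>

lemma ex_component:
  assumes "1 \<le> n" "length (syms w) \<le> L"
  shows "\<exists>F s t. transl n L w = fenc F \<and> component n (2 ^ L) F s t \<and> SAT n w = {s} \<and> coSAT n w = {t}"
proof (cases "level_inst n w")
  case None
  then show ?thesis
    using transl_invalid[OF None assms(2)] component_falsum[OF assms(1)]
    by (intro exI[of _ falsum] exI[of _ False]) (simp add: SAT_def coSAT_def)
next
  case (Some e)
  then obtain ms f where e: "level_inst n w = Some (ms, f)" by (cases e) auto
  note i = level_inst_SomeD[OF e]
  show ?thesis
    using transl_valid[OF e assms(2)] component_ren[OF i(2) assms(1) i(4)] e
    by (intro exI[of _ "ren ms L f"] exI[of _ "sat ms (feval f)"] exI[of _ "cosat ms (feval f)"])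
      (simp add: SAT_def coSAT_def)
qed

lemma inst_enc_neq_Nil: "inst_enc e \<noteq> []"
proof
  assume "inst_enc e = []"
  then have "isyms e = []" using syms_inst_enc[of e] by simp
  then show False by (simp add: isyms_def numenc_eq)
qed

lemma VAL_merge_subset:
  assumes "1 \<le> n" "SAT n u \<subseteq> X" "coSAT n v \<subseteq> X"
  shows "merge n u v \<noteq> [] \<and> VAL n (merge n u v) \<subseteq> X"
proof -
  let ?L = "length (syms u) + length (syms v)"
  obtain F s t where F: "transl n ?L u = fenc F" "component n (2 ^ ?L) F s t" "SAT n u = {s}"
    using ex_component[OF assms(1), of u ?L] le_add1 by blast
  obtain G s' t' where G: "transl n ?L v = fenc G" "component n (2 ^ ?L) G s' t'" "coSAT n v = {t'}"
    using ex_component[OF assms(1), of v ?L] le_add2 by blast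
  have "(if s then (if t' then {True} else UNIV) else (if t' then UNIV else {False})) \<subseteq> X"
    using assms(2,3) F(3) G(3) by (cases s; cases t') (auto simp: UNIV_bool)
  then show ?thesis
    using VAL_merged[OF assms(1) _ F(2) G(2)] inst_enc_neq_Nil
    unfolding merge_eq[OF refl F(1) G(1)] by (meson order_trans zero_less_numeral zero_less_power)
qed

text \<open>Puts connectives in front of the formula, after the \<open>Suc n\<close> numbers.
  Validity is not tested, because \<open>VAL\<close> allows every answer on invalid strings; only
  the output must be nonempty.\<close>

definition insert_prefix :: "nat \<Rightarrow> nat list \<Rightarrow> bool list \<Rightarrow> bool list" where
  "insert_prefix n p w = tobits (concat (map (\<lambda>d. d @ [2]) (fst (rdn (Suc n) (syms w)))) @ p
     @ snd (rdn (Suc n) (syms w)))"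

lemma pt_insert_prefix: "pt (insert_prefix n p)"
proof -
  have 1: "pt (\<lambda>w. rdn (Suc n) (syms w))" by (intro pt_rdn pt_syms pt_intros)
  show ?thesis unfolding insert_prefix_def by (intro pt_tobits pt_intros 1)
qed

lemma insert_prefix_neq_Nil: "p = a # q \<Longrightarrow> a < 4 \<Longrightarrow> insert_prefix n p w \<noteq> []"
  by (simp add: insert_prefix_def tobits_def symb_def sym_bits_def)

lemma insert_prefix_eq:
  assumes "level_inst n w = Some (ms, f)" "fenc f' = p @ fenc f"
  shows "insert_prefix n p w = inst_enc (ms, f')"
proof -
  note i = level_inst_SomeD[OF assms(1)]
  have "rdn (Suc n) (syms w) = (map (\<lambda>n. map b2n (bits n)) (n # ms), fenc f)"
    using rdn_numencs[of "n # ms" "fenc f"] i(1,2) by (simp add: syms_inst_enc isyms_def)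
  then show ?thesis
    unfolding insert_prefix_def inst_enc_eq isyms_def
    by (simp add: i(2) assms(2) numenc_eq[abs_def] comp_def)
qed

section \<open>Reducibility\<close>

lemma reduces_iff: "reduces \<phi> \<psi> \<longleftrightarrow> (\<exists>\<mu>. pt \<mu> \<and> (\<forall>x. x \<noteq> [] \<longrightarrow> \<mu> x \<noteq> [] \<and> \<psi> (\<mu> x) \<subseteq> \<phi> x))"
  by (simp add: reduces_def poly_time_computable_iff)

lemma reduces_trans:
  assumes "reduces \<phi> \<psi>" "reduces \<psi> \<chi>"
  shows "reduces \<phi> \<chi>"
proof -
  obtain \<mu> where \<mu>: "pt \<mu>" "\<And>x. x \<noteq> [] \<Longrightarrow> \<mu> x \<noteq> [] \<and> \<psi> (\<mu> x) \<subseteq> \<phi> x"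
    using assms(1) unfolding reduces_iff by blast
  obtain \<nu> where \<nu>: "pt \<nu>" "\<And>x. x \<noteq> [] \<Longrightarrow> \<nu> x \<noteq> [] \<and> \<chi> (\<nu> x) \<subseteq> \<psi> x"
    using assms(2) unfolding reduces_iff by blast
  have "\<nu> (\<mu> x) \<noteq> [] \<and> \<chi> (\<nu> (\<mu> x)) \<subseteq> \<phi> x" if "x \<noteq> []" for x
    using \<mu>(2)[OF that] \<nu>(2)[of "\<mu> x"] by blast
  then show ?thesis unfolding reduces_iff using pt_comp[OF \<nu>(1) \<mu>(1)] by blast
qed

lemma VAL_reduces:
  assumes "1 \<le> n"
  shows "reduces (VAL n) (SAT n)" "reduces (VAL n) (coSAT n)"
proof -
  \<comment> \<open>\<open>[2, 0, 2]\<close> opens \<open>FAnd (FVar 0)\<close>, and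
    \<open>[3, 0, 2, 1]\<close> opens \<open>FOr (FVar 0) (FNeg ...\<close>.\<close>
  have "insert_prefix n [2, 0, 2] w \<noteq> [] \<and> SAT n (insert_prefix n [2, 0, 2] w) \<subseteq> VAL n w
      \<and> insert_prefix n [3, 0, 2, 1] w \<noteq> [] \<and> coSAT n (insert_prefix n [3, 0, 2, 1] w) \<subseteq> VAL n w" for w
  proof (cases "level_inst n w")
    case None
    then show ?thesis by (simp add: VAL_def insert_prefix_neq_Nil)
  next
    case (Some e)
    then obtain ms f where e: "level_inst n w = Some (ms, f)" by (cases e) auto
    have "insert_prefix n [2, 0, 2] w = inst_enc (ms, FAnd (FVar 0) f)"
      "insert_prefix n [3, 0, 2, 1] w = inst_enc (ms, FOr (FVar 0) (FNeg f))"
      by (rule insert_prefix_eq[OF e]; simp add: numenc_eq)+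
    then show ?thesis using SAT_prefix_subset_VAL[OF assms e] inst_enc_neq_Nil by simp
  qed
  then show "reduces (VAL n) (SAT n)" "reduces (VAL n) (coSAT n)"
    unfolding reduces_iff using pt_insert_prefix by blast+
qed

lemma reduces_VAL:
  assumes "1 \<le> n" "reduces \<phi> (SAT n)" "reduces \<phi> (coSAT n)"
  shows "reduces \<phi> (VAL n)"
proof -
  obtain \<mu> where \<mu>: "pt \<mu>" "\<And>x. x \<noteq> [] \<Longrightarrow> SAT n (\<mu> x) \<subseteq> \<phi> x"
    using assms(2) unfolding reduces_iff by blast
  obtain \<nu> where \<nu>: "pt \<nu>" "\<And>x. x \<noteq> [] \<Longrightarrow> coSAT n (\<nu> x) \<subseteq> \<phi> x"
    using assms(3) unfolding reduces_iff by blast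
  show ?thesis unfolding reduces_iff
    using pt_merge[OF \<mu>(1) \<nu>(1), of n] VAL_merge_subset[OF assms(1) \<mu>(2) \<nu>(2)]
    by (intro exI[of _ "\<lambda>x. merge n (\<mu> x) (\<nu> x)"] conjI allI impI) simp_all
qed

theorem theorem9:
  fixes n :: nat
  assumes "1 \<le> n"
  shows "cls (VAL n) = cls (SAT n) \<inter> cls (coSAT n)"
  using VAL_reduces[OF assms] reduces_VAL[OF assms] reduces_trans unfolding cls_def by blast

end
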